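(* Let $G$ be a finite $2$-group such that $G_3\cong C_2$, $\Phi(G')G_3\cong C_2^2$, $G/\Phi(G')G_3\cong M_2(n,m,1)$ and the type of the abelian group $C_G(G')/\Phi(G')G_3$ is $(2^{n-1},2^m,2)$, where $n>m$. Let $w(G)=(w_{ij})$ be a characteristic matrix of $G$. Then: (1) $I_{\min}\ge2$; that is, $G$ does not have an $\mathcal{A}_1$-subgroup of index $2$. (2) $I_{\max}\ge m$. (3) $I_{\max}=2$ if and only if $m=2$ and one of the following holds: (i) $w_{11}=0$ and $w_{12}=1$; (ii) $w_{12}=0$ and $w_{11}=w_{22}=1$.
   Context: All groups are finite; $G_3=[G',G]$, $\Phi(H)$ is the Frattini subgroup of $H$, $[x,y]=x^{-1}y^{-1}xy$. An $\mathcal{A}_1$-group is a minimal non-abelian $p$-group (here $p=2$). For a finite non-abelian $2$-group $G$, $2^{I_{\min}}$ and $2^{I_{\max}}$ denote the minimal and the maximal index in $G$ of the $\mathcal{A}_1$-subgroups of $G$. $M_2(n,m,1)=\langle a,b,c\mid a^{2^n}=b^{2^m}=c^2=1,\ [a,b]=c,\ [c,a]=[c,b]=1\rangle$. An abelian group has type $(2^{e_1},2^{e_2},2^{e_3})$ if it is isomorphic to $C_{2^{e_1}}\times C_{2^{e_2}}\times C_{2^{e_3}}$. Characteristic matrix: choose $a,b\in G$ whose images $\tilde a,\tilde b$ in $G/\Phi(G')G_3\cong M_2(n,m,1)$ are generators satisfying, with $\tilde c=[\tilde a,\tilde b]$, the relations $\tilde a^{2^n}=\tilde b^{2^m}=\tilde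 c^2=1$, $[\tilde c,\tilde a]=[\tilde c,\tilde b]=1$ (image of $a$ of order $2^n$, image of $b$ of order $2^m$); put $c=[a,b]$. In the present case $[b,c]=1$ and $[a,c]\ne1$. Put $y=[a,c]$, so $G_3=\langle y\rangle$; $c$ has order $4$ and $\Phi(G')G_3=\langle c^2\rangle\times\langle y\rangle$. There are $w_{ij}\in F_2$ with $a^{2^n}=c^{2w_{11}}y^{w_{12}}$ and $b^{2^m}=c^{2w_{21}}y^{w_{22}}$. The matrix $w(G)=(w_{ij})$ is called a characteristic matrix of $G$ (it depends on the choice of $a,b$). *)

theory Defs
  imports
    "HOL-Algebra.Algebra"
    "HOL-Library.Z2"
    "HOL-Analysis.Finite_Cartesian_Product"
begin

section \<open>Groups given by generators and relations\<close>

text \<open>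
  A letter \<open>(x, True)\<close> stands for the generator \<open>x\<close>, and \<open>(x, False)\<close> for its formal inverse.
  A presentation is a set of pairs \<open>(u, v)\<close> of words, each read as the relation \<open>u = v\<close>;
  every element of the letter type is a generator.
\<close>

type_synonym 'x gword = "('x \<times> bool) list"

definition gen_word :: "'x \<Rightarrow> 'x gword" where
  "gen_word x = [(x, True)]"

definition inv_word :: "'x gword \<Rightarrow> 'x gword" where
  "inv_word u = rev (map (\<lambda>(x, s). (x, \<not> s)) u)"

definition pow_word :: "'x gword \<Rightarrow> nat \<Rightarrow> 'x gword" where
  "pow_word u k = concat (replicate k u)"

definition comm_word :: "'x gword \<Rightarrow> 'x gword \<Rightarrow> 'x gword" where
  "comm_word u v = inv_word u @ inv_word v @ u @ v"

inductive pres_eq :: "('x gword \<times> 'x gword) set \<Rightarrow> 'x gword \<Rightarrow> 'x gword \<Rightarrow> bool"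
  for R where
    refl: "pres_eq R u u"
  | sym: "pres_eq R u v \<Longrightarrow> pres_eq R v u"
  | trans: "pres_eq R u v \<Longrightarrow> pres_eq R v w \<Longrightarrow> pres_eq R u w"
  | append: "pres_eq R u u' \<Longrightarrow> pres_eq R v v' \<Longrightarrow> pres_eq R (u @ v) (u' @ v')"
  | cancel: "pres_eq R [(x, s), (x, \<not> s)] []"
  | rel: "(u, v) \<in> R \<Longrightarrow> pres_eq R u v"

definition word_class :: "('x gword \<times> 'x gword) set \<Rightarrow> 'x gword \<Rightarrow> 'x gword set" where
  "word_class R u = {v. pres_eq R u v}"

definition presented_group :: "('x gword \<times> 'x gword) set \<Rightarrow> 'x gword set monoid" where
  "presented_group R =
     \<lparr>carrier = range (word_class R),
      monoid.mult = (\<lambda>A B. {w. \<exists>u\<in>A. \<exists>v\<in>B. pres_eq R (u @ v) w}),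
      one = word_class R []\<rparr>"

lemma presented_group_mult:
  "word_class R u \<otimes>\<^bsub>presented_group R\<^esub> word_class R v = word_class R (u @ v)"
  unfolding presented_group_def word_class_def
  by (auto intro: pres_eq.trans pres_eq.append pres_eq.refl)

lemma word_class_eqI: "pres_eq R u v \<Longrightarrow> word_class R u = word_class R v"
  unfolding word_class_def by (auto intro: pres_eq.trans pres_eq.sym)

lemma inv_word_cancel: "pres_eq R (inv_word u @ u) []"
proof (induction u)
  case Nil
  then show ?case by (simp add: inv_word_def pres_eq.refl)
next
  case (Cons l u)
  obtain x s where l: "l = (x, s)" by fastforce
  have c: "pres_eq R ([(x, \<not> s)] @ [(x, s)]) []"
    using pres_eq.cancel[of R x "\<not> s"] by simp
  have "pres_eq R (inv_word u @ (([(x, \<not> s)] @ [(x, s)]) @ u)) (inv_word u @ ([] @ u))"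
    by (intro pres_eq.append pres_eq.refl c)
  then show ?case
    using Cons.IH pres_eq.trans by (fastforce simp: l inv_word_def)
qed

lemma group_presented_group: "group (presented_group R)"
proof (rule groupI)
  fix A B assume "A \<in> carrier (presented_group R)" "B \<in> carrier (presented_group R)"
  then obtain u v where "A = word_class R u" "B = word_class R v"
    by (auto simp: presented_group_def)
  then have "A \<otimes>\<^bsub>presented_group R\<^esub> B = word_class R (u @ v)"
    by (simp add: presented_group_mult)
  then show "A \<otimes>\<^bsub>presented_group R\<^esub> B \<in> carrier (presented_group R)"
    by (simp add: presented_group_def)
next
  fix A B C
  assume "A \<in> carrier (presented_group R)" "B \<in> carrier (presented_group R)"
    "C \<in> carrier (presented_group R)"
  then obtain u v w where "A = word_class R u" "B = word_class R v" "C = word_class R w"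
    by (auto simp: presented_group_def)
  then show "A \<otimes>\<^bsub>presented_group R\<^esub> B \<otimes>\<^bsub>presented_group R\<^esub> C =
      A \<otimes>\<^bsub>presented_group R\<^esub> (B \<otimes>\<^bsub>presented_group R\<^esub> C)"
    by (simp add: presented_group_mult)
next
  fix A assume "A \<in> carrier (presented_group R)"
  then obtain u where A: "A = word_class R u" by (auto simp: presented_group_def)
  have one: "\<one>\<^bsub>presented_group R\<^esub> = word_class R []"
    by (simp add: presented_group_def)
  show "\<one>\<^bsub>presented_group R\<^esub> \<otimes>\<^bsub>presented_group R\<^esub> A = A"
    by (simp add: A one presented_group_mult)
  have "word_class R (inv_word u) \<otimes>\<^bsub>presented_group R\<^esub> A = \<one>\<^bsub>presented_group R\<^esub>"
    by (simp add: A one presented_group_mult word_class_eqI inv_word_cancel)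
  moreover have "word_class R (inv_word u) \<in> carrier (presented_group R)"
    by (simp add: presented_group_def)
  ultimately show "\<exists>B\<in>carrier (presented_group R).
      B \<otimes>\<^bsub>presented_group R\<^esub> A = \<one>\<^bsub>presented_group R\<^esub>" by blast
qed (simp add: presented_group_def)

datatype gen3 = Gen_a | Gen_b | Gen_c

text \<open>The group \<open>M\<^sub>2(n, m, 1)\<close>.\<close>

definition M2_group :: "nat \<Rightarrow> nat \<Rightarrow> gen3 gword set monoid" where
  "M2_group n m =
     (let a = gen_word Gen_a; b = gen_word Gen_b; c = gen_word Gen_c
      in presented_group
          {(pow_word a (2 ^ n), []), (pow_word b (2 ^ m), []), (pow_word c 2, []),
           (comm_word a b, c), (comm_word c a, []), (comm_word c b, [])})"

section \<open>Subgroups of a group\<close>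

definition commutator :: "('a, 'b) monoid_scheme \<Rightarrow> 'a \<Rightarrow> 'a \<Rightarrow> 'a" where
  "commutator G x y = inv\<^bsub>G\<^esub> x \<otimes>\<^bsub>G\<^esub> inv\<^bsub>G\<^esub> y \<otimes>\<^bsub>G\<^esub> x \<otimes>\<^bsub>G\<^esub> y"

definition commutator_subgroup ::
    "('a, 'b) monoid_scheme \<Rightarrow> 'a set \<Rightarrow> 'a set \<Rightarrow> 'a set" where
  "commutator_subgroup G H K = generate G {commutator G h k | h k. h \<in> H \<and> k \<in> K}"

text \<open>
  The library's \<^const>\<open>derived\<close> uses the commutators \<open>x y x\<^sup>-\<^sup>1 y\<^sup>-\<^sup>1\<close>, which form the same set
  as the commutators \<open>x\<^sup>-\<^sup>1 y\<^sup>-\<^sup>1 x y\<close>.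
\<close>

abbreviation derived_subgroup :: "('a, 'b) monoid_scheme \<Rightarrow> 'a set" where
  "derived_subgroup G \<equiv> derived G (carrier G)"

definition G3 :: "('a, 'b) monoid_scheme \<Rightarrow> 'a set" where
  "G3 G = commutator_subgroup G (derived_subgroup G) (carrier G)"

definition maximal_subgroup :: "'a set \<Rightarrow> ('a, 'b) monoid_scheme \<Rightarrow> bool" where
  "maximal_subgroup M G \<longleftrightarrow> subgroup M G \<and> M \<noteq> carrier G \<and>
     (\<forall>K. subgroup K G \<and> M \<subseteq> K \<longrightarrow> K = M \<or> K = carrier G)"

text \<open>A group without maximal subgroups is its own Frattini subgroup.\<close>

definition frattini :: "('a, 'b) monoid_scheme \<Rightarrow> 'a set" where
  "frattini G = carrier G \<inter> \<Inter>{M. maximal_subgroup M G}"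

definition centralizer :: "('a, 'b) monoid_scheme \<Rightarrow> 'a set \<Rightarrow> 'a set" where
  "centralizer G H = {x \<in> carrier G. \<forall>h\<in>H. x \<otimes>\<^bsub>G\<^esub> h = h \<otimes>\<^bsub>G\<^esub> x}"

text \<open>The subgroup \<open>\<Phi>(G') G\<^sub>3\<close>.\<close>

definition PhiG3 :: "('a, 'b) monoid_scheme \<Rightarrow> 'a set" where
  "PhiG3 G = frattini (G\<lparr>carrier := derived_subgroup G\<rparr>) <#>\<^bsub>G\<^esub> G3 G"

section \<open>Minimal non-abelian subgroups\<close>

definition p_group :: "nat \<Rightarrow> ('a, 'b) monoid_scheme \<Rightarrow> bool" where
  "p_group p G \<longleftrightarrow> group G \<and> (\<exists>k. order G = p ^ k)"

definition minimal_nonabelian :: "('a, 'b) monoid_scheme \<Rightarrow> bool" where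
  "minimal_nonabelian G \<longleftrightarrow> group G \<and> \<not> comm_group G \<and>
     (\<forall>K. subgroup K G \<and> K \<noteq> carrier G \<longrightarrow> comm_group (G\<lparr>carrier := K\<rparr>))"

definition A1_group :: "nat \<Rightarrow> ('a, 'b) monoid_scheme \<Rightarrow> bool" where
  "A1_group p G \<longleftrightarrow> p_group p G \<and> minimal_nonabelian G"

definition A1_indices :: "('a, 'b) monoid_scheme \<Rightarrow> nat set" where
  "A1_indices G = {card (rcosets\<^bsub>G\<^esub> H) | H. subgroup H G \<and> A1_group 2 (G\<lparr>carrier := H\<rparr>)}"

text \<open>
  The two exponents below are meaningful for finite non-abelian 2-groups: these have
  minimal non-abelian subgroups, and all indices of subgroups are powers of 2.
\<close>

definition I_min :: "('a, 'b) monoid_scheme \<Rightarrow> nat" where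
  "I_min G = (THE i. 2 ^ i = Min (A1_indices G))"

definition I_max :: "('a, 'b) monoid_scheme \<Rightarrow> nat" where
  "I_max G = (THE i. 2 ^ i = Max (A1_indices G))"

section \<open>Characteristic matrices\<close>

definition characteristic_generators ::
    "('a, 'b) monoid_scheme \<Rightarrow> nat \<Rightarrow> nat \<Rightarrow> 'a \<Rightarrow> 'a \<Rightarrow> bool" where
  "characteristic_generators G n m a b \<longleftrightarrow>
     a \<in> carrier G \<and> b \<in> carrier G \<and>
     (let Q = G Mod PhiG3 G;
          a' = PhiG3 G #>\<^bsub>G\<^esub> a;
          b' = PhiG3 G #>\<^bsub>G\<^esub> b;
          c' = commutator Q a' b'
      in generate Q {a', b'} = carrier Q \<and>
         a' [^]\<^bsub>Q\<^esub> ((2::nat) ^ n) = \<one>\<^bsub>Q\<^esub> \<and> b' [^]\<^bsub>Q\<^esub> ((2::nat) ^ m) = \<one>\<^bsub>Q\<^esub> \<and>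
         c' [^]\<^bsub>Q\<^esub> (2::nat) = \<one>\<^bsub>Q\<^esub> \<and>
         commutator Q c' a' = \<one>\<^bsub>Q\<^esub> \<and> commutator Q c' b' = \<one>\<^bsub>Q\<^esub> \<and>
         group.ord Q a' = 2 ^ n \<and> group.ord Q b' = 2 ^ m)"

text \<open>
  \<open>of_bit\<close> lifts an element of the two-element field \<^typ>\<open>bit\<close> to the exponent 0 or 1.
  With \<open>c = [a, b]\<close> and \<open>y = [a, c]\<close>, the rows of \<open>w\<close> are the exponents of
  \<open>a\<close> to the \<open>2\<^sup>n\<close> and of \<open>b\<close> to the \<open>2\<^sup>m\<close> with respect to \<open>c\<^sup>2\<close> and \<open>y\<close>.
\<close>

definition characteristic_matrix ::
    "('a, 'b) monoid_scheme \<Rightarrow> nat \<Rightarrow> nat \<Rightarrow> bit^2^2 \<Rightarrow> bool" where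
  "characteristic_matrix G n m w \<longleftrightarrow>
     (\<exists>a b. characteristic_generators G n m a b \<and>
       (let c = commutator G a b; y = commutator G a c
        in a [^]\<^bsub>G\<^esub> ((2::nat) ^ n) =
             c [^]\<^bsub>G\<^esub> (2 * of_bit (w $ 1 $ 1) :: nat) \<otimes>\<^bsub>G\<^esub> y [^]\<^bsub>G\<^esub> (of_bit (w $ 1 $ 2) :: nat) \<and>
           b [^]\<^bsub>G\<^esub> ((2::nat) ^ m) =
             c [^]\<^bsub>G\<^esub> (2 * of_bit (w $ 2 $ 1) :: nat) \<otimes>\<^bsub>G\<^esub> y [^]\<^bsub>G\<^esub> (of_bit (w $ 2 $ 2) :: nat)))"

end

theory Submission
  imports Defs
begin

text \<open>
  Let \<open>c = [a, b]\<close> and \<open>y = [a, c]\<close>. The hypotheses force \<open>y\<close> to be a central involution, \<open>c\<close> to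
  have order 4 and to commute with \<open>b\<close>, and \<open>m \<ge> 2\<close>: otherwise \<open>b\<close> to the \<open>2\<^sup>m\<close>, which lies in the
  central subgroup \<open>\<Phi>(G') G\<^sub>3\<close>, would not commute with \<open>a\<close>. Hence every element has the
  form \<open>a\<^sup>i b\<^sup>j c\<^sup>k y\<^sup>l\<close> with an explicit multiplication rule, and \<open>|G| \<ge> 2\<^sup>n\<^sup>+\<^sup>m\<^sup>+\<^sup>3\<close>.
  A minimal non-abelian subgroup is generated by any two of its non-commuting elements, and two elements
  generate one as soon as their commutator is a central involution of the subgroup they generate.

  (1) A minimal non-abelian subgroup \<open>H\<close> of index at most 2 contains all squares, hence \<open>c\<close>. If some \<open>x\<close> in \<open>H\<close> does
  not commute with \<open>c\<close>, then \<open>H = \<langle>x, c\<rangle>\<close>; otherwise \<open>H\<close> is generated by one element of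
  \<open>a\<^sup>2 G'\<close> and one of \<open>b G'\<close>. Both groups are too small.
  (2) The subgroup \<open>\<langle>a, c\<rangle>\<close> is minimal non-abelian of index at least \<open>2\<^sup>m\<close>.
  (3) For \<open>m = 2\<close> a non-abelian subgroup contains, up to \<open>G'\<close>, either a non-commuting pair \<open>a b\<^sup>j\<close>, \<open>b\<^sup>j'\<close> or the pair
  \<open>a\<^sup>2\<close>, \<open>b\<close>. The commutator of the pair together with suitable 2-power powers generates
  \<open>\<Phi>(G') G\<^sub>3\<close> under the condition on \<open>w\<close>, which gives index at most 4; if the condition fails,
  one of \<open>\<langle>a, b\<^sup>2\<rangle>\<close>, \<open>\<langle>a, b\<^sup>2 c\<rangle>\<close>, \<open>\<langle>a\<^sup>2, b\<rangle>\<close> is minimal non-abelian of index at least 8.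
\<close>

section \<open>Integer powers and normal forms\<close>


context group begin

text \<open>The hypothesis says that \<open>w\<close> is the conjugate of \<open>v\<close> by
  \<open>u\<close>, and conjugation respects powers.\<close>

lemma conj_int_pow:
  assumes "u \<in> carrier G" "v \<in> carrier G" "w \<in> carrier G" and vu: "v \<otimes> u = u \<otimes> w"
  shows "v [^] (j::int) \<otimes> u = u \<otimes> w [^] j"
proof -
  have nat: "v [^] (n::nat) \<otimes> u = u \<otimes> w [^] n" for n
  proof (induction n)
    case (Suc n)
    have "v [^] Suc n \<otimes> u = v [^] n \<otimes> (v \<otimes> u)"
      using assms by (simp add: m_assoc)
    also have "\<dots> = (v [^] n \<otimes> u) \<otimes> w"
      using assms by (simp add: vu m_assoc)
    also have "\<dots> = u \<otimes> w [^] Suc n"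
      using assms by (simp add: Suc m_assoc)
    finally show ?case .
  qed (use assms in simp)
  show ?thesis
  proof (cases j)
    case (nonneg n)
    then show ?thesis using nat by (simp add: int_pow_int)
  next
    case (neg n)
    have "inv (v [^] Suc n) \<otimes> u = u \<otimes> inv (w [^] Suc n)"
      using nat[of "Suc n"] assms
      by (smt (verit) inv_solve_left inv_solve_right m_assoc inv_closed m_closed nat_pow_closed)
    then show ?thesis
      using assms neg by (simp only: int_pow_neg_int)
  qed
qed

lemma swap_int_pow:
  assumes uv: "u \<in> carrier G" "v \<in> carrier G" and z: "z \<in> carrier G"
    and zu: "z \<otimes> u = u \<otimes> z" and zv: "z \<otimes> v = v \<otimes> z" and vu: "v \<otimes> u = u \<otimes> (v \<otimes> z)"
  shows "v [^] (j::int) \<otimes> u [^] (i::int) = u [^] i \<otimes> (v [^] j \<otimes> z [^] (i * j))"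
proof -
  have 1: "v [^] j \<otimes> u = u \<otimes> (v [^] j \<otimes> z [^] j)"
    using conj_int_pow[OF uv(1,2) _ vu, of j] uv z zv by (simp add: int_pow_mult_distrib)
  define V Z where "V = v [^] j" and "Z = z [^] j"
  have VZ: "V \<in> carrier G" "Z \<in> carrier G" using uv z by (auto simp: V_def Z_def)
  have Zu: "Z \<otimes> u = u \<otimes> Z"
    using conj_int_pow[OF uv(1) z z zu] by (simp add: Z_def)
  have ZV: "Z \<otimes> V = V \<otimes> Z"
    using conj_int_pow[OF uv(2) z z zv, of j] conj_int_pow[of Z v v j] uv VZ
    by (simp add: Z_def V_def)
  have "u \<otimes> (V \<otimes> Z) = V \<otimes> u"
    using 1 by (simp add: V_def Z_def)
  \<comment> \<open>The roles are exchanged: conjugation by \<open>V\<close> sends \<open>u\<close>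
    to \<open>u \<otimes> inv Z\<close>, whose powers split because \<open>Z\<close> commutes with
    \<open>u\<close>.\<close>
  then have "u \<otimes> V = V \<otimes> (u \<otimes> inv Z)"
    using uv VZ Zu ZV
    by (smt (verit) inv_closed inv_solve_right m_assoc m_closed)
  moreover have "Z \<otimes> u = u \<otimes> Z" using Zu .
  then have "u \<otimes> inv Z = inv Z \<otimes> u"
    using uv VZ by (metis inv_closed inv_solve_left inv_solve_right m_assoc m_closed)
  ultimately have "u [^] i \<otimes> V = V \<otimes> (u [^] i \<otimes> (inv Z) [^] i)"
    using conj_int_pow[of V u "u \<otimes> inv Z" i] uv VZ int_pow_mult_distrib[of u "inv Z" i]
    by simp
  then have "u [^] i \<otimes> V \<otimes> Z [^] i = V \<otimes> u [^] i"
    using uv VZ by (simp add: m_assoc int_pow_inv)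
  moreover have "Z [^] i = z [^] (i * j)"
    using z by (simp add: Z_def int_pow_pow mult.commute)
  ultimately show ?thesis
    using uv VZ z by (simp add: V_def m_assoc)
qed

lemma commute_int_pow:
  assumes "u \<in> carrier G" "v \<in> carrier G" "v \<otimes> u = u \<otimes> v"
  shows "v [^] (j::int) \<otimes> u [^] (i::int) = u [^] i \<otimes> v [^] j"
  using swap_int_pow[of u v \<one> j i] assms by simp

lemma int_pow_cong:
  assumes "x \<in> carrier G" "x [^] (d::int) = \<one>" "d dvd i - j"
  shows "x [^] i = x [^] j"
proof -
  obtain q where "i = j + d * q" using assms(3) by (metis add.commute diff_add_cancel dvd_def)
  then show ?thesis using assms by (simp add: int_pow_mult flip: int_pow_pow)
qed

text \<open>An odd \<open>d\<close> is invertible modulo \<open>2 ^ N\<close>, so \<open>x\<close>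
  is itself a power of \<open>x [^] d\<close>.\<close>

lemma odd_int_pow_mem:
  assumes H: "subgroup H G" and x: "x \<in> carrier G" and 2: "x [^] ((2::int) ^ N) = \<one>"
    and d: "odd d" and mem: "x [^] (d::int) \<in> H"
  shows "x \<in> H"
proof -
  have "coprime d (2 ^ N)" using d by simp
  then obtain s t where "s * d + t * 2 ^ N = 1"
    using bezout_int[of d "2 ^ N"] by (metis coprime_iff_gcd_eq_1)
  then have "x = x [^] (d * s + 2 ^ N * t)"
    using x by (simp add: mult.commute)
  also have "\<dots> = (x [^] d) [^] s"
    using x 2 by (simp add: int_pow_mult flip: int_pow_pow)
  also have "\<dots> \<in> H"
    using H mem by (metis subgroup_int_pow_closed)
  finally show ?thesis .
qed

end

section \<open>Collection formulas for the generators a, b, c = [a, b] and y = [a, c]\<close>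

locale class3_gens = group G for G (structure) +
  fixes a b c y
  assumes a [simp]: "a \<in> carrier G" and b [simp]: "b \<in> carrier G"
    and c [simp]: "c \<in> carrier G" and y [simp]: "y \<in> carrier G"
    and ab: "a \<otimes> b = b \<otimes> a \<otimes> c" and ac: "a \<otimes> c = c \<otimes> a \<otimes> y"
    and bc: "c \<otimes> b = b \<otimes> c"
    and ya: "y \<otimes> a = a \<otimes> y" and yb: "y \<otimes> b = b \<otimes> y" and yc: "y \<otimes> c = c \<otimes> y"
    and y2: "y [^] (2::int) = \<one>" and c4: "c [^] (4::int) = \<one>"
begin

text \<open>\<open>T i\<close> is the exponent of \<open>y\<close> that appears when \<open>b\<close> is moved past \<open>a\<^sup>i\<close>.\<close>

definition T :: "int \<Rightarrow> int" where "T i = i * (i - 1) div 2"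

lemma T_add1: "T (i + 1) = T i + i"
proof -
  have "(i + 1) * (i + 1 - 1) = i * (i - 1) + i * 2" by (simp add: algebra_simps)
  moreover have "(i * (i - 1) + i * 2) div 2 = i + i * (i - 1) div 2"
    by (rule div_mult_self1) simp
  ultimately show ?thesis by (simp add: T_def add.commute)
qed

lemma T_simps [simp]: "T 0 = 0" "T 1 = 0" "T 2 = 1"
  by (simp_all add: T_def)

lemma y_int_pow_cong: "2 dvd i - j \<Longrightarrow> y [^] (i::int) = y [^] j"
  by (rule int_pow_cong[OF y y2])

lemma c_int_pow_cong: "4 dvd i - j \<Longrightarrow> c [^] (i::int) = c [^] j"
  by (rule int_pow_cong[OF c c4])

lemma bc_pow: "c [^] (k::int) \<otimes> b [^] (j::int) = b [^] j \<otimes> c [^] k"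
  and ya_pow: "y [^] (l::int) \<otimes> a [^] (i::int) = a [^] i \<otimes> y [^] l"
  and yb_pow: "y [^] (l::int) \<otimes> b [^] (j::int) = b [^] j \<otimes> y [^] l"
  and yc_pow: "y [^] (l::int) \<otimes> c [^] (k::int) = c [^] k \<otimes> y [^] l"
  using bc ya yb yc by (simp_all add: commute_int_pow)

text \<open>As \<open>y\<close> is an involution commuting with \<open>a\<close> and
  \<open>c\<close>, the relation for \<open>a \<otimes> c\<close> also reads
  \<open>c \<otimes> a = a \<otimes> (c \<otimes> y)\<close>, which has the shape required by
  \<open>swap_int_pow\<close>.\<close>

lemma ca_pow: "c [^] (k::int) \<otimes> a [^] (i::int) = a [^] i \<otimes> (c [^] k \<otimes> y [^] (k * i))"
proof -
  have "c \<otimes> a \<otimes> (y \<otimes> y) = a \<otimes> c \<otimes> y"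
    by (simp add: ac m_assoc)
  moreover have "y \<otimes> y = \<one>"
    using y2 int_pow_mult[of y 1 1] by simp
  ultimately have "c \<otimes> a = a \<otimes> (c \<otimes> y)"
    by (simp add: m_assoc)
  from swap_int_pow[OF a c y ya yc this] show ?thesis by (simp add: mult.commute)
qed

text \<open>Lifts a swap rule to right-nested products, so that it can rewrite inside a longer
  word.\<close>

lemma lcomm_of:
  assumes "u \<otimes> v = v \<otimes> w" "u \<in> carrier G" "v \<in> carrier G" "w \<in> carrier G" "x \<in> carrier G"
  shows "u \<otimes> (v \<otimes> x) = v \<otimes> (w \<otimes> x)"
  using assms by (metis m_assoc)

lemmas bcy_simps =
  bc_pow lcomm_of[OF bc_pow] yb_pow lcomm_of[OF yb_pow] yc_pow lcomm_of[OF yc_pow]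

lemma collect:
  assumes "x \<in> carrier G"
  shows "x [^] (i::int) \<otimes> x [^] (j::int) = x [^] (i + j)"
    "z \<in> carrier G \<Longrightarrow> x [^] (i::int) \<otimes> (x [^] (j::int) \<otimes> z) = x [^] (i + j) \<otimes> z"
  using assms by (simp_all add: int_pow_mult m_assoc)

text \<open>The conjugate of \<open>b\<close> by \<open>a [^] i\<close> is called
  \<open>U i\<close>. Moving one more \<open>a\<close> through it turns \<open>U i\<close> into
  \<open>U (i + 1)\<close>, and induction in both directions from 0 gives all integers.\<close>

lemma ba_pow1: "b \<otimes> a [^] (i::int) = a [^] i \<otimes> (b \<otimes> (c [^] (- i) \<otimes> y [^] T i))"
proof -
  define U where "U i = b \<otimes> (c [^] (- i) \<otimes> y [^] T i)" for i
  have U [simp]: "U i \<in> carrier G" for i by (simp add: U_def)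
  have ba: "b \<otimes> a = a \<otimes> (b \<otimes> c [^] (-1::int))"
  proof -
    have "a \<otimes> (b \<otimes> c [^] (-1::int)) = (a \<otimes> b) \<otimes> inv c"
      by (simp add: m_assoc int_pow_neg)
    also have "\<dots> = b \<otimes> a"
      by (simp add: ab m_assoc)
    finally show ?thesis ..
  qed
  have ca: "c [^] (k::int) \<otimes> a = a \<otimes> (c [^] k \<otimes> y [^] k)" for k
    using ca_pow[of k 1] by simp
  have ya': "y [^] (k::int) \<otimes> a = a \<otimes> y [^] k" for k
    using ya_pow[of k 1] by simp
  have Ua: "U i \<otimes> a = a \<otimes> U (i + 1)" for i
  proof -
    have "U i \<otimes> a = b \<otimes> (c [^] (- i) \<otimes> (y [^] T i \<otimes> a))"
      by (simp add: U_def m_assoc)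
    also have "\<dots> = b \<otimes> (c [^] (- i) \<otimes> (a \<otimes> y [^] T i))"
      by (simp add: ya')
    also have "\<dots> = b \<otimes> (a \<otimes> (c [^] (- i) \<otimes> (y [^] (- i) \<otimes> y [^] T i)))"
      by (simp add: lcomm_of[OF ca] m_assoc)
    also have "\<dots> = a \<otimes> (b \<otimes> (c [^] (-1::int) \<otimes> (c [^] (- i) \<otimes> (y [^] (- i) \<otimes> y [^] T i))))"
      by (simp add: lcomm_of[OF ba] m_assoc)
    also have "\<dots> = a \<otimes> (b \<otimes> (c [^] (- (i + 1)) \<otimes> y [^] (T i - i)))"
      by (simp add: collect algebra_simps)
    \<comment> \<open>The two exponents differ by \<open>2 * i\<close>, which is invisible because
      \<open>y\<close> has exponent 2.\<close>
    also have "y [^] (T i - i) = y [^] T (i + 1)"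
      by (rule y_int_pow_cong) (simp add: T_add1)
    finally show ?thesis by (simp add: U_def)
  qed
  have "b \<otimes> a [^] i = a [^] i \<otimes> U i"
  proof (induction i rule: int_induct[where k = 0])
    case base
    then show ?case by (simp add: U_def)
  next
    case (step1 i)
    have "b \<otimes> a [^] (i + 1) = (b \<otimes> a [^] i) \<otimes> a"
      by (simp add: int_pow_mult m_assoc)
    also have "\<dots> = a [^] i \<otimes> (U i \<otimes> a)"
      by (simp add: step1 m_assoc)
    also have "\<dots> = a [^] (i + 1) \<otimes> U (i + 1)"
      by (simp add: Ua int_pow_mult m_assoc)
    finally show ?case .
  next
    case (step2 i)
    have *: "a [^] i = a [^] (i - 1) \<otimes> a"
      using int_pow_mult[OF a, of "i - 1" 1] by simp
    have "b \<otimes> a [^] (i - 1) \<otimes> a = b \<otimes> a [^] i"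
      by (simp add: * m_assoc)
    also have "\<dots> = a [^] (i - 1) \<otimes> (a \<otimes> U i)"
      by (simp add: step2) (simp add: * m_assoc)
    also have "\<dots> = a [^] (i - 1) \<otimes> U (i - 1) \<otimes> a"
      using Ua[of "i - 1"] by (simp add: m_assoc)
    finally show ?case by simp
  qed
  then show ?thesis by (simp add: U_def)
qed

text \<open>The conjugate of \<open>b\<close> found in \<open>ba_pow1\<close> is a product of
  commuting factors, so its \<open>j\<close>-th power is taken factor by factor.\<close>

lemma ba_pow:
  "b [^] (j::int) \<otimes> a [^] (i::int) = a [^] i \<otimes> (b [^] j \<otimes> (c [^] (- (i * j)) \<otimes> y [^] (j * T i)))"
proof -
  have "c [^] (- i) \<otimes> b = b \<otimes> c [^] (- i)" "y [^] T i \<otimes> b = b \<otimes> y [^] T i"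
    using bc_pow[of "- i" 1] yb_pow[of "T i" 1] by simp_all
  then have "b \<otimes> (c [^] (- i) \<otimes> y [^] T i) = (c [^] (- i) \<otimes> y [^] T i) \<otimes> b"
    by (metis b c y int_pow_closed m_assoc)
  then have "(b \<otimes> (c [^] (- i) \<otimes> y [^] T i)) [^] j = b [^] j \<otimes> (c [^] (- i) \<otimes> y [^] T i) [^] j"
    by (intro int_pow_mult_distrib) simp_all
  also have "(c [^] (- i) \<otimes> y [^] T i) [^] j = c [^] (- (i * j)) \<otimes> y [^] (j * T i)"
    using int_pow_mult_distrib[of "c [^] (- i)" "y [^] T i" j, OF yc_pow[symmetric]]
    by (simp add: int_pow_pow mult.commute)
  finally show ?thesis
    using conj_int_pow[OF _ b _ ba_pow1[of i], of j] by simp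
qed

text \<open>The exponents are arbitrary integers, so one element has many such forms. They are
  compared through \<open>E_cong\<close> and, later, through the power relations of \<open>a\<close>
  and \<open>b\<close>.\<close>

definition E :: "int \<Rightarrow> int \<Rightarrow> int \<Rightarrow> int \<Rightarrow> 'a" where
  "E i j k l = a [^] i \<otimes> (b [^] j \<otimes> (c [^] k \<otimes> y [^] l))"

lemma E_closed [simp]: "E i j k l \<in> carrier G"
  by (simp add: E_def)

lemma E_cong: "4 dvd k - k' \<Longrightarrow> 2 dvd l - l' \<Longrightarrow> E i j k l = E i j k' l'"
  unfolding E_def using c_int_pow_cong y_int_pow_cong by metis

text \<open>Moving \<open>a [^] i'\<close> to the left past \<open>y\<close>, \<open>c\<close> and
  \<open>b\<close> in turn costs nothing, then \<open>y [^] (k * i')\<close>, then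
  \<open>c [^] (- (j * i'))\<close> together with \<open>y [^] (j * T i')\<close>. The remaining
  letters commute.\<close>

lemma E_mult:
  "E i j k l \<otimes> E i' j' k' l' =
    E (i + i') (j + j') (k + k' - j * i') (l + l' + k * i' + j * T i')"
proof -
  have "E i j k l \<otimes> E i' j' k' l' =
    a [^] i \<otimes> (b [^] j \<otimes> (c [^] k \<otimes> (y [^] l \<otimes> (a [^] i' \<otimes> (b [^] j' \<otimes> (c [^] k' \<otimes> y [^] l'))))))"
    by (simp add: E_def m_assoc)
  also have "\<dots> = a [^] i \<otimes> (b [^] j \<otimes> (c [^] k \<otimes> (a [^] i' \<otimes> (y [^] l \<otimes> (b [^] j' \<otimes> (c [^] k' \<otimes> y [^] l'))))))"
    by (simp add: lcomm_of[OF ya_pow])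
  also have "\<dots> = a [^] i \<otimes> (b [^] j \<otimes> (a [^] i' \<otimes> ((c [^] k \<otimes> y [^] (k * i')) \<otimes> (y [^] l \<otimes> (b [^] j' \<otimes> (c [^] k' \<otimes> y [^] l'))))))"
    by (simp add: lcomm_of[OF ca_pow])
  also have "\<dots> = a [^] i \<otimes> (a [^] i' \<otimes> ((b [^] j \<otimes> (c [^] (- (i' * j)) \<otimes> y [^] (j * T i'))) \<otimes>
      ((c [^] k \<otimes> y [^] (k * i')) \<otimes> (y [^] l \<otimes> (b [^] j' \<otimes> (c [^] k' \<otimes> y [^] l'))))))"
    by (simp add: lcomm_of[OF ba_pow])
  also have "\<dots> = E (i + i') (j + j') (k + k' - j * i') (l + l' + k * i' + j * T i')"
    by (simp add: E_def m_assoc bcy_simps collect algebra_simps)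
  finally show ?thesis .
qed

lemma E_zero: "E 0 0 0 0 = \<one>"
  and E_a: "E i 0 0 0 = a [^] i" and E_b: "E 0 j 0 0 = b [^] j"
  and E_c: "E 0 0 k 0 = c [^] k" and E_y: "E 0 0 0 l = y [^] l"
  and E_cy: "E 0 0 k l = c [^] k \<otimes> y [^] l"
  by (simp_all add: E_def)

lemma E_inv:
  "inv (E i j k l) = E (-i) (-j) (-k - i * j) (-l + (k + i * j) * i + j * T i)"
  by (rule inv_equality) (simp_all add: E_mult E_zero algebra_simps)

end

section \<open>Two generators with a central involution as commutator\<close>

lemma (in group) comm_group_subgroup_iff:
  assumes "subgroup K G"
  shows "comm_group (G\<lparr>carrier := K\<rparr>) \<longleftrightarrow> (\<forall>x\<in>K. \<forall>x'\<in>K. x \<otimes> x' = x' \<otimes> x)"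
proof
  assume "comm_group (G\<lparr>carrier := K\<rparr>)"
  from comm_groupE(4)[OF this] show "\<forall>x\<in>K. \<forall>x'\<in>K. x \<otimes> x' = x' \<otimes> x" by simp
next
  assume "\<forall>x\<in>K. \<forall>x'\<in>K. x \<otimes> x' = x' \<otimes> x"
  then show "comm_group (G\<lparr>carrier := K\<rparr>)"
    by (intro group.group_comm_groupI subgroup_imp_group assms) simp
qed

text \<open>Here \<open>z\<close> is the commutator of \<open>v\<close> and \<open>u\<close>, and it
  may be trivial. The locale is used inside the group under study as well as inside its quotient by
  \<open>PhiG3 G\<close>.\<close>

locale heisenberg_gens = group G for G (structure) +
  fixes u v z
  assumes u [simp]: "u \<in> carrier G" and v [simp]: "v \<in> carrier G" and z [simp]: "z \<in> carrier G"
    and zu: "z \<otimes> u = u \<otimes> z" and zv: "z \<otimes> v = v \<otimes> z" and vu: "v \<otimes> u = u \<otimes> (v \<otimes> z)"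
    and z2: "z [^] (2::int) = \<one>"
begin

definition F :: "int \<Rightarrow> int \<Rightarrow> int \<Rightarrow> 'a" where
  "F i j k = u [^] i \<otimes> (v [^] j \<otimes> z [^] k)"

lemma F_closed [simp]: "F i j k \<in> carrier G"
  by (simp add: F_def)

lemma zu_pow: "z [^] (k::int) \<otimes> u [^] (i::int) = u [^] i \<otimes> z [^] k"
  and zv_pow: "z [^] (k::int) \<otimes> v [^] (j::int) = v [^] j \<otimes> z [^] k"
  using zu zv by (simp_all add: commute_int_pow)

lemma F_mult: "F i j k \<otimes> F i' j' k' = F (i + i') (j + j') (k + k' + j * i')"
proof -
  have l: "x \<otimes> (y \<otimes> t) = y \<otimes> (w \<otimes> t)"
    if "x \<otimes> y = y \<otimes> w" "x \<in> carrier G" "y \<in> carrier G" "w \<in> carrier G" "t \<in> carrier G"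
    for x y w t using that by (metis m_assoc)
  have p: "x [^] (i::int) \<otimes> (x [^] (j::int) \<otimes> t) = x [^] (i + j) \<otimes> t"
    if "x \<in> carrier G" "t \<in> carrier G" for x t i j
    using that by (simp add: int_pow_mult m_assoc)
  have "F i j k \<otimes> F i' j' k' = u [^] i \<otimes> (v [^] j \<otimes> (z [^] k \<otimes> (u [^] i' \<otimes> (v [^] j' \<otimes> z [^] k'))))"
    by (simp add: F_def m_assoc)
  also have "\<dots> = u [^] i \<otimes> (u [^] i' \<otimes> ((v [^] j \<otimes> z [^] (i' * j)) \<otimes> (z [^] k \<otimes> (v [^] j' \<otimes> z [^] k'))))"
    by (simp add: l[OF zu_pow] l[OF swap_int_pow[OF u v z zu zv vu]])
  also have "\<dots> = F (i + i') (j + j') (k + k' + j * i')"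
    by (simp add: F_def m_assoc zv_pow l[OF zv_pow] p int_pow_mult[symmetric] algebra_simps)
  finally show ?thesis .
qed

lemma z_int_pow_cong: "2 dvd i - j \<Longrightarrow> z [^] (i::int) = z [^] j"
  by (rule int_pow_cong[OF z z2])

lemma F_cong: "2 dvd k - k' \<Longrightarrow> F i j k = F i j k'"
  unfolding F_def using z_int_pow_cong by metis

lemma F_gens: "F 0 0 0 = \<one>" "F 1 0 0 = u" "F 0 1 0 = v" "F 0 0 1 = z"
  by (simp_all add: F_def)

lemma F_inv: "inv (F i j k) = F (- i) (- j) (- k + i * j)"
  by (rule inv_equality) (simp_all add: F_mult F_gens)

text \<open>The exponent of \<open>z\<close> is left open: it is removed separately once
  \<open>z\<close> is known to lie in the subgroup considered.\<close>

lemma F_int_pow: "\<exists>k'. F i j k [^] (r::int) = F (r * i) (r * j) k'"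
proof -
  have nat: "\<exists>k'. F i j k [^] int r = F (int r * i) (int r * j) k'" for r
  proof (induction r)
    case 0
    have "F i j k [^] int 0 = F (int 0 * i) (int 0 * j) 0" by (simp add: F_gens)
    then show ?case ..
  next
    case (Suc r)
    then obtain k' where "F i j k [^] int r = F (int r * i) (int r * j) k'" by blast
    then have "F i j k [^] int (Suc r) = F (int r * i) (int r * j) k' \<otimes> F i j k"
      using int_pow_mult[of "F i j k" "int r" 1] by (simp add: add.commute)
    also have "\<dots> = F (int (Suc r) * i) (int (Suc r) * j) (k' + k + (int r * j) * i)"
      by (simp add: F_mult algebra_simps)
    finally show ?case ..
  qed
  show ?thesis
  proof (cases r)
    case (neg n)
    obtain k' where "F i j k [^] int (Suc n) = F (int (Suc n) * i) (int (Suc n) * j) k'"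
      using nat by blast
    then have "F i j k [^] r = inv (F (int (Suc n) * i) (int (Suc n) * j) k')"
      by (simp only: neg int_pow_neg F_closed)
    then show ?thesis
      by (auto simp: F_inv neg simp del: of_nat_Suc)
  qed (use nat in auto)
qed

lemma F_sq: "F i j k [^] (2::int) = F (2 * i) (2 * j) (2 * k + j * i)"
  using int_pow_mult[of "F i j k" 1 1] by (simp add: F_mult mult.commute)

text \<open>Squaring once leaves an odd power of \<open>z\<close>, squaring twice an even one, which
  vanishes. Hence the exponent is at least 4.\<close>

lemma F_1_1_pow:
  "F 1 1 k [^] ((2::int) ^ (r + 2)) = F (2 ^ (r + 2)) (2 ^ (r + 2)) 0"
proof (induction r)
  case 0
  have "F 1 1 k [^] ((2::int) ^ (0 + 2)) = (F 1 1 k [^] (2::int)) [^] (2::int)"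
    by (simp add: int_pow_pow)
  also have "\<dots> = F 4 4 0"
    unfolding F_sq by simp (rule F_cong; simp)
  finally show ?case by simp
next
  case (Suc r)
  have "F 1 1 k [^] ((2::int) ^ (Suc r + 2)) = (F 1 1 k [^] ((2::int) ^ (r + 2))) [^] (2::int)"
    by (simp add: int_pow_pow mult.commute)
  also have "\<dots> = F (2 ^ (Suc r + 2)) (2 ^ (Suc r + 2)) 0"
    unfolding Suc F_sq by simp (rule F_cong; simp)
  finally show ?case .
qed

lemma F_0: "F i j 0 = u [^] i \<otimes> v [^] j" "F 1 1 0 = u \<otimes> v"
  by (simp_all add: F_def)

text \<open>The commutator is bilinear in the exponents of \<open>u\<close> and \<open>v\<close> and
  alternating, so the exponent of \<open>z\<close> is a determinant.\<close>

lemma F_swap: "F i' j' k' \<otimes> F i j k = F i j k \<otimes> F i' j' k' \<otimes> z [^] (i * j' - i' * j)"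
proof -
  have "z [^] l = F 0 0 l" for l by (simp add: F_def)
  then show ?thesis by (simp add: F_mult algebra_simps)
qed

lemma generate_eq: "generate G {u, v} = {F i j k |i j k. True}" (is "_ = ?S")
proof
  have "subgroup ?S G"
  proof (rule subgroupI)
    show "inv x \<in> ?S" if "x \<in> ?S" for x
      using that by (clarsimp simp: F_inv) blast
    show "x \<otimes> x' \<in> ?S" if "x \<in> ?S" "x' \<in> ?S" for x x'
      using that by (clarsimp simp: F_mult) blast
  qed auto
  moreover have "{u, v} \<subseteq> ?S"
    using F_gens by (metis (mono_tags, lifting) empty_subsetI insert_subset mem_Collect_eq)
  ultimately show "generate G {u, v} \<subseteq> ?S" by (simp add: generate_subgroup_incl)
next
  have sg: "subgroup (generate G {u, v}) G" by (simp add: generate_is_subgroup)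
  have uvH: "u \<in> generate G {u, v}" "v \<in> generate G {u, v}" by (auto intro: generate.incl)
  have "z = inv (u \<otimes> v) \<otimes> (v \<otimes> u)"
    by (simp add: vu inv_mult_group m_assoc) (simp flip: m_assoc)
  then have "z \<in> generate G {u, v}"
    using sg uvH by (metis subgroup.m_closed subgroup.m_inv_closed)
  then show "?S \<subseteq> generate G {u, v}"
    using sg uvH by (auto simp: F_def intro!: subgroup.m_closed subgroup_int_pow_closed)
qed

lemma generateE:
  assumes "x \<in> generate G {u, v}"
  obtains i j k where "x = F i j k"
  using assms unfolding generate_eq by blast

text \<open>Two non-commuting elements of a subgroup \<open>K\<close> have exponent vectors with odd
  determinant. This puts \<open>z\<close> into \<open>K\<close>, then by Cramer's rule an odd power
  of \<open>u\<close> and of \<open>v\<close>, and finally \<open>u\<close> and \<open>v\<close>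
  themselves. So every non-abelian subgroup is the whole group.\<close>

lemma A1_group_generate:
  assumes G: "order G = 2 ^ N" and z1: "z \<noteq> \<one>"
  shows "A1_group 2 (G\<lparr>carrier := generate G {u, v}\<rparr>)"
proof -
  let ?H = "generate G {u, v}"
  have sg: "subgroup ?H G" by (simp add: generate_is_subgroup)
  have torsion: "x [^] ((2::int) ^ N) = \<one>" if "x \<in> carrier G" for x
    using pow_order_eq_1[OF that] int_pow_int[of G x "2 ^ N"] by (simp add: G)
  have "finite (carrier G)"
    using G by (simp flip: order_gt_0_iff_finite)
  then have "card ?H dvd 2 ^ N"
    using lagrange_finite[OF _ sg] G by (metis dvd_triv_right)
  then obtain N' where "card ?H = 2 ^ N'"
    by (metis divides_primepow_nat two_is_prime_nat)
  then have pg: "p_group 2 (G\<lparr>carrier := ?H\<rparr>)"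
    unfolding p_group_def using subgroup_imp_group[OF sg] by (auto simp: order_def)
  have "v \<otimes> u \<noteq> u \<otimes> v"
    using z1 by (simp add: vu flip: m_assoc)
  moreover have "u \<in> ?H" "v \<in> ?H" by (auto intro: generate.incl)
  ultimately have "\<not> comm_group (G\<lparr>carrier := ?H\<rparr>)"
    using comm_group_subgroup_iff[OF sg] by metis
  moreover have "comm_group (G\<lparr>carrier := K\<rparr>)"
    if K: "subgroup K (G\<lparr>carrier := ?H\<rparr>)" "K \<noteq> ?H" for K
  proof (rule ccontr)
    assume nc: "\<not> comm_group (G\<lparr>carrier := K\<rparr>)"
    have KG: "subgroup K G" using incl_subgroup[OF sg K(1)] .
    have KH: "K \<subseteq> ?H" using subgroup.subset[OF K(1)] by simp
    obtain x x' where x: "x \<in> K" "x' \<in> K" "x' \<otimes> x \<noteq> x \<otimes> x'"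
      using nc comm_group_subgroup_iff[OF KG] by metis
    obtain i j k where ijk: "x = F i j k" by (rule generateE[OF subsetD[OF KH x(1)]])
    obtain i' j' k' where ijk': "x' = F i' j' k'" by (rule generateE[OF subsetD[OF KH x(2)]])
    let ?d = "i * j' - i' * j"
    have sw: "x' \<otimes> x = x \<otimes> x' \<otimes> z [^] ?d" unfolding ijk ijk' by (rule F_swap)
    have xc: "x \<in> carrier G" "x' \<in> carrier G" by (simp_all add: ijk ijk')
    have d: "odd ?d"
    proof
      assume "even ?d"
      then have "z [^] ?d = \<one>" using z_int_pow_cong[of ?d 0] by simp
      then show False using sw x(3) xc by simp
    qed
    have "z [^] ?d = inv (x \<otimes> x') \<otimes> (x' \<otimes> x)"
      unfolding sw using xc by (subst m_assoc[symmetric]) simp_all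
    moreover have "z [^] ?d = z" using z_int_pow_cong[of ?d 1] d by simp
    ultimately have zK: "z \<in> K"
      using x KG by (metis subgroup.m_closed subgroup.m_inv_closed)
    have red: "F i0 j0 0 \<in> K" if "F i0 j0 k0 \<in> K" for i0 j0 k0
    proof -
      have "F i0 j0 0 = F i0 j0 k0 \<otimes> z [^] (- k0)"
        using F_mult[of i0 j0 k0 0 0 "- k0"] by (simp add: F_def)
      then show ?thesis
        using that zK KG by (metis subgroup.m_closed subgroup_int_pow_closed)
    qed
    have comb: "\<exists>k0. F (r * i + s * i') (r * j + s * j') k0 \<in> K" for r s
    proof -
      obtain p q where "x [^] r = F (r * i) (r * j) p" "x' [^] s = F (s * i') (s * j') q"
        using F_int_pow ijk ijk' by metis
      moreover have "x [^] r \<otimes> x' [^] s \<in> K"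
        using x KG by (simp add: subgroup.m_closed subgroup_int_pow_closed)
      ultimately show ?thesis by (auto simp: F_mult)
    qed
    \<comment> \<open>Cramer's rule: these coefficients eliminate one of the two exponents and leave
      the determinant in the other.\<close>
    have "j' * i + (- j) * i' = ?d" "j' * j + (- j) * j' = 0"
      "(- i') * i + i * i' = 0" "(- i') * j + i * j' = ?d"
      by (simp_all add: algebra_simps)
    then have "F ?d 0 0 \<in> K" "F 0 ?d 0 \<in> K"
      using comb[of j' "- j"] comb[of "- i'" i] red by metis+
    then have "u [^] ?d \<in> K" "v [^] ?d \<in> K" by (simp_all add: F_def)
    then have "u \<in> K" "v \<in> K"
      using odd_int_pow_mem[OF KG _ torsion d] by simp_all
    then have "?H \<subseteq> K" using generate_subgroup_incl[OF _ KG] by simp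
    with KH K(2) show False by simp
  qed
  ultimately show ?thesis
    unfolding A1_group_def minimal_nonabelian_def
    using pg subgroup_imp_group[OF sg] by simp
qed

text \<open>Reducing the exponents of \<open>u\<close> and \<open>v\<close> modulo \<open>r\<close>
  and \<open>s\<close> produces factors in \<open>Z\<close>; the one coming from \<open>u\<close> is
  moved past the power of \<open>v\<close>. So every element is determined by two residues and an
  element of \<open>Z\<close>.\<close>

lemma card_generate_le:
  assumes Z: "subgroup Z G" "finite Z" "z \<in> Z"
    and comm: "\<And>t. t \<in> Z \<Longrightarrow> t \<otimes> v = v \<otimes> t"
    and r: "0 < r" "u [^] (int r) \<in> Z" and s: "0 < s" "v [^] (int s) \<in> Z"
  shows "card (generate G {u, v}) \<le> r * s * card Z"
proof -
  let ?A = "{0..<int r} \<times> {0..<int s} \<times> Z"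
  let ?f = "\<lambda>(i, j, t). u [^] i \<otimes> (v [^] j \<otimes> t)"
  have "generate G {u, v} \<subseteq> ?f ` ?A"
  proof
    fix x assume "x \<in> generate G {u, v}"
    then obtain i j k where x: "x = F i j k" by (rule generateE)
    define U V where "U = (u [^] int r) [^] (i div int r)" and "V = (v [^] int s) [^] (j div int s)"
    have UV: "U \<in> Z" "V \<in> Z" "z [^] k \<in> Z"
      using Z r s by (auto simp: U_def V_def intro: subgroup_int_pow_closed)
    have car [simp]: "U \<in> carrier G" "V \<in> carrier G" by (auto simp: U_def V_def)
    let ?i = "i mod int r" and ?j = "j mod int s"
    have iU: "u [^] i = u [^] ?i \<otimes> U" and jV: "v [^] j = v [^] ?j \<otimes> V"
      by (simp_all add: U_def V_def int_pow_mult[symmetric] int_pow_pow)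
    have Uv: "U \<otimes> v [^] ?j = v [^] ?j \<otimes> U"
      using commute_int_pow[of v U 1 ?j] comm[OF UV(1)] by simp
    have "x = u [^] ?i \<otimes> U \<otimes> (v [^] ?j \<otimes> V \<otimes> z [^] k)"
      by (simp only: x F_def iU jV)
    also have "\<dots> = u [^] ?i \<otimes> ((U \<otimes> v [^] ?j) \<otimes> (V \<otimes> z [^] k))"
      by (simp add: m_assoc)
    also have "\<dots> = ?f (?i, ?j, U \<otimes> (V \<otimes> z [^] k))"
      unfolding Uv by (simp add: m_assoc)
    finally have "x = ?f (?i, ?j, U \<otimes> (V \<otimes> z [^] k))" .
    moreover have "U \<otimes> (V \<otimes> z [^] k) \<in> Z"
      using UV Z by (simp add: subgroup.m_closed)
    ultimately show "x \<in> ?f ` ?A"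
      using r(1) s(1) by (intro image_eqI[where x = "(i mod int r, j mod int s, U \<otimes> (V \<otimes> z [^] k))"]) auto
  qed
  then have "card (generate G {u, v}) \<le> card (?f ` ?A)"
    by (rule card_mono[rotated]) (simp add: Z)
  also have "\<dots> \<le> card ?A" by (rule card_image_le) (simp add: Z)
  also have "\<dots> = r * s * card Z" by (simp add: card_cartesian_product)
  finally show ?thesis .
qed

end

section \<open>Indices of non-abelian subgroups\<close>

context group begin

lemma card_rcosets_le:
  assumes H: "subgroup H G" and S: "finite S" "S \<subseteq> carrier G"
    and "\<And>g. g \<in> carrier G \<Longrightarrow> \<exists>h\<in>H. h \<otimes> g \<in> S"
  shows "card (rcosets H) \<le> card S"
proof -
  have "rcosets H \<subseteq> (\<lambda>t. H #> t) ` S"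
  proof
    fix R assume "R \<in> rcosets H"
    then obtain g where g: "g \<in> carrier G" "R = H #> g" by (auto simp: RCOSETS_def)
    then obtain h where h: "h \<in> H" "h \<otimes> g \<in> S" using assms by blast
    then have "h \<otimes> g \<in> H #> g" by (auto simp: r_coset_def)
    then have "R = H #> (h \<otimes> g)" using repr_independence[OF _ g(1) H] g(2) by simp
    then show "R \<in> (\<lambda>t. H #> t) ` S" using h by blast
  qed
  then have "card (rcosets H) \<le> card ((\<lambda>t. H #> t) ` S)"
    by (rule card_mono[rotated]) (simp add: S)
  also have "\<dots> \<le> card S" by (rule card_image_le) (rule S)
  finally show ?thesis .
qed

text \<open>If \<open>x \<otimes> x\<close> were outside \<open>H\<close>, then
  \<open>\<one>\<close>, \<open>x\<close> and \<open>x \<otimes> x\<close> would represent three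
  different cosets.\<close>

lemma square_mem_of_index_le_2:
  assumes H: "subgroup H G" and "finite (carrier G)" and 2: "card (rcosets H) \<le> 2"
    and x: "x \<in> carrier G"
  shows "x \<otimes> x \<in> H"
proof (rule ccontr)
  assume n: "x \<otimes> x \<notin> H"
  then have x': "x \<notin> H" using subgroup.m_closed[OF H, of x x] by auto
  have *: "u \<otimes> inv t \<in> H" if "H #> u = H #> t" "u \<in> carrier G" "t \<in> carrier G" for u t
  proof -
    have "u \<in> H #> t" using rcos_self[OF that(2) H] that(1) by simp
    then obtain h where "h \<in> H" "u = h \<otimes> t" by (auto simp: r_coset_def)
    then show ?thesis using that subgroup.mem_carrier[OF H] by (simp add: m_assoc)
  qed
  have "H #> \<one> \<noteq> H #> x" using *[of x \<one>] x x' by auto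
  moreover have "H #> \<one> \<noteq> H #> (x \<otimes> x)" using *[of "x \<otimes> x" \<one>] x n by auto
  moreover have "H #> x \<noteq> H #> (x \<otimes> x)" using *[of "x \<otimes> x" x] x x' by (auto simp: m_assoc)
  ultimately have "card {H #> \<one>, H #> x, H #> (x \<otimes> x)} = 3" by simp
  moreover have "{H #> \<one>, H #> x, H #> (x \<otimes> x)} \<subseteq> rcosets H"
    using x subgroup.subset[OF H] by (simp add: rcosetsI del: coset_mult_one)
  moreover have "finite (rcosets H)"
    using assms by (simp add: RCOSETS_def)
  ultimately have "3 \<le> card (rcosets H)" by (metis card_mono)
  then show False using 2 by simp
qed

text \<open>The subgroup generated by \<open>u\<close> and \<open>v\<close> is not abelian, hence
  cannot be proper in \<open>H\<close>.\<close>

lemma minimal_nonabelian_eq_generate: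
  assumes H: "subgroup H G" "minimal_nonabelian (G\<lparr>carrier := H\<rparr>)"
    and uv: "u \<in> H" "v \<in> H" "u \<otimes> v \<noteq> v \<otimes> u"
  shows "H = generate G {u, v}"
proof (rule ccontr)
  assume ne: "H \<noteq> generate G {u, v}"
  let ?K = "generate G {u, v}"
  have "{u, v} \<subseteq> carrier G" using uv H subgroup.subset by blast
  then have K: "subgroup ?K G" by (rule generate_is_subgroup)
  moreover have "?K \<subseteq> H" using uv H by (simp add: generate_subgroup_incl)
  ultimately have "subgroup ?K (G\<lparr>carrier := H\<rparr>)"
    using H by (simp add: subgroup_incl)
  then have "comm_group (G\<lparr>carrier := ?K\<rparr>)"
    using H(2) ne by (fastforce simp: minimal_nonabelian_def)
  moreover have "u \<in> ?K" "v \<in> ?K" by (auto intro: generate.incl)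
  ultimately show False using comm_group_subgroup_iff[OF K] uv by blast
qed

lemma A1_group_noncommuting:
  assumes "subgroup H G" "A1_group 2 (G\<lparr>carrier := H\<rparr>)"
  obtains u v where "u \<in> H" "v \<in> H" "u \<otimes> v \<noteq> v \<otimes> u"
proof -
  have "\<not> comm_group (G\<lparr>carrier := H\<rparr>)"
    using assms(2) by (simp add: A1_group_def minimal_nonabelian_def)
  then show ?thesis
    using that comm_group_subgroup_iff[OF assms(1)] by metis
qed

end

section \<open>Orders and indices in a group with prescribed power relations\<close>

text \<open>The matrix entries enter as integers so that they can be multiplied by exponents; only
  their parity matters. The three inequalities say that \<open>c [^] 2\<close>, \<open>y\<close> and
  their product are non-trivial: these are the commutators of the generating pairs met
  below.\<close>

locale tower_group = class3_gens +
  fixes n m N :: nat and w11 w12 w21 w22 :: int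
  assumes order: "order G = 2 ^ N" and order_ge: "2 ^ (n + m + 3) \<le> order G"
    and normal_form: "x \<in> carrier G \<Longrightarrow> \<exists>i j k l. x = E i j k l"
    and a_pow: "a [^] ((2::int) ^ n) = E 0 0 (2 * w11) w12"
    and b_pow: "b [^] ((2::int) ^ m) = E 0 0 (2 * w21) w22"
    and c2: "E 0 0 2 0 \<noteq> \<one>" and y1: "E 0 0 0 1 \<noteq> \<one>" and c2y: "E 0 0 2 1 \<noteq> \<one>"
    and m2: "2 \<le> m" and mn: "m < n"
begin

lemma finite_carrier: "finite (carrier G)"
  using order by (simp flip: order_gt_0_iff_finite)

lemma E_eq_one: "4 dvd k \<Longrightarrow> 2 dvd l \<Longrightarrow> E 0 0 k l = \<one>"
  using E_cong[of k 0 l 0 0 0] by (simp add: E_zero)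

text \<open>In the application this is the subgroup \<open>PhiG3 G\<close>, generated by the square
  of \<open>c\<close> and by \<open>y\<close>.\<close>

definition P :: "'a set" where "P = {E 0 0 (2 * k) l |k l. True}"

lemma P_I [intro]: "E 0 0 (2 * k) l \<in> P" by (auto simp: P_def)

lemma card_P_le: "card P \<le> 4" and finite_P: "finite P"
proof -
  have sub: "P \<subseteq> (\<lambda>(k, l). E 0 0 k l) ` ({0, 2} \<times> {0, 1})"
  proof
    fix x assume "x \<in> P"
    then obtain k l where x: "x = E 0 0 (2 * k) l" by (auto simp: P_def)
    have "x = E 0 0 (2 * (k mod 2)) (l mod 2)"
      unfolding x by (rule E_cong) presburger+
    moreover have "(2 * (k mod 2), l mod 2) \<in> {0, 2} \<times> {0, 1}" by (auto; presburger)
    ultimately show "x \<in> (\<lambda>(k, l). E 0 0 k l) ` ({0, 2} \<times> {0, 1})" by force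
  qed
  then show "finite P" by (rule finite_subset) simp
  have "card P \<le> card ((\<lambda>(k, l). E 0 0 k l) ` ({0, 2::int} \<times> {0, 1::int}))"
    by (rule card_mono) (simp, rule sub)
  also have "\<dots> \<le> card ({0, 2::int} \<times> {0, 1::int})" by (rule card_image_le) simp
  finally show "card P \<le> 4" by simp
qed

lemma P_subgroup: "subgroup P G"
proof (rule subgroupI)
  show "inv x \<in> P" if x: "x \<in> P" for x
  proof -
    obtain k l where "x = E 0 0 (2 * k) l" using x by (auto simp: P_def)
    then show ?thesis using P_I[of "- k" "- l"] by (simp add: E_inv)
  qed
  show "x \<otimes> x' \<in> P" if xx: "x \<in> P" "x' \<in> P" for x x'
  proof -
    obtain k l where "x = E 0 0 (2 * k) l" using xx by (auto simp: P_def)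
    moreover obtain k' l' where "x' = E 0 0 (2 * k') l'" using xx by (auto simp: P_def)
    ultimately show ?thesis using P_I[of "k + k'" "l + l'"] by (simp add: E_mult algebra_simps)
  qed
qed (auto simp: P_def)

lemma P_central:
  assumes "t \<in> P" "x \<in> carrier G"
  shows "t \<otimes> x = x \<otimes> t"
proof -
  obtain k l where t: "t = E 0 0 (2 * k) l" using assms by (auto simp: P_def)
  obtain i j k' l' where x: "x = E i j k' l'" using normal_form assms by blast
  show ?thesis unfolding t x by (simp add: E_mult) (rule E_cong; simp)
qed

text \<open>The \<open>2 ^ n\<close>-th power of \<open>a\<close> lies in the central subgroup
  \<open>P\<close>, so the exponent of \<open>a\<close> may be reduced modulo \<open>2 ^ n\<close>
  at the cost of a factor from \<open>P\<close>.\<close>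

lemma a_pow_mult: "E (i + 2 ^ n * s) j k l = E i j (k + 2 * w11 * s) (l + w12 * s)"
proof -
  have "E (2 ^ n * s) 0 0 0 = E 0 0 (2 * w11) w12 [^] s"
    by (simp add: E_a int_pow_pow flip: a_pow)
  also have "\<dots> = E 0 0 (2 * w11 * s) (w12 * s)"
    using yc_pow by (simp add: E_cy int_pow_mult_distrib int_pow_pow)
  finally have "E (2 ^ n * s) 0 0 0 \<otimes> E i j k l = E 0 0 (2 * w11 * s) (w12 * s) \<otimes> E i j k l"
    by simp
  also have "\<dots> = E i j (k + 2 * w11 * s) (l + w12 * s)"
    by (simp add: E_mult) (rule E_cong; simp)
  finally show ?thesis by (simp add: E_mult add.commute)
qed

lemma b_pow_mult: "E i (j + 2 ^ m * s) k l = E i j (k + 2 * w21 * s) (l + w22 * s)"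
proof -
  have "E 0 (2 ^ m * s) 0 0 = E 0 0 (2 * w21) w22 [^] s"
    by (simp add: E_b int_pow_pow flip: b_pow)
  also have "\<dots> = E 0 0 (2 * w21 * s) (w22 * s)"
    using yc_pow by (simp add: E_cy int_pow_mult_distrib int_pow_pow)
  finally have "E i j k l \<otimes> E 0 (2 ^ m * s) 0 0 = E i j k l \<otimes> E 0 0 (2 * w21 * s) (w22 * s)"
    by simp
  then show ?thesis by (simp add: E_mult add.commute)
qed

lemma E_sq: "E i j k l [^] (2::int) = E (2 * i) (2 * j) (2 * k - i * j) (2 * l + k * i + j * T i)"
proof -
  have "E i j k l [^] (2::int) = E i j k l \<otimes> E i j k l"
    using int_pow_mult[of "E i j k l" 1 1] by simp
  then show ?thesis by (simp add: E_mult mult.commute)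
qed

text \<open>The first squaring may leave an odd exponent of \<open>c\<close>, the second makes it
  even; this is why the induction starts at the fourth power.\<close>

lemma E_pow_two_pow:
  "\<exists>k' l'. E i j k l [^] ((2::int) ^ (r + 2)) = E (2 ^ (r + 2) * i) (2 ^ (r + 2) * j) (2 * k') l'"
proof (induction r)
  case 0
  have "E i j k l [^] ((2::int) ^ (0 + 2)) = (E i j k l [^] (2::int)) [^] (2::int)"
    by (simp add: int_pow_pow)
  also have "\<dots> = E (2 ^ (0 + 2) * i) (2 ^ (0 + 2) * j) (2 * ((2 * k - i * j) - 2 * i * j))
      (2 * (2 * l + k * i + j * T i) + (2 * k - i * j) * (2 * i) + (2 * j) * T (2 * i))"
    by (simp add: E_sq algebra_simps)
  finally show ?case by blast
next
  case (Suc r)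
  then obtain k' l' where *: "E i j k l [^] ((2::int) ^ (r + 2)) = E (2 ^ (r + 2) * i) (2 ^ (r + 2) * j) (2 * k') l'"
    by blast
  have "E i j k l [^] ((2::int) ^ (Suc r + 2)) = (E i j k l [^] ((2::int) ^ (r + 2))) [^] (2::int)"
    by (simp add: int_pow_pow mult.commute)
  also have "\<dots> = E (2 ^ (Suc r + 2) * i) (2 ^ (Suc r + 2) * j)
      (2 * (2 * k' - (2 * 2 ^ r * i) * (2 ^ (r + 2) * j)))
      (2 * l' + (2 * k') * (2 ^ (r + 2) * i) + (2 ^ (r + 2) * j) * T (2 ^ (r + 2) * i))"
    unfolding * E_sq by (simp add: algebra_simps)
  finally show ?case by blast
qed

text \<open>Here \<open>n\<close> is at least 3, so the exponent of \<open>c\<close> has become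
  even; the powers of \<open>a\<close> and \<open>b\<close> fold into \<open>P\<close> because
  \<open>2 ^ n\<close> is a multiple of \<open>2 ^ m\<close>.\<close>

lemma pow_n_in_P:
  assumes "x \<in> carrier G"
  shows "x [^] ((2::int) ^ n) \<in> P"
proof -
  obtain i j k l where x: "x = E i j k l" using normal_form assms by blast
  have n2: "n = (n - 2) + 2" using m2 mn by simp
  obtain k' l' where *: "x [^] ((2::int) ^ n) = E (2 ^ n * i) (2 ^ n * j) (2 * k') l'"
    unfolding x using E_pow_two_pow[of i j k l "n - 2"] unfolding n2[symmetric] by blast
  have jj: "(2::int) ^ n * j = 0 + 2 ^ m * (2 ^ (n - m) * j)"
    using mn by (simp flip: power_add mult.assoc)
  then have "x [^] ((2::int) ^ n) = E (0 + 2 ^ n * i) (0 + 2 ^ m * (2 ^ (n - m) * j)) (2 * k') l'"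
    unfolding jj[symmetric] using * by simp
  also have "\<dots> = E 0 0 (2 * (k' + w11 * i + w21 * (2 ^ (n - m) * j)))
      (l' + w12 * i + w22 * (2 ^ (n - m) * j))"
    unfolding b_pow_mult a_pow_mult by (simp add: algebra_simps)
  finally show ?thesis by (simp only: P_I)
qed

lemma index_pow_two:
  assumes "subgroup H G"
  shows "\<exists>i. card (rcosets H) = 2 ^ i"
proof -
  have "card (rcosets H) dvd 2 ^ N"
    unfolding order[symmetric] lagrange[OF assms, symmetric] by simp
  then show ?thesis by (simp add: divides_primepow_nat) blast
qed

lemma index_ge:
  assumes H: "subgroup H G" and "card H \<le> 2 ^ r" "r \<le> n + m + 3"
  shows "2 ^ (n + m + 3 - r) \<le> card (rcosets H)"
proof -
  have "(2::nat) ^ (n + m + 3 - r) * 2 ^ r = 2 ^ (n + m + 3)"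
    using assms by (simp flip: power_add)
  also have "\<dots> \<le> card (rcosets H) * card H"
    using order_ge lagrange[OF H] by simp
  also have "\<dots> \<le> card (rcosets H) * 2 ^ r" using assms by simp
  finally show ?thesis by simp
qed

lemma E_c_comm: "E 0 0 1 0 \<otimes> E i j k l = E i j k l \<otimes> (E 0 0 1 0 \<otimes> E 0 0 0 i)"
  by (simp add: E_mult add.commute add.left_commute)

text \<open>The commutator of \<open>c\<close> with an element of \<open>a\<close>-exponent
  \<open>i\<close> is \<open>y [^] i\<close>, which is \<open>y\<close> for odd
  \<open>i\<close>.\<close>

lemma heisenberg_x_c:
  assumes "odd i"
  shows "heisenberg_gens G (E i j k l) (E 0 0 1 0) (E 0 0 0 1)"
proof unfold_locales
  show "E 0 0 1 0 \<otimes> E i j k l = E i j k l \<otimes> (E 0 0 1 0 \<otimes> E 0 0 0 1)"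
    using E_c_comm[of i j k l] E_cong[of 0 0 i 1 0 0] assms by simp
  show "E 0 0 0 1 \<otimes> E i j k l = E i j k l \<otimes> E 0 0 0 1"
    by (simp add: E_mult add.commute)
  show "E 0 0 0 1 [^] (2::int) = \<one>" using y2 by (simp add: E_y)
qed (simp_all add: E_mult)

text \<open>Modulo \<open>P\<close>, of order at most 4, the two generators have orders dividing
  \<open>2 ^ n\<close> and 2.\<close>

lemma card_generate_x_c:
  assumes "odd i"
  shows "card (generate G {E i j k l, E 0 0 1 0}) \<le> 2 ^ (n + 3)"
proof -
  interpret H: heisenberg_gens G "E i j k l" "E 0 0 1 0" "E 0 0 0 1"
    using heisenberg_x_c[OF assms] .
  have "E 0 0 1 0 [^] int 2 \<in> P"
    using P_I[of 1 0] by (simp add: E_sq)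
  then have "card (generate G {E i j k l, E 0 0 1 0}) \<le> 2 ^ n * 2 * card P"
    using P_subgroup finite_P P_central[OF _ E_closed] pow_n_in_P[of "E i j k l"] P_I[of 0 1]
    by (intro H.card_generate_le) simp_all
  also have "\<dots> \<le> 2 ^ (n + 3)" using card_P_le by (simp add: power_add)
  finally show ?thesis .
qed

lemma A1_large_index:
  "\<exists>H. subgroup H G \<and> A1_group 2 (G\<lparr>carrier := H\<rparr>) \<and> 2 ^ m \<le> card (rcosets H)"
proof -
  interpret H: heisenberg_gens G "E 1 0 0 0" "E 0 0 1 0" "E 0 0 0 1"
    by (rule heisenberg_x_c) simp
  let ?H = "generate G {E 1 0 0 0, E 0 0 1 0}"
  have "subgroup ?H G" by (simp add: generate_is_subgroup)
  moreover have "A1_group 2 (G\<lparr>carrier := ?H\<rparr>)"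
    using H.A1_group_generate[OF order y1] .
  moreover have "2 ^ (n + m + 3 - (n + 3)) \<le> card (rcosets ?H)"
    using calculation(1) card_generate_x_c[of 1 0 0 0] by (intro index_ge) simp_all
  ultimately show ?thesis by auto
qed

text \<open>The coset of \<open>a\<^sup>i b\<^sup>j\<close> modulo the derived subgroup.\<close>

definition cls :: "int \<Rightarrow> int \<Rightarrow> 'a set" where "cls i j = {E i j k l |k l. True}"

lemma clsI [intro]: "E i j k l \<in> cls i j" by (auto simp: cls_def)
lemma clsE: assumes "x \<in> cls i j" obtains k l where "x = E i j k l"
  using assms by (auto simp: cls_def)

lemma cls_carrier: "x \<in> cls i j \<Longrightarrow> x \<in> carrier G" by (auto simp: cls_def)

lemma cls_mult: "x \<in> cls i j \<Longrightarrow> x' \<in> cls i' j' \<Longrightarrow> x \<otimes> x' \<in> cls (i + i') (j + j')"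
  by (elim clsE) (auto simp: E_mult)

lemma cls_inv: "x \<in> cls i j \<Longrightarrow> inv x \<in> cls (- i) (- j)"
  by (elim clsE) (auto simp: E_inv)

lemma cls_int_pow:
  assumes "x \<in> cls i j"
  shows "x [^] (r::int) \<in> cls (r * i) (r * j)"
proof -
  have x: "x \<in> carrier G" using assms cls_carrier by blast
  show ?thesis
  proof (induction r rule: int_induct[where k = 0])
    case base
    show ?case using clsI[of 0 0 0 0] by (simp add: E_zero)
  next
    case (step1 r)
    have "x [^] (r + 1) = x [^] r \<otimes> x" using x by (simp add: int_pow_mult)
    then show ?case using cls_mult[OF step1(2) assms] by (simp add: algebra_simps)
  next
    case (step2 r)
    have "x [^] (r - 1) = x [^] r \<otimes> inv x" using x by (simp add: int_pow_diff)
    then show ?case using cls_mult[OF step2(2) cls_inv[OF assms]] by (simp add: algebra_simps)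
  qed
qed

lemma cls_add_a: "cls (i + 2 ^ n * s) j \<subseteq> cls i j"
  by (auto simp: cls_def a_pow_mult)

lemma cls_add_b: "cls i (j + 2 ^ m * s) \<subseteq> cls i j"
  by (auto simp: cls_def b_pow_mult)

text \<open>The required element is \<open>x [^] s\<close> with \<open>s\<close> inverse to
  \<open>d\<close> modulo \<open>2 ^ n\<close>, and therefore also modulo
  \<open>2 ^ m\<close>.\<close>

lemma cls_odd_root:
  assumes H: "subgroup H G" and x: "x \<in> H" "x \<in> cls (d * i) (d * j)" and d: "odd d"
  obtains x' where "x' \<in> H" "x' \<in> cls i j"
proof -
  have "coprime d (2 ^ n)" using d by simp
  then obtain s t where st: "s * d + t * 2 ^ n = 1"
    using bezout_int[of d "2 ^ n"] by (metis coprime_iff_gcd_eq_1)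
  have sd: "s * d = 1 + 2 ^ n * (- t)" using st by (simp add: algebra_simps)
  have "s * (d * j) = j + 2 ^ n * (- t) * j"
    using sd by (metis (no_types, lifting) distrib_right mult.assoc mult_1)
  moreover have "(2::int) ^ n = 2 ^ m * 2 ^ (n - m)" using mn by (simp flip: power_add)
  ultimately have j: "s * (d * j) = j + 2 ^ m * (- (2 ^ (n - m)) * t * j)" by simp
  have i: "s * (d * i) = i + 2 ^ n * (- t * i)"
    using sd by (metis (no_types, lifting) distrib_right mult.assoc mult_1)
  have "x [^] s \<in> cls (s * (d * i)) (s * (d * j))" using cls_int_pow[OF x(2)] .
  then have "x [^] s \<in> cls i j" unfolding i j using cls_add_a cls_add_b by blast
  moreover have "x [^] s \<in> H" using H x by (simp add: subgroup_int_pow_closed)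
  ultimately show ?thesis using that by blast
qed

end

section \<open>Exclusion of minimal non-abelian subgroups of index at most 2\<close>

context tower_group begin

lemma T_double: "T (2 * s) = s * (2 * s - 1)"
  by (simp add: T_def)

text \<open>Writing the \<open>a\<close>-exponents of \<open>u\<close> and \<open>v\<close> as
  \<open>2 * s\<close> and \<open>2 * s'\<close>, the determinant \<open>?d\<close> must be odd,
  since otherwise the elements commute. Cramer's rule and an odd root then isolate the classes of
  \<open>a [^] 2\<close> and of \<open>b\<close>.\<close>

lemma even_pair:
  assumes H: "subgroup H G" and ev: "\<And>i j k l. E i j k l \<in> H \<Longrightarrow> even i"
    and uv: "u \<in> H" "v \<in> H" "u \<otimes> v \<noteq> v \<otimes> u"
  obtains u' v' where "u' \<in> H" "u' \<in> cls 2 0" "v' \<in> H" "v' \<in> cls 0 1"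
proof -
  have car: "u \<in> carrier G" "v \<in> carrier G" using uv H subgroup.mem_carrier by metis+
  obtain i j k l where u: "u = E i j k l" using normal_form[OF car(1)] by blast
  obtain i' j' k' l' where v: "v = E i' j' k' l'" using normal_form[OF car(2)] by blast
  obtain s where s: "i = 2 * s" using ev uv(1) u by blast
  obtain s' where s': "i' = 2 * s'" using ev uv(2) v by blast
  let ?d = "s * j' - s' * j"
  have d: "odd ?d"
  proof
    assume "even ?d"
    then obtain q where q: "s * j' = s' * j + 2 * q" by (metis add.commute diff_add_cancel dvdE)
    \<comment> \<open>Both products have the same exponents of \<open>a\<close> and
      \<open>b\<close>, so it remains to compare those of \<open>c\<close> modulo 4 and of
      \<open>y\<close> modulo 2.\<close>
    have "E i j k l \<otimes> E i' j' k' l' = E i' j' k' l' \<otimes> E i j k l"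
      unfolding E_mult s s' T_double add.commute[of "2 * s" "2 * s'"] add.commute[of j j']
    proof (rule E_cong)
      have "k + k' - j * (2 * s') - (k' + k - j' * (2 * s)) = 4 * q"
        using q by (simp add: algebra_simps)
      then show "4 dvd k + k' - j * (2 * s') - (k' + k - j' * (2 * s))" by simp
      have "l + l' + k * (2 * s') + j * (s' * (2 * s' - 1)) -
          (l' + l + k' * (2 * s) + j' * (s * (2 * s - 1)))
        = 2 * (k * s' + j * s' * s' - k' * s - s * j' * s) + (s * j' - s' * j)"
        by (simp add: algebra_simps)
      also have "\<dots> = 2 * (k * s' + j * s' * s' - k' * s - s * j' * s + q)"
        using q by simp
      finally show "2 dvd l + l' + k * (2 * s') + j * (s' * (2 * s' - 1)) -
          (l' + l + k' * (2 * s) + j' * (s * (2 * s - 1)))" by (rule dvdI)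
    qed
    then show False using uv(3) u v by simp
  qed
  have cu: "u \<in> cls i j" and cv: "v \<in> cls i' j'" by (auto simp: u v)
  have H': "u [^] (p::int) \<otimes> v [^] (q::int) \<in> H" for p q
    using H uv by (simp add: subgroup.m_closed subgroup_int_pow_closed)
  have "u [^] j' \<otimes> v [^] (- j) \<in> cls (?d * 2) (?d * 0)"
    using cls_mult[OF cls_int_pow[OF cu, of j'] cls_int_pow[OF cv, of "- j"]]
    by (simp add: s s' algebra_simps)
  from cls_odd_root[OF H H' this d] obtain u' where u': "u' \<in> H" "u' \<in> cls 2 0" .
  have "u [^] (- s') \<otimes> v [^] s \<in> cls (?d * 0) (?d * 1)"
    using cls_mult[OF cls_int_pow[OF cu, of "- s'"] cls_int_pow[OF cv, of s]]
    by (simp add: s s' algebra_simps)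
  from cls_odd_root[OF H H' this d] obtain v' where "v' \<in> H" "v' \<in> cls 0 1" .
  with u' that show ?thesis by blast
qed

text \<open>The fourth power is already \<open>a [^] 8\<close>, free of \<open>c\<close> and
  \<open>y\<close>. As \<open>n\<close> is at least 3, \<open>2 ^ (n - 1)\<close> is 4 times
  \<open>2 ^ (n - 3)\<close>.\<close>

lemma E_2_0_pow: "E 2 0 k l [^] ((2::int) ^ (n - 1)) = E 0 0 (2 * w11) w12"
proof -
  have n: "(2::int) ^ (n - 1) = 2 * 2 * 2 ^ (n - 3)" "(2::int) ^ n = 8 * 2 ^ (n - 3)"
  proof -
    have "n = Suc (Suc (Suc (n - 3)))" using m2 mn by simp
    then obtain r where "n = Suc (Suc (Suc r))" by blast
    then show "(2::int) ^ (n - 1) = 2 * 2 * 2 ^ (n - 3)" "(2::int) ^ n = 8 * 2 ^ (n - 3)" by simp_all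
  qed
  have "(E 2 0 k l [^] (2::int)) [^] (2::int) = E 8 0 0 0"
    unfolding E_sq by simp (rule E_cong; simp)
  then have "E 2 0 k l [^] ((2::int) ^ (n - 1)) = E 8 0 0 0 [^] ((2::int) ^ (n - 3))"
    unfolding n(1) by (simp only: int_pow_pow[symmetric] E_closed)
  also have "\<dots> = a [^] ((2::int) ^ n)"
    unfolding n(2) E_a by (simp only: int_pow_pow a)
  finally show ?thesis using a_pow by simp
qed

lemma E_0_1_pow: "E 0 1 k l [^] ((2::int) ^ m) = E 0 0 (2 * w21) w22"
proof -
  have m: "(2::int) ^ m = 2 * 2 * 2 ^ (m - 2)" "(2::int) ^ m = 4 * 2 ^ (m - 2)"
  proof -
    have "m = Suc (Suc (m - 2))" using m2 by simp
    then obtain r where "m = Suc (Suc r)" by blast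
    then show "(2::int) ^ m = 2 * 2 * 2 ^ (m - 2)" "(2::int) ^ m = 4 * 2 ^ (m - 2)" by simp_all
  qed
  have "(E 0 1 k l [^] (2::int)) [^] (2::int) = E 0 4 0 0"
    unfolding E_sq by simp (rule E_cong; simp)
  then have "E 0 1 k l [^] ((2::int) ^ m) = E 0 4 0 0 [^] ((2::int) ^ (m - 2))"
    unfolding m(1) by (simp only: int_pow_pow[symmetric] E_closed)
  also have "\<dots> = b [^] ((2::int) ^ m)"
    unfolding m(2) E_b by (simp only: int_pow_pow b)
  finally show ?thesis using b_pow by simp
qed

text \<open>Moving \<open>b\<close> past \<open>a [^] 2\<close> yields \<open>c [^] (-2)\<close>
  and, because \<open>T 2 = 1\<close>, one factor \<open>y\<close>; the exponent -2 equals 2 modulo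
  4.\<close>

lemma heisenberg_2_1: "heisenberg_gens G (E 2 0 k l) (E 0 1 k' l') (E 0 0 2 1)"
proof unfold_locales
  show "E 0 1 k' l' \<otimes> E 2 0 k l = E 2 0 k l \<otimes> (E 0 1 k' l' \<otimes> E 0 0 2 1)"
    unfolding E_mult by simp (rule E_cong; simp)
  show "E 0 0 2 1 \<otimes> E 2 0 k l = E 2 0 k l \<otimes> E 0 0 2 1"
    unfolding E_mult by simp (rule E_cong; simp)
  show "E 0 0 2 1 \<otimes> E 0 1 k' l' = E 0 1 k' l' \<otimes> E 0 0 2 1"
    unfolding E_mult by (simp add: add.commute)
  show "E 0 0 2 1 [^] (2::int) = \<one>"
    by (simp add: E_sq E_eq_one)
qed simp_all

lemma A1_index_gt_2:
  assumes H: "subgroup H G" and A1: "A1_group 2 (G\<lparr>carrier := H\<rparr>)"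
  shows "2 < card (rcosets H)"
proof (rule ccontr)
  assume "\<not> 2 < card (rcosets H)"
  then have 2: "card (rcosets H) \<le> 2" by simp
  have min: "minimal_nonabelian (G\<lparr>carrier := H\<rparr>)" using A1 by (simp add: A1_group_def)
  note sq = square_mem_of_index_le_2[OF H finite_carrier 2]
  \<comment> \<open>This writes \<open>c\<close> as a product of squares: the inverse of the square
    of \<open>a\<close>, then the square of \<open>a \<otimes> inv b\<close>, then the square of
    \<open>b\<close>.\<close>
  have "inv (E 1 0 0 0 \<otimes> E 1 0 0 0) \<otimes> ((E 1 (-1) 0 0 \<otimes> E 1 (-1) 0 0) \<otimes> (E 0 1 0 0 \<otimes> E 0 1 0 0)) = E 0 0 1 0"
    by (simp add: E_mult E_inv)
  moreover have "inv (E 1 0 0 0 \<otimes> E 1 0 0 0) \<otimes> ((E 1 (-1) 0 0 \<otimes> E 1 (-1) 0 0) \<otimes> (E 0 1 0 0 \<otimes> E 0 1 0 0)) \<in> H"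
    by (intro subgroup.m_closed[OF H] subgroup.m_inv_closed[OF H] sq E_closed)
  ultimately have cH: "E 0 0 1 0 \<in> H" by simp
  have ev: "even i" if x: "E i j k l \<in> H" for i j k l
  proof (rule ccontr)
    assume i: "odd i"
    have "E 0 0 1 0 \<otimes> E i j k l = E i j k l \<otimes> E 0 0 1 0 \<otimes> E 0 0 0 1"
      using E_c_comm[of i j k l] E_cong[of 0 0 i 1 0 0] i by (simp add: m_assoc)
    then have "E i j k l \<otimes> E 0 0 1 0 \<noteq> E 0 0 1 0 \<otimes> E i j k l"
      using y1 by simp
    from minimal_nonabelian_eq_generate[OF H min x cH this]
    have "card H \<le> 2 ^ (n + 3)" using card_generate_x_c[OF i] by simp
    from index_ge[OF H this] have "2 ^ m \<le> card (rcosets H)" by simp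
    moreover have "(2::nat) ^ 2 \<le> 2 ^ m" using m2 by (intro power_increasing) simp_all
    ultimately show False using 2 by simp
  qed
  obtain u v where uv: "u \<in> H" "v \<in> H" "u \<otimes> v \<noteq> v \<otimes> u"
    using A1_group_noncommuting[OF H A1] .
  obtain u' v' where u': "u' \<in> H" "u' \<in> cls 2 0" and v': "v' \<in> H" "v' \<in> cls 0 1"
    using even_pair[OF H ev uv] .
  obtain k l where ue: "u' = E 2 0 k l" using u'(2) by (rule clsE)
  obtain k' l' where ve: "v' = E 0 1 k' l'" using v'(2) by (rule clsE)
  interpret K: heisenberg_gens G "E 2 0 k l" "E 0 1 k' l'" "E 0 0 2 1"
    by (rule heisenberg_2_1)
  have "E 0 1 k' l' \<otimes> E 2 0 k l = E 2 0 k l \<otimes> E 0 1 k' l' \<otimes> E 0 0 2 1"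
    using K.vu by (simp add: m_assoc)
  then have "u' \<otimes> v' \<noteq> v' \<otimes> u'"
    unfolding ue ve using c2y by simp
  \<comment> \<open>The bound below gives \<open>H\<close> order at most
    \<open>2 ^ (n + m + 1)\<close>, hence index at least 4.\<close>
  then have "H = generate G {u', v'}"
    using minimal_nonabelian_eq_generate[OF H min u'(1) v'(1)] by simp
  also have "card (generate G {u', v'}) \<le> 2 ^ (n - 1) * 2 ^ m * card P"
    unfolding ue ve using P_subgroup finite_P P_central[OF _ E_closed] P_I[of 1 1]
    by (intro K.card_generate_le) (simp_all add: E_2_0_pow[simplified] E_0_1_pow P_I)
  also have "\<dots> \<le> 2 ^ (n - 1) * 2 ^ m * 2 ^ 2"
    using card_P_le by simp
  also have "\<dots> = 2 ^ (n + m + 1)"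
    using mn by (cases n) (simp_all add: power_add)
  finally have "card H \<le> 2 ^ (n + m + 1)" .
  from index_ge[OF H this] have "4 \<le> card (rcosets H)" by simp
  with 2 show False by simp
qed

section \<open>Upper bound 4 for the index of non-abelian subgroups\<close>

lemma E_0_0_pow: "E 0 0 k l [^] (r::int) = E 0 0 (r * k) (r * l)"
  using yc_pow by (simp add: E_cy int_pow_mult_distrib int_pow_pow mult.commute)

text \<open>\<open>P\<close> behaves like a plane over the two-element field with coordinates
  \<open>k\<close> and \<open>l\<close>; two vectors with odd determinant span it. The coefficients
  \<open>r\<close> and \<open>r'\<close> come from Cramer's rule.\<close>

lemma P_subset_of_det:
  assumes H: "subgroup H G" and x: "E 0 0 (2 * p) q \<in> H" and x': "E 0 0 (2 * p') q' \<in> H"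
    and d: "odd (p * q' - p' * q)"
  shows "P \<subseteq> H"
proof
  fix t assume "t \<in> P"
  then obtain k l where t: "t = E 0 0 (2 * k) l" by (auto simp: P_def)
  define r r' where "r = k * q' - l * p'" and "r' = l * p - k * q"
  have "E 0 0 (2 * p) q [^] r \<otimes> E 0 0 (2 * p') q' [^] r' \<in> H"
    using x x' H by (simp add: subgroup.m_closed subgroup_int_pow_closed)
  also have "E 0 0 (2 * p) q [^] r \<otimes> E 0 0 (2 * p') q' [^] r' =
      E 0 0 (2 * (k * (p * q' - p' * q))) (l * (p * q' - p' * q))"
    by (simp add: E_mult E_0_0_pow r_def r'_def algebra_simps)
  also have "\<dots> = t"
  proof -
    obtain e where "p * q' - p' * q = 2 * e + 1" using d oddE by blast
    then show ?thesis unfolding t by (intro E_cong) (simp_all add: algebra_simps)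
  qed
  finally show "t \<in> H" .
qed

text \<open>The square of an odd number is 1 modulo 4, so the \<open>k * d\<close>-th power of the
  given element has the right exponent of \<open>c\<close>; a power of \<open>y\<close> corrects the
  rest.\<close>

lemma E_0_0_mem:
  assumes H: "subgroup H G" and x: "E 0 0 d e \<in> H" and y: "E 0 0 0 1 \<in> H" and d: "odd d"
  shows "E 0 0 k l \<in> H"
proof -
  have "E 0 0 d e [^] (k * d) \<otimes> E 0 0 0 1 [^] (l - k * d * e) \<in> H"
    using x y H by (simp add: subgroup.m_closed subgroup_int_pow_closed)
  also have "E 0 0 d e [^] (k * d) \<otimes> E 0 0 0 1 [^] (l - k * d * e) = E 0 0 (k * d * d) l"
    by (simp add: E_mult E_0_0_pow)
  also have "\<dots> = E 0 0 k l"
  proof (rule E_cong)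
    obtain f where "d = 2 * f + 1" using d oddE by blast
    then have "k * d * d - k = 4 * (k * f * f + k * f)" by (simp add: algebra_simps)
    then show "4 dvd k * d * d - k" by simp
  qed simp
  finally show ?thesis .
qed

text \<open>\<open>R\<close> lists the exponents of \<open>a\<close> and \<open>b\<close> that
  remain after multiplication by \<open>H\<close>. Modulo \<open>P\<close> only the parity of the
  exponent of \<open>c\<close> survives, which gives the factor 2.\<close>

lemma index_le_of_P_subset:
  assumes H: "subgroup H G" and PH: "P \<subseteq> H" and R: "finite R"
    and red: "\<And>g. g \<in> carrier G \<Longrightarrow> \<exists>h\<in>H. \<exists>(i, j)\<in>R. h \<otimes> g \<in> cls i j"
  shows "card (rcosets H) \<le> 2 * card R"
proof -
  let ?S = "(\<lambda>((i, j), k). E i j k 0) ` (R \<times> {0, 1})"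
  have "\<exists>h\<in>H. h \<otimes> g \<in> ?S" if g: "g \<in> carrier G" for g
  proof -
    obtain h i j where h: "h \<in> H" "(i, j) \<in> R" "h \<otimes> g \<in> cls i j" using red[OF g] by blast
    obtain k l where e: "h \<otimes> g = E i j k l" using h(3) by (rule clsE)
    define q where "q = k div 2"
    have q: "k - 2 * q = k mod 2" by (simp add: q_def minus_mult_div_eq_mod)
    \<comment> \<open>The second exponent also compensates the power of \<open>y\<close> that arises
      when \<open>c\<close> passes \<open>a [^] i\<close>.\<close>
    let ?p = "E 0 0 (2 * (- q)) (2 * q * i - l)"
    have p: "?p \<in> H" using PH P_I by blast
    have "?p \<otimes> (h \<otimes> g) = E i j (k - 2 * q) 0"
      unfolding e E_mult by (simp add: algebra_simps)
    then have "(?p \<otimes> h) \<otimes> g = E i j (k mod 2) 0"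
      using g h(1) subgroup.mem_carrier[OF H] unfolding q by (simp add: m_assoc)
    moreover have "E i j (k mod 2) 0 \<in> ?S"
      by (rule image_eqI[where x = "((i, j), k mod 2)"]) (use h(2) in auto)
    ultimately show ?thesis
      using subgroup.m_closed[OF H p h(1)] by metis
  qed
  then have "card (rcosets H) \<le> card ?S"
    by (intro card_rcosets_le[OF H]) (auto simp: R)
  also have "\<dots> \<le> card (R \<times> {0, 1::int})" by (rule card_image_le) (simp add: R)
  also have "\<dots> = 2 * card R" by (simp add: card_cartesian_product)
  finally show ?thesis .
qed

lemma index_le_of_derived_subset:
  assumes H: "subgroup H G" and DH: "\<And>k l. E 0 0 k l \<in> H" and R: "finite R"
    and red: "\<And>g. g \<in> carrier G \<Longrightarrow> \<exists>h\<in>H. \<exists>(i, j)\<in>R. h \<otimes> g \<in> cls i j"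
  shows "card (rcosets H) \<le> card R"
proof -
  let ?S = "(\<lambda>(i, j). E i j 0 0) ` R"
  have "\<exists>h\<in>H. h \<otimes> g \<in> ?S" if g: "g \<in> carrier G" for g
  proof -
    obtain h i j where h: "h \<in> H" "(i, j) \<in> R" "h \<otimes> g \<in> cls i j" using red[OF g] by blast
    obtain k l where e: "h \<otimes> g = E i j k l" using h(3) by (rule clsE)
    let ?p = "E 0 0 (- k) (k * i - l)"
    have "?p \<otimes> (h \<otimes> g) = E i j 0 0"
      unfolding e E_mult by (simp add: algebra_simps)
    then have "(?p \<otimes> h) \<otimes> g = E i j 0 0"
      using g h(1) subgroup.mem_carrier[OF H] by (simp add: m_assoc)
    moreover have "E i j 0 0 \<in> ?S"
      by (rule image_eqI[where x = "(i, j)"]) (use h(2) in auto)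
    ultimately show ?thesis
      using subgroup.m_closed[OF H DH h(1)] by metis
  qed
  then have "card (rcosets H) \<le> card ?S"
    by (intro card_rcosets_le[OF H]) (auto simp: R)
  also have "\<dots> \<le> card R" by (rule card_image_le) (simp add: R)
  finally show ?thesis .
qed

text \<open>\<open>H\<close> meets the classes of \<open>a [^] 2\<close> and \<open>b\<close>. The
  commutator of such elements is the product of \<open>y\<close> and the square of \<open>c\<close>,
  and a power of the first equals \<open>E 0 0 (2 * w11) w12\<close>; the parity of
  \<open>w11 + w12\<close> makes these two span \<open>P\<close>. What remains is the parity of the
  exponents of \<open>a\<close> and \<open>c\<close>.\<close>

lemma index_le_4_even:
  assumes H: "subgroup H G" and ev: "\<And>i j k l. E i j k l \<in> H \<Longrightarrow> even i"
    and uv: "u \<in> H" "v \<in> H" "u \<otimes> v \<noteq> v \<otimes> u" and w: "odd (w11 + w12)"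
  shows "card (rcosets H) \<le> 4"
proof -
  obtain u' v' where u': "u' \<in> H" "u' \<in> cls 2 0" and v': "v' \<in> H" "v' \<in> cls 0 1"
    using even_pair[OF H ev uv] .
  obtain k l where ue: "u' = E 2 0 k l" using u'(2) by (rule clsE)
  obtain k' l' where ve: "v' = E 0 1 k' l'" using v'(2) by (rule clsE)
  interpret K: heisenberg_gens G "E 2 0 k l" "E 0 1 k' l'" "E 0 0 2 1"
    by (rule heisenberg_2_1)
  have "E 0 0 2 1 = inv (u' \<otimes> v') \<otimes> (v' \<otimes> u')"
    unfolding ue ve K.vu by (subst m_assoc[symmetric]; simp add: m_assoc inv_solve_left)
  then have "E 0 0 (2 * 1) 1 \<in> H"
    using u'(1) v'(1) H by (simp add: subgroup.m_closed subgroup.m_inv_closed)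
  moreover have "E 0 0 (2 * w11) w12 \<in> H"
    using subgroup_int_pow_closed[OF H u'(1), of "2 ^ (n - 1)"] unfolding ue E_2_0_pow .
  ultimately have PH: "P \<subseteq> H"
    using w by (intro P_subset_of_det[OF H, of 1 1 w11 w12]) auto
  have "card (rcosets H) \<le> 2 * card {(0::int, 0::int), (1, 0)}"
  proof (rule index_le_of_P_subset[OF H PH])
    fix g assume g: "g \<in> carrier G"
    obtain i j k l where ge: "g = E i j k l" using normal_form[OF g] by blast
    define q where "q = i div 2"
    have q: "- q * 2 + i = i mod 2" by (simp add: q_def minus_div_mult_eq_mod)
    have "u' [^] (- q) \<otimes> g \<in> cls (i mod 2) j"
      using cls_mult[OF cls_int_pow[OF u'(2), of "- q"] clsI[of i j k l]] unfolding ge q by simp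
    then have "v' [^] (- j) \<otimes> (u' [^] (- q) \<otimes> g) \<in> cls (i mod 2) 0"
      using cls_mult[OF cls_int_pow[OF v'(2), of "- j"]] by fastforce
    then have "(v' [^] (- j) \<otimes> u' [^] (- q)) \<otimes> g \<in> cls (i mod 2) 0"
      using g u' v' by (simp add: m_assoc cls_carrier)
    moreover have "v' [^] (- j) \<otimes> u' [^] (- q) \<in> H"
      using u'(1) v'(1) by (intro subgroup.m_closed[OF H] subgroup_int_pow_closed[OF H])
    moreover have "i mod 2 = 0 \<or> i mod 2 = 1" by presburger
    ultimately show "\<exists>h\<in>H. \<exists>(i, j)\<in>{(0, 0), (1, 0)}. h \<otimes> g \<in> cls i j" by auto
  qed simp
  then show ?thesis by simp
qed

lemma commute_mult:
  assumes "x \<in> carrier G" "x' \<in> carrier G" "t \<in> carrier G"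
    and "x \<otimes> t = t \<otimes> x" "x' \<otimes> t = t \<otimes> x'"
  shows "(x \<otimes> x') \<otimes> t = t \<otimes> (x \<otimes> x')"
proof -
  have "(x \<otimes> x') \<otimes> t = x \<otimes> (x' \<otimes> t)" using assms(1-3) by (simp add: m_assoc)
  also have "\<dots> = (x \<otimes> t) \<otimes> x'" using assms(1-3) by (simp add: assms(5) m_assoc)
  also have "\<dots> = t \<otimes> (x \<otimes> x')" unfolding assms(4) using assms(1-3) by (simp add: m_assoc)
  finally show ?thesis .
qed

text \<open>A power \<open>u\<close> of the given element has \<open>a\<close>-exponent 1, and every
  element of \<open>H\<close> is a power of \<open>u\<close> times one of \<open>a\<close>-exponent
  0. The latter commute with each other, so if all those in \<open>H\<close> commuted with
  \<open>u\<close>, then \<open>H\<close> would be abelian.\<close>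

lemma odd_pair:
  assumes H: "subgroup H G" and x: "E i j k l \<in> H" and i: "odd i"
    and uv: "u0 \<in> H" "v0 \<in> H" "u0 \<otimes> v0 \<noteq> v0 \<otimes> u0"
  obtains u v j1 j2 where "u \<in> H" "u \<in> cls 1 j1" "v \<in> H" "v \<in> cls 0 j2" "u \<otimes> v \<noteq> v \<otimes> u"
proof -
  have "coprime i (2 ^ n)" using i by simp
  then obtain s t where st: "s * i + t * 2 ^ n = 1"
    using bezout_int[of i "2 ^ n"] by (metis coprime_iff_gcd_eq_1)
  have si: "s * i = 1 + 2 ^ n * (- t)" using st by (simp add: algebra_simps)
  define u where "u = E i j k l [^] s"
  have uH: "u \<in> H" unfolding u_def using subgroup_int_pow_closed[OF H x] .
  have "u \<in> cls (s * i) (s * j)" unfolding u_def by (rule cls_int_pow) (rule clsI)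
  then have u: "u \<in> cls 1 (s * j)" unfolding si using cls_add_a by blast
  have uc: "u \<in> carrier G" using u by (rule cls_carrier)
  have "\<exists>v j2. v \<in> H \<and> v \<in> cls 0 j2 \<and> u \<otimes> v \<noteq> v \<otimes> u"
  proof (rule ccontr)
    assume "\<nexists>v j2. v \<in> H \<and> v \<in> cls 0 j2 \<and> u \<otimes> v \<noteq> v \<otimes> u"
    then have com: "u \<otimes> v = v \<otimes> u" if "v \<in> H" "v \<in> cls 0 j2" for v j2
      using that by blast
    have split: "\<exists>p g0 j2. g = u [^] (p::int) \<otimes> g0 \<and> g0 \<in> H \<and> g0 \<in> cls 0 j2" if gH: "g \<in> H" for g
    proof -
      have g: "g \<in> carrier G" using subgroup.mem_carrier[OF H gH] .
      obtain i' j' k' l' where ge: "g = E i' j' k' l'" using normal_form[OF g] by blast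
      have "u [^] (- i') \<otimes> g \<in> cls (- i' * 1 + i') (- i' * (s * j) + j')"
        unfolding ge by (rule cls_mult[OF cls_int_pow[OF u] clsI])
      then have "u [^] (- i') \<otimes> g \<in> cls 0 (- i' * (s * j) + j')" by simp
      moreover have "u [^] (- i') \<otimes> g \<in> H"
        using subgroup.m_closed[OF H subgroup_int_pow_closed[OF H uH] gH] .
      moreover have "g = u [^] i' \<otimes> (u [^] (- i') \<otimes> g)"
        using g uc by (simp add: m_assoc[symmetric] int_pow_mult[symmetric])
      ultimately show ?thesis by blast
    qed
    have ug: "u [^] (p::int) \<otimes> g = g \<otimes> u [^] p" if gH: "g \<in> H" for g p
    proof -
      obtain q g0 j2 where g: "g = u [^] (q::int) \<otimes> g0" "g0 \<in> H" "g0 \<in> cls 0 j2"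
        using split[OF gH] by blast
      have g0: "g0 \<in> carrier G" using g(3) by (rule cls_carrier)
      have "g0 \<otimes> u = u \<otimes> g0" using com[OF g(2,3)] by simp
      then have "(u [^] q \<otimes> g0) \<otimes> u = u \<otimes> (u [^] q \<otimes> g0)"
        using commute_int_pow[of u u q 1] uc g0 by (intro commute_mult) simp_all
      then have "u \<otimes> g = g \<otimes> u" by (simp add: g(1))
      then show ?thesis
        using commute_int_pow[of g u p 1] uc subgroup.mem_carrier[OF H gH] by simp
    qed
    obtain p g0 j2 where g: "u0 = u [^] (p::int) \<otimes> g0" "g0 \<in> H" "g0 \<in> cls 0 j2"
      using split[OF uv(1)] by blast
    obtain q h0 j3 where h: "v0 = u [^] (q::int) \<otimes> h0" "h0 \<in> H" "h0 \<in> cls 0 j3"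
      using split[OF uv(2)] by blast
    have g0: "g0 \<in> carrier G" using g(3) by (rule cls_carrier)
    have h0: "h0 \<in> carrier G" using h(3) by (rule cls_carrier)
    have v0: "v0 \<in> carrier G" using subgroup.mem_carrier[OF H uv(2)] .
    have "h0 \<otimes> g0 = g0 \<otimes> h0"
      using g(3) h(3) by (elim clsE) (simp add: E_mult add.commute)
    then have "v0 \<otimes> g0 = g0 \<otimes> v0"
      unfolding h(1) using g0 h0 uc ug[OF g(2)] by (intro commute_mult) simp_all
    then have "u0 \<otimes> v0 = v0 \<otimes> u0"
      unfolding g(1) using g0 v0 uc ug[OF uv(2)] by (intro commute_mult) simp_all
    then show False using uv(3) by simp
  qed
  then show ?thesis using that uH u by blast
qed

text \<open>The last factor is the commutator; only the exponents of \<open>b\<close> and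
  \<open>c\<close> in the second element enter it.\<close>

lemma swap_1_0:
  "E 1 j1 k l \<otimes> E 0 j k' l' = E 0 j k' l' \<otimes> E 1 j1 k l \<otimes> E 0 0 j k'"
  unfolding E_mult add.commute[of j j1] by simp (rule E_cong; simp)

lemma swap_1_0_mem:
  assumes H: "subgroup H G" and u: "E 1 j1 k l \<in> H" and v: "E 0 j k' l' \<in> H"
  shows "E 0 0 j k' \<in> H"
proof -
  have "E 0 0 j k' = inv (E 0 j k' l' \<otimes> E 1 j1 k l) \<otimes> (E 1 j1 k l \<otimes> E 0 j k' l')"
    unfolding swap_1_0 by (subst m_assoc[symmetric]) simp_all
  then show ?thesis
    using u v H by (simp add: subgroup.m_closed subgroup.m_inv_closed)
qed

text \<open>The eighth power is \<open>a [^] 8\<close>: for \<open>m = 2\<close> the power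
  \<open>b [^] (8 * j)\<close> is the square of an element of \<open>P\<close>, hence trivial. Since
  \<open>n\<close> is at least 3, \<open>2 ^ n\<close> is a multiple of 8.\<close>

lemma E_1_pow:
  assumes "m = 2"
  shows "E 1 j k l [^] ((2::int) ^ n) = E 0 0 (2 * w11) w12"
proof -
  have n: "(2::int) ^ n = 2 * 2 * 2 * 2 ^ (n - 3)" "(2::int) ^ n = 8 * 2 ^ (n - 3)"
  proof -
    have "n = Suc (Suc (Suc (n - 3)))" using m2 mn by simp
    then obtain r where "n = Suc (Suc (Suc r))" by blast
    then show "(2::int) ^ n = 2 * 2 * 2 * 2 ^ (n - 3)" "(2::int) ^ n = 8 * 2 ^ (n - 3)" by simp_all
  qed
  have "((E 1 j k l [^] (2::int)) [^] (2::int)) [^] (2::int) = E 8 (0 + 2 ^ m * (2 * j)) 0 0"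
    unfolding E_sq by (simp add: assms) (rule E_cong; simp add: T_def)
  also have "\<dots> = E 8 0 0 0"
    unfolding b_pow_mult by (rule E_cong) simp_all
  finally have "E 1 j k l [^] ((2::int) ^ n) = E 8 0 0 0 [^] ((2::int) ^ (n - 3))"
    unfolding n(1) by (simp only: int_pow_pow[symmetric] E_closed)
  also have "\<dots> = a [^] ((2::int) ^ n)"
    unfolding n(2) E_a by (simp only: int_pow_pow a)
  finally show ?thesis using a_pow by simp
qed

text \<open>With \<open>u\<close> of \<open>a\<close>-exponent 1 in \<open>H\<close>, only the
  exponents of \<open>b\<close> and \<open>c\<close> remain to be reduced. Depending on
  \<open>j2\<close> modulo 4, either \<open>H\<close> contains the whole derived subgroup, leaving
  four classes of powers of \<open>b\<close>, or \<open>H\<close> contains \<open>P\<close> and the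
  parities of both exponents remain.\<close>

lemma index_le_4_odd:
  assumes m: "m = 2" and H: "subgroup H G" and x: "E i j k l \<in> H" and i: "odd i"
    and uv: "u0 \<in> H" "v0 \<in> H" "u0 \<otimes> v0 \<noteq> v0 \<otimes> u0"
    and w: "odd (w11 + w12)" "odd w12 \<or> odd w22"
  shows "card (rcosets H) \<le> 4"
proof -
  obtain u v j1 j2 where u: "u \<in> H" "u \<in> cls 1 j1" and v: "v \<in> H" "v \<in> cls 0 j2"
    and nc: "u \<otimes> v \<noteq> v \<otimes> u"
    using odd_pair[OF H x i uv] .
  obtain k1 l1 where ue: "u = E 1 j1 k1 l1" using u(2) by (rule clsE)
  obtain k2 l2 where ve: "v = E 0 j2 k2 l2" using v(2) by (rule clsE)
  note mem = swap_1_0_mem[OF H u(1)[unfolded ue]]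
  have e: "E 0 0 j2 k2 \<in> H" using mem[OF v(1)[unfolded ve]] .
  have red: "\<exists>h\<in>H. \<exists>j'. h \<otimes> g \<in> cls 0 j'" if g: "g \<in> carrier G" for g
  proof -
    obtain i' j' k' l' where ge: "g = E i' j' k' l'" using normal_form[OF g] by blast
    have "u [^] (- i') \<otimes> g \<in> cls (- i' * 1 + i') (- i' * j1 + j')"
      unfolding ge by (rule cls_mult[OF cls_int_pow[OF u(2)] clsI])
    then have "u [^] (- i') \<otimes> g \<in> cls 0 (- i' * j1 + j')" by simp
    then show ?thesis using subgroup_int_pow_closed[OF H u(1)] by blast
  qed
  have derived_case: "card (rcosets H) \<le> 4" if D: "\<And>k l. E 0 0 k l \<in> H"
  proof -
    have "card (rcosets H) \<le> card (Pair (0::int) ` {0, 1, 2, 3::int})"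
    proof (rule index_le_of_derived_subset[OF H D])
      fix g assume "g \<in> carrier G"
      then obtain h j' where h: "h \<in> H" "h \<otimes> g \<in> cls 0 j'" using red by blast
      have "h \<otimes> g \<in> cls 0 (j' mod 4 + 2 ^ m * (j' div 4))" using h(2) by (simp add: m)
      then have "h \<otimes> g \<in> cls 0 (j' mod 4)" by (rule subsetD[OF cls_add_b])
      moreover have "j' mod 4 = 0 \<or> j' mod 4 = 1 \<or> j' mod 4 = 2 \<or> j' mod 4 = 3" by presburger
      then have "(0, j' mod 4) \<in> Pair 0 ` {0, 1, 2, 3}" by auto
      ultimately show "\<exists>h\<in>H. \<exists>(i, j)\<in>Pair 0 ` {0, 1, 2, 3}. h \<otimes> g \<in> cls i j"
        by (intro bexI[OF _ h(1)] bexI[of _ "(0, j' mod 4)"]) simp_all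
    qed simp
    also have "\<dots> \<le> card {0, 1, 2, 3::int}" by (rule card_image_le) simp
    finally show ?thesis by simp
  qed
  consider "odd j2" | t where "j2 = 4 * t" | t where "j2 = 4 * t + 2"
  proof -
    have "odd j2 \<or> j2 = 4 * (j2 div 4) \<or> j2 = 4 * (j2 div 4) + 2" by presburger
    then show ?thesis using that by blast
  qed
  then show ?thesis
  proof cases
    case 1
    \<comment> \<open>The commutator of \<open>u\<close> with \<open>e\<close>, whose exponent of
      \<open>c\<close> is the odd \<open>j2\<close>, is \<open>y\<close>.\<close>
    have "E 0 0 0 1 \<in> H" using mem[OF e] E_cong[of 0 0 j2 1 0 0] 1 by simp
    then show ?thesis using E_0_0_mem[OF H e _ 1] derived_case by blast
  next
    case (2 t)
    \<comment> \<open>Here the commutator of \<open>u\<close> and \<open>v\<close> reduces to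
      \<open>y [^] k2\<close> and must not be trivial.\<close>
    have k2: "odd k2"
    proof
      assume "even k2"
      then have "E 0 0 j2 k2 = \<one>" using 2 by (intro E_eq_one) simp_all
      then show False using nc swap_1_0[of j1 k1 l1 j2 k2 l2] by (simp add: ue ve)
    qed
    have y: "E 0 0 0 1 \<in> H" using e E_cong[of j2 0 k2 1 0 0] 2 k2 by simp
    have "v = E 0 (0 + 2 ^ m * t) k2 l2" by (simp add: ve 2 m)
    also have "\<dots> = E 0 0 (k2 + 2 * w21 * t) (l2 + w22 * t)" by (rule b_pow_mult)
    finally have "E 0 0 (k2 + 2 * w21 * t) (l2 + w22 * t) \<in> H" using v(1) by simp
    moreover have "odd (k2 + 2 * w21 * t)" using k2 by simp
    ultimately show ?thesis using E_0_0_mem[OF H _ y] derived_case by blast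
  next
    case (3 t)
    let ?t = "2 * t + 1"
    have e1: "E 0 0 (2 * 1) k2 \<in> H" using e E_cong[of j2 2 k2 k2 0 0] 3 by simp
    have e2: "E 0 0 (2 * w11) w12 \<in> H"
      using subgroup_int_pow_closed[OF H u(1), of "2 ^ n"] unfolding ue E_1_pow[OF m] .
    have "v [^] (2::int) = E 0 (0 + 2 ^ m * ?t) (2 * k2) (2 * l2)"
      unfolding ve E_sq by (simp add: 3 m)
    also have "\<dots> = E 0 0 (2 * (k2 + w21 * ?t)) (2 * l2 + w22 * ?t)"
      unfolding b_pow_mult by (simp add: algebra_simps)
    finally have e3: "E 0 0 (2 * (k2 + w21 * ?t)) (2 * l2 + w22 * ?t) \<in> H"
      using subgroup_int_pow_closed[OF H v(1), of 2] by simp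
    \<comment> \<open>Three elements of \<open>P\<close> are available: the commutator
      \<open>e1\<close>, the power \<open>e2\<close> of \<open>u\<close> and the square
      \<open>e3\<close> of \<open>v\<close>. The pair \<open>e1\<close>, \<open>e3\<close> has
      determinant of the parity of \<open>w22\<close> when \<open>k2\<close> is even; in the other
      case \<open>e1\<close> and \<open>e2\<close> suffice.\<close>
    have PH: "P \<subseteq> H"
    proof (cases "even k2 \<and> even w12")
      case True
      then have "odd w22" using w by blast
      then show ?thesis using True by (intro P_subset_of_det[OF H e1 e3]) simp
    next
      case False
      then show ?thesis using w(1) by (intro P_subset_of_det[OF H e1 e2]) auto
    qed
    have "card (rcosets H) \<le> 2 * card {(0::int, 0::int), (0, 1)}"
    proof (rule index_le_of_P_subset[OF H PH])
      fix g assume g: "g \<in> carrier G"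
      obtain h j' where h: "h \<in> H" "h \<otimes> g \<in> cls 0 j'" using red[OF g] by blast
      define q where "q = j' div 2"
      have q: "- q * j2 + j' = j' mod 2 + 2 ^ m * (- q * t)"
        \<comment> \<open>Since \<open>j2\<close> is \<open>4 * t + 2\<close>, subtracting
          \<open>q * j2\<close> leaves the remainder modulo 2 up to a multiple of
          \<open>2 ^ m\<close>, which is 4 here.\<close>
        using minus_mult_div_eq_mod[of j' 2] by (simp add: q_def 3 m algebra_simps)
      have "v [^] (- q) \<otimes> (h \<otimes> g) \<in> cls (- q * 0 + 0) (- q * j2 + j')"
        by (rule cls_mult[OF cls_int_pow[OF v(2)] h(2)])
      then have "v [^] (- q) \<otimes> (h \<otimes> g) \<in> cls 0 (j' mod 2 + 2 ^ m * (- q * t))"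
        unfolding q by (simp only: mult_zero_right add_0_right)
      then have "v [^] (- q) \<otimes> (h \<otimes> g) \<in> cls 0 (j' mod 2)"
        by (rule subsetD[OF cls_add_b])
      then have "(v [^] (- q) \<otimes> h) \<otimes> g \<in> cls 0 (j' mod 2)"
        using g v(1) h(1) subgroup.mem_carrier[OF H] by (simp add: m_assoc)
      moreover have "v [^] (- q) \<otimes> h \<in> H"
        using v(1) h(1) by (intro subgroup.m_closed[OF H] subgroup_int_pow_closed[OF H])
      moreover have "j' mod 2 = 0 \<or> j' mod 2 = 1" by presburger
      ultimately show "\<exists>h\<in>H. \<exists>(i, j)\<in>{(0, 0), (0, 1)}. h \<otimes> g \<in> cls i j" by auto
    qed simp
    then show ?thesis by simp
  qed
qed

lemma A1_index_le_4:
  assumes "m = 2" "odd (w11 + w12)" "odd w12 \<or> odd w22"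
    and H: "subgroup H G" and "A1_group 2 (G\<lparr>carrier := H\<rparr>)"
  shows "card (rcosets H) \<le> 4"
proof -
  obtain u v where "u \<in> H" "v \<in> H" "u \<otimes> v \<noteq> v \<otimes> u"
    using A1_group_noncommuting[OF H assms(5)] .
  then show ?thesis
    using index_le_4_odd[OF assms(1) H _ _ _ _ _ assms(2,3)] index_le_4_even[OF H _ _ _ _ assms(2)]
    by metis
qed

section \<open>Minimal non-abelian subgroups of index at least 8\<close>

text \<open>The parity conditions say that \<open>u [^] int r\<close> and \<open>v [^] int s\<close>
  lie in the subgroup of order 2 generated by the commutator. So the group generated has order at
  most \<open>2 ^ (n + 2)\<close>, against \<open>2 ^ (n + 5)\<close> for a lower bound of the whole
  order.\<close>

lemma A1_index_ge_8:
  assumes m: "m = 2" and uvz: "heisenberg_gens G u v (E 0 0 2 e)" and e: "E 0 0 2 e \<noteq> \<one>"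
    and rs: "0 < r" "0 < s" "r * s \<le> 2 ^ (n + 1)"
    and u: "u [^] int r = E 0 0 (2 * p) q" "even (e * p - q)"
    and v: "v [^] int s = E 0 0 (2 * p') q'" "even (e * p' - q')"
  shows "\<exists>H. subgroup H G \<and> A1_group 2 (G\<lparr>carrier := H\<rparr>) \<and> 8 \<le> card (rcosets H)"
proof -
  interpret K: heisenberg_gens G u v "E 0 0 2 e" by (rule uvz)
  let ?H = "generate G {u, v}" and ?Z = "{E 0 0 0 0, E 0 0 2 e}"
  have H: "subgroup ?H G" by (simp add: generate_is_subgroup)
  have Zsq: "E 0 0 2 e \<otimes> E 0 0 2 e = \<one>" by (simp add: E_mult E_eq_one)
  then have "inv (E 0 0 2 e) = E 0 0 2 e" by (intro inv_equality) simp_all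
  then have Z: "subgroup ?Z G"
    by (intro subgroupI) (auto simp: E_zero Zsq)
  have mem: "E 0 0 (2 * p) q \<in> ?Z" if "even (e * p - q)" for p q
  proof (cases "even p")
    case True
    then have "E 0 0 (2 * p) q = E 0 0 0 0" using that by (intro E_cong) auto
    then show ?thesis by simp
  next
    case False
    then have "E 0 0 (2 * p) q = E 0 0 2 e" using that by (intro E_cong) (auto elim!: oddE)
    then show ?thesis by simp
  qed
  have "card ?H \<le> r * s * card ?Z"
    using Z rs mem u v K.zv by (intro K.card_generate_le) (auto simp: E_zero)
  also have "\<dots> \<le> r * s * 2" by (intro mult_left_mono) (auto simp: card_insert_if)
  also have "\<dots> \<le> 2 ^ (n + 2)" using rs(3) by simp
  finally have "2 ^ (n + m + 3 - (n + 2)) \<le> card (rcosets ?H)"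
    by (intro index_ge[OF H]) (simp_all add: m)
  then have "8 \<le> card (rcosets ?H)" by (simp add: m)
  with H K.A1_group_generate[OF order e] show ?thesis by blast
qed

lemma A1_index_ge_8_cases:
  assumes m: "m = 2" and w: "\<not> (odd (w11 + w12) \<and> (odd w12 \<or> odd w22))"
  shows "\<exists>H. subgroup H G \<and> A1_group 2 (G\<lparr>carrier := H\<rparr>) \<and> 8 \<le> card (rcosets H)"
proof -
  have heis: "heisenberg_gens G u v (E 0 0 2 e)"
    if "u \<in> carrier G" "v \<in> carrier G" "v \<otimes> u = u \<otimes> (v \<otimes> E 0 0 2 e)" for u v e
  proof unfold_locales
    show "E 0 0 2 e \<otimes> u = u \<otimes> E 0 0 2 e" "E 0 0 2 e \<otimes> v = v \<otimes> E 0 0 2 e"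
      using that P_central P_I[of 1 e] by simp_all
    show "E 0 0 2 e [^] (2::int) = \<one>" by (simp add: E_0_0_pow E_eq_one)
  qed (use that in simp_all)
  have an: "E 1 0 0 0 [^] int (2 ^ n) = E 0 0 (2 * w11) w12"
    using a_pow by (simp add: E_a)
  consider "even w12" "even w22" | "even (w11 + w12)" "odd (w21 + w22)" | "even (w11 + w12)" "even (w21 + w22)"
    using w by blast
  then show ?thesis
  proof cases
    \<comment> \<open>The subgroup generated by \<open>a\<close> and \<open>b [^] 2\<close>, whose
      commutator is the square of \<open>c\<close>.\<close>
    case 1
    have "E 0 2 0 0 [^] int 2 = E 0 (0 + 2 ^ m * 1) 0 0" by (simp add: E_sq m)
    then have "E 0 2 0 0 [^] int 2 = E 0 0 (2 * w21) w22" unfolding b_pow_mult by simp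
    moreover have "E 0 2 0 0 \<otimes> E 1 0 0 0 = E 1 0 0 0 \<otimes> (E 0 2 0 0 \<otimes> E 0 0 2 0)"
      unfolding E_mult by simp (rule E_cong; simp)
    ultimately show ?thesis
      using 1 an c2 by (intro A1_index_ge_8[OF m heis, of "E 1 0 0 0" "E 0 2 0 0" 0 "2 ^ n" 2 w11 w12 w21 w22]) simp_all
  next
    \<comment> \<open>The extra factor \<open>c\<close> next to \<open>b [^] 2\<close> changes the
      commutator with \<open>a\<close> by \<open>y\<close> and raises the exponent
      \<open>w21\<close> of the square by 1, which repairs the parity of the second row.\<close>
    case 2
    have "E 0 2 1 0 [^] int 2 = E 0 (0 + 2 ^ m * 1) 2 0" by (simp add: E_sq m)
    then have "E 0 2 1 0 [^] int 2 = E 0 0 (2 * (w21 + 1)) w22"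
      unfolding b_pow_mult by (simp add: algebra_simps)
    moreover have "E 0 2 1 0 \<otimes> E 1 0 0 0 = E 1 0 0 0 \<otimes> (E 0 2 1 0 \<otimes> E 0 0 2 1)"
      unfolding E_mult by simp (rule E_cong; simp)
    ultimately show ?thesis
      using 2 an c2y by (intro A1_index_ge_8[OF m heis, of "E 1 0 0 0" "E 0 2 1 0" 1 "2 ^ n" 2 w11 w12 "w21 + 1" w22]) simp_all
  next
    \<comment> \<open>The subgroup generated by \<open>a [^] 2\<close> and \<open>b\<close>; the
      exponents \<open>2 ^ (n - 1)\<close> and 4 have product \<open>2 ^ (n + 1)\<close>.\<close>
    case 3
    have "r * 4 \<le> 2 ^ (n + 1)" if "r = 2 ^ (n - 1)" for r :: nat
      using that mn by (cases n) simp_all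
    then show ?thesis
      using 3 E_2_0_pow[of 0 0] E_0_1_pow[of 0 0] c2y heisenberg_2_1[of 0 0 0 0] m
      by (intro A1_index_ge_8[OF m, of "E 2 0 0 0" "E 0 1 0 0" 1 "2 ^ (n - 1)" 4 w11 w12 w21 w22]) simp_all
  qed
qed

end

section \<open>The order of the group presented by \<open>M\<^sub>2(n, m, 1)\<close>\<close>

type_synonym heis = "int \<times> int \<times> int"

text \<open>
  The integer Heisenberg group maps onto \<open>M\<^sub>2(n, m, 1)\<close>; its normal form, read modulo
  \<open>2\<^sup>n\<close>, \<open>2\<^sup>m\<close> and 2, is an invariant of words that tells apart
  \<open>2\<^sup>n\<^sup>+\<^sup>m\<^sup>+\<^sup>1\<close> elements.
\<close>

definition heis_mult :: "heis \<Rightarrow> heis \<Rightarrow> heis" where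
  "heis_mult = (\<lambda>(i, j, k) (i', j', k'). (i + i', j + j', k + k' + j * i'))"

fun heis_letter :: "gen3 \<times> bool \<Rightarrow> heis" where
  "heis_letter (Gen_a, s) = (if s then 1 else -1, 0, 0)"
| "heis_letter (Gen_b, s) = (0, if s then 1 else -1, 0)"
| "heis_letter (Gen_c, s) = (0, 0, if s then 1 else -1)"

definition heis_word :: "gen3 gword \<Rightarrow> heis" where
  "heis_word u = foldr (\<lambda>l. heis_mult (heis_letter l)) u (0, 0, 0)"

definition heis_cong :: "nat \<Rightarrow> nat \<Rightarrow> heis \<Rightarrow> heis \<Rightarrow> bool" where
  "heis_cong n m = (\<lambda>(i, j, k) (i', j', k').
     2 ^ n dvd i - i' \<and> 2 ^ m dvd j - j' \<and> 2 dvd k - k')"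

lemma heis_word_simps [simp]:
  "heis_word [] = (0, 0, 0)"
  "heis_word (l # u) = heis_mult (heis_letter l) (heis_word u)"
  by (simp_all add: heis_word_def)

lemma heis_mult_assoc: "heis_mult (heis_mult x y) z = heis_mult x (heis_mult y z)"
  by (cases x; cases y; cases z) (simp add: heis_mult_def algebra_simps)

lemma heis_word_append: "heis_word (u @ v) = heis_mult (heis_word u) (heis_word v)"
  by (induction u) (simp_all add: heis_mult_assoc, simp add: heis_mult_def split: prod.split)

text \<open>The mixed term \<open>j * i'\<close> is read modulo 2 only. Positivity of
  \<open>n\<close> and \<open>m\<close> ensures that congruence of the first two coordinates
  preserves its parity.\<close>

lemma heis_cong_mult:
  assumes "0 < n" "0 < m" "heis_cong n m x x'" "heis_cong n m y y'"
  shows "heis_cong n m (heis_mult x y) (heis_mult x' y')"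
proof -
  obtain i j k i' j' k' p q r p' q' r' where
    e: "x = (i, j, k)" "x' = (i', j', k')" "y = (p, q, r)" "y' = (p', q', r')"
    by (metis prod_cases3)
  have d: "2 ^ n dvd i - i'" "2 ^ m dvd j - j'" "even (k - k')"
    "2 ^ n dvd p - p'" "2 ^ m dvd q - q'" "even (r - r')"
    using assms(3,4) by (simp_all add: e heis_cong_def)
  have "2 dvd (2::int) ^ n" "2 dvd (2::int) ^ m" using assms(1,2) by simp_all
  then have "even (j - j')" "even (p - p')" using d by (meson dvd_trans)+
  then have "even (k + r + j * p - (k' + r' + j' * p'))"
    using d by auto
  moreover have "2 ^ n dvd i + p - (i' + p')" "2 ^ m dvd j + q - (j' + q')"
    using dvd_add[OF d(1,4)] dvd_add[OF d(2,5)] by (simp_all add: algebra_simps)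
  ultimately show ?thesis by (simp add: e heis_cong_def heis_mult_def)
qed

lemma heis_cong_refl: "heis_cong n m x x"
  by (cases x) (simp add: heis_cong_def)

lemma heis_cong_sym: "heis_cong n m x y \<Longrightarrow> heis_cong n m y x"
  by (cases x; cases y) (auto simp: heis_cong_def dvd_diff_commute)

lemma heis_cong_trans: "heis_cong n m x y \<Longrightarrow> heis_cong n m y z \<Longrightarrow> heis_cong n m x z"
proof -
  have "d dvd p - r" if "d dvd p - q" "d dvd q - r" for d p q r :: int
    using dvd_add[OF that] by simp
  then show "heis_cong n m x y \<Longrightarrow> heis_cong n m y z \<Longrightarrow> heis_cong n m x z"
    by (cases x; cases y; cases z) (auto simp: heis_cong_def)
qed

lemma heis_word_pow:
  "heis_word (pow_word (gen_word Gen_a) r) = (int r, 0, 0)"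
  "heis_word (pow_word (gen_word Gen_b) r) = (0, int r, 0)"
  "heis_word (pow_word (gen_word Gen_c) r) = (0, 0, int r)"
  unfolding pow_word_def gen_word_def
  by (induction r) (simp_all add: heis_mult_def)

lemma heis_cong_of_pres_eq:
  assumes "pres_eq R u v" "0 < n" "0 < m"
    and R: "\<And>u v. (u, v) \<in> R \<Longrightarrow> heis_cong n m (heis_word u) (heis_word v)"
  shows "heis_cong n m (heis_word u) (heis_word v)"
  using assms(1)
proof (induction rule: pres_eq.induct)
  case (append u u' v v')
  then show ?case using assms(2,3) by (simp add: heis_word_append heis_cong_mult)
next
  case (cancel x s)
  then show ?case by (cases x; cases s) (simp_all add: heis_mult_def heis_cong_refl)
qed (auto intro: heis_cong_refl heis_cong_sym heis_cong_trans R)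

lemma card_M2_group_ge:
  assumes "0 < n" "0 < m" and fin: "finite (carrier (M2_group n m))"
  shows "2 ^ (n + m + 1) \<le> card (carrier (M2_group n m))"
proof -
  let ?a = "gen_word Gen_a" and ?b = "gen_word Gen_b" and ?c = "gen_word Gen_c"
  define R where "R = {(pow_word ?a (2 ^ n), []), (pow_word ?b (2 ^ m), []), (pow_word ?c 2, []),
    (comm_word ?a ?b, ?c), (comm_word ?c ?a, []), (comm_word ?c ?b, [])}"
  define W where "W = (\<lambda>(i, j, k). pow_word ?a i @ pow_word ?b j @ pow_word ?c k)"
  have M: "M2_group n m = presented_group R"
    by (simp add: M2_group_def R_def Let_def)
  have W: "heis_word (W (i, j, k)) = (int i, int j, int k)" for i j k
    by (simp add: W_def heis_word_append heis_word_pow heis_mult_def)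
  \<comment> \<open>The commutator word of the first two generators evaluates to
    \<open>(0, 0, -1)\<close>, which agrees with the third generator modulo 2.\<close>
  have rel: "heis_cong n m (heis_word u) (heis_word v)" if "(u, v) \<in> R" for u v
    using that unfolding R_def
    by (auto simp: heis_word_pow) (auto simp: comm_word_def inv_word_def gen_word_def heis_mult_def heis_cong_def)
  let ?A = "{..<(2::nat) ^ n} \<times> {..<(2::nat) ^ m} \<times> {..<2::nat}"
  have "inj_on (\<lambda>t. word_class R (W t)) ?A"
  proof (rule inj_onI)
    fix t t' assume t: "t \<in> ?A" "t' \<in> ?A" and eq: "word_class R (W t) = word_class R (W t')"
    obtain i j k i' j' k' where e: "t = (i, j, k)" "t' = (i', j', k')" by (metis prod_cases3)
    have "pres_eq R (W t) (W t')"
      using eq pres_eq.refl[of R "W t'"] by (auto simp: word_class_def)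
    from heis_cong_of_pres_eq[OF this assms(1,2) rel]
    have d: "2 ^ n dvd int i - int i'" "2 ^ m dvd int j - int j'" "2 dvd int k - int k'"
      by (simp_all add: e W heis_cong_def)
    have "x = x'" if "2 ^ r dvd int x - int x'" "x < 2 ^ r" "x' < 2 ^ r" for x x' r
    proof -
      have "int x mod 2 ^ r = int x' mod 2 ^ r" using that(1) by (simp add: mod_eq_dvd_iff)
      moreover have "int x < 2 ^ r" "int x' < 2 ^ r" using that(2,3) by (metis of_nat_less_iff of_nat_numeral of_nat_power)+
      ultimately show ?thesis by simp
    qed
    from this[of n i i'] this[of m j j'] this[of 1 k k'] show "t = t'"
      using d t by (simp add: e)
  qed
  then have "card ?A = card ((\<lambda>t. word_class R (W t)) ` ?A)" by (simp add: card_image)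
  also have "\<dots> \<le> card (carrier (M2_group n m))"
    by (rule card_mono[OF fin]) (auto simp: M presented_group_def)
  finally show ?thesis by (simp add: card_cartesian_product power_add ac_simps)
qed

section \<open>The derived subgroup\<close>

context group begin

lemma inv_cancel:
  assumes "x \<in> carrier G" "t \<in> carrier G"
  shows "inv x \<otimes> (x \<otimes> t) = t" "x \<otimes> (inv x \<otimes> t) = t"
  using assms by (simp_all add: m_assoc[symmetric])

lemma commutator_closed [simp]:
  "x \<in> carrier G \<Longrightarrow> y \<in> carrier G \<Longrightarrow> commutator G x y \<in> carrier G"
  by (simp add: commutator_def)

lemma commutator_eq_iff:
  assumes "x \<in> carrier G" "y \<in> carrier G" "t \<in> carrier G"
  shows "commutator G x y = t \<longleftrightarrow> x \<otimes> y = y \<otimes> x \<otimes> t"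
proof
  assume "commutator G x y = t"
  then show "x \<otimes> y = y \<otimes> x \<otimes> t"
    using assms by (auto simp: commutator_def m_assoc inv_cancel)
next
  assume "x \<otimes> y = y \<otimes> x \<otimes> t"
  then have "inv x \<otimes> inv y \<otimes> (x \<otimes> y) = inv x \<otimes> inv y \<otimes> (y \<otimes> x \<otimes> t)" by simp
  also have "\<dots> = t" using assms by (simp add: m_assoc inv_cancel)
  finally show "commutator G x y = t" using assms by (simp add: commutator_def m_assoc)
qed

lemma commutator_swap:
  assumes "x \<in> carrier G" "y \<in> carrier G"
  shows "x \<otimes> y = y \<otimes> x \<otimes> commutator G x y"
  using commutator_eq_iff[OF assms, of "commutator G x y"] assms by simp

lemma commutator_inv:
  assumes "x \<in> carrier G" "y \<in> carrier G"
  shows "inv (commutator G x y) = commutator G y x"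
  using assms by (simp add: commutator_def inv_mult_group m_assoc)

lemma commutator_conj:
  assumes "x \<in> carrier G" "y \<in> carrier G" "g \<in> carrier G"
  shows "g \<otimes> commutator G x y \<otimes> inv g = commutator G (g \<otimes> x \<otimes> inv g) (g \<otimes> y \<otimes> inv g)"
  using assms by (simp add: commutator_def inv_mult_group m_assoc inv_cancel)

lemma commutator_mult_right:
  assumes "x \<in> carrier G" "y \<in> carrier G" "y' \<in> carrier G"
  shows "commutator G x (y \<otimes> y') = commutator G x y' \<otimes> (inv y' \<otimes> commutator G x y \<otimes> y')"
  using assms by (simp add: commutator_def inv_mult_group m_assoc inv_cancel)

lemma commutator_inv_right:
  assumes "x \<in> carrier G" "y \<in> carrier G"
  shows "commutator G x (inv y) = y \<otimes> inv (commutator G x y) \<otimes> inv y"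
  using assms by (simp add: commutator_def inv_mult_group m_assoc inv_cancel)

text \<open>A commutator with a product is a product of conjugates of commutators, and
  \<open>K\<close> is normal. Hence commutators with \<open>x\<close> need to be checked on
  generators only.\<close>

lemma subgroup_commutator_mem:
  assumes K: "K \<lhd> G" and x: "x \<in> carrier G"
  shows "subgroup {z \<in> carrier G. commutator G x z \<in> K} G"
proof -
  interpret K: normal K G by (rule K)
  show ?thesis
  proof (rule subgroupI)
    show "{z \<in> carrier G. commutator G x z \<in> K} \<noteq> {}"
    proof -
      have "commutator G x \<one> = \<one>" using x by (simp add: commutator_def)
      then show ?thesis by force
    qed
    show "inv z \<in> {z \<in> carrier G. commutator G x z \<in> K}"
      if z: "z \<in> {z \<in> carrier G. commutator G x z \<in> K}" for z
      using z x K.inv_op_closed2 by (simp add: commutator_inv_right)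
    show "z \<otimes> z' \<in> {z \<in> carrier G. commutator G x z \<in> K}"
      if zz: "z \<in> {z \<in> carrier G. commutator G x z \<in> K}" "z' \<in> {z \<in> carrier G. commutator G x z \<in> K}" for z z'
      using zz x K.inv_op_closed1 by (simp add: commutator_mult_right)
  qed auto
qed

lemma subgroup_centralizer:
  assumes "D \<subseteq> carrier G"
  shows "subgroup (centralizer G D) G"
proof (rule subgroupI)
  show "inv x \<in> centralizer G D" if x: "x \<in> centralizer G D" for x
  proof -
    have "inv x \<otimes> h = h \<otimes> inv x" if "h \<in> D" for h
    proof -
      have h: "h \<in> carrier G" "x \<in> carrier G" "x \<otimes> h = h \<otimes> x"
        using x that assms by (auto simp: centralizer_def)
      have "inv x \<otimes> (x \<otimes> h) \<otimes> inv x = inv x \<otimes> (h \<otimes> x) \<otimes> inv x" by (simp only: h(3))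
      then show ?thesis using h(1,2) by (simp add: m_assoc inv_cancel)
    qed
    then show ?thesis using x by (simp add: centralizer_def)
  qed
  show "x \<otimes> x' \<in> centralizer G D" if xx: "x \<in> centralizer G D" "x' \<in> centralizer G D" for x x'
  proof -
    have "x \<otimes> x' \<otimes> h = h \<otimes> (x \<otimes> x')" if "h \<in> D" for h
    proof -
      have h: "h \<in> carrier G" "x \<in> carrier G" "x' \<in> carrier G" "x \<otimes> h = h \<otimes> x" "x' \<otimes> h = h \<otimes> x'"
        using xx that assms by (auto simp: centralizer_def)
      have "x \<otimes> x' \<otimes> h = x \<otimes> (h \<otimes> x')" using h by (simp add: m_assoc)
      also have "\<dots> = (h \<otimes> x) \<otimes> x'" unfolding h(4)[symmetric] using h(1-3) by (simp add: m_assoc)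
      finally show ?thesis using h(1-3) by (simp add: m_assoc)
    qed
    then show ?thesis using xx by (simp add: centralizer_def)
  qed
  show "centralizer G D \<noteq> {}" using assms by (force simp: centralizer_def)
qed (auto simp: centralizer_def)

abbreviation "D \<equiv> derived_subgroup G"

lemma D_normal: "D \<lhd> G"
  by (rule derived_is_normal) (simp add: normal_inv_iff subgroup_self)

lemma D_subgroup: "subgroup D G"
  by (simp add: derived_is_subgroup)

lemma D_carrier: "x \<in> D \<Longrightarrow> x \<in> carrier G"
  using subgroup.mem_carrier[OF D_subgroup] .

lemma commutator_mem_D:
  assumes "x \<in> carrier G" "y \<in> carrier G"
  shows "commutator G x y \<in> D"
proof -
  have "commutator G x y = inv x \<otimes> inv y \<otimes> inv (inv x) \<otimes> inv (inv y)"
    using assms by (simp add: commutator_def)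
  then show ?thesis
    unfolding derived_def using assms by (intro generate.incl) blast
qed

lemma D_subset_of_commutators:
  assumes K: "subgroup K G" and "\<And>x y. x \<in> carrier G \<Longrightarrow> y \<in> carrier G \<Longrightarrow> commutator G x y \<in> K"
  shows "D \<subseteq> K"
  unfolding derived_def
proof (rule generate_subgroup_incl[OF _ K], clarify)
  fix x y assume xy: "x \<in> carrier G" "y \<in> carrier G"
  \<comment> \<open>This translates between the two commutator conventions.\<close>
  have "commutator G (inv x) (inv y) = x \<otimes> y \<otimes> inv x \<otimes> inv y"
    using xy by (simp add: commutator_def)
  then show "x \<otimes> y \<otimes> inv x \<otimes> inv y \<in> K"
    using assms(2)[of "inv x" "inv y"] xy by simp
qed

lemma G3_normal: "G3 G \<lhd> G"
  unfolding G3_def commutator_subgroup_def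
proof (rule normal_generateI)
  show "{commutator G h k |h k. h \<in> D \<and> k \<in> carrier G} \<subseteq> carrier G"
    using D_carrier by auto
  fix t g assume "t \<in> {commutator G h k |h k. h \<in> D \<and> k \<in> carrier G}" and g: "g \<in> carrier G"
  then obtain h k where t: "t = commutator G h k" "h \<in> D" "k \<in> carrier G" by blast
  have "g \<otimes> h \<otimes> inv g \<in> D" using normal.inv_op_closed2[OF D_normal g t(2)] .
  moreover have "g \<otimes> t \<otimes> inv g = commutator G (g \<otimes> h \<otimes> inv g) (g \<otimes> k \<otimes> inv g)"
    unfolding t(1) using D_carrier[OF t(2)] t(3) g by (rule commutator_conj)
  ultimately show "g \<otimes> t \<otimes> inv g \<in> {commutator G h k |h k. h \<in> D \<and> k \<in> carrier G}"
    using g t(3) by blast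
qed

lemma commutator_mem_G3:
  assumes "h \<in> D" "k \<in> carrier G"
  shows "commutator G h k \<in> G3 G"
  unfolding G3_def commutator_subgroup_def using assms by (intro generate.incl) blast

lemma G3_subset_D: "G3 G \<subseteq> D"
  unfolding G3_def commutator_subgroup_def
  by (rule generate_subgroup_incl[OF _ D_subgroup]) (auto intro!: commutator_mem_D D_carrier)

text \<open>A conjugate of \<open>h\<close> differs from \<open>h\<close> by a commutator of an
  element of \<open>D\<close>, which lies in \<open>G3 G\<close> and so in \<open>K\<close>.\<close>

lemma normal_of_G3_subset:
  assumes K: "subgroup K G" and G3K: "G3 G \<subseteq> K" and KD: "K \<subseteq> D"
  shows "K \<lhd> G"
  unfolding normal_inv_iff
proof (intro conjI ballI K)
  fix x h assume x: "x \<in> carrier G" and h: "h \<in> K"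
  have hc: "h \<in> carrier G" using K h by (rule subgroup.mem_carrier)
  have "commutator G h (inv x) \<in> K"
    using commutator_mem_G3[of h "inv x"] h KD G3K x by auto
  then have "h \<otimes> commutator G h (inv x) \<in> K" using K h by (simp add: subgroup.m_closed)
  also have "h \<otimes> commutator G h (inv x) = x \<otimes> h \<otimes> inv x"
    using x hc by (simp add: commutator_def m_assoc inv_cancel)
  finally show "x \<otimes> h \<otimes> inv x \<in> K" .
qed

end

lemma exists_maximal_subgroup:
  assumes G: "group G" and fin: "finite (carrier G)" and H: "subgroup H G" "H \<noteq> carrier G"
  obtains M where "maximal_subgroup M G" "H \<subseteq> M"
proof -
  let ?S = "{K. subgroup K G \<and> K \<noteq> carrier G \<and> H \<subseteq> K}"
  have "?S \<subseteq> Pow (carrier G)" using subgroup.subset by blast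
  then have "finite ?S" using fin by (simp add: finite_subset)
  moreover have "?S \<noteq> {}" using H by auto
  ultimately have "\<exists>M\<in>?S. \<forall>K\<in>?S. M \<subseteq> K \<longrightarrow> M = K"
    by (rule finite_has_maximal)
  then obtain M where M: "M \<in> ?S" "\<forall>K\<in>?S. M \<subseteq> K \<longrightarrow> M = K" by (rule bexE)
  have "maximal_subgroup M G"
    unfolding maximal_subgroup_def
  proof (intro conjI allI impI)
    fix K assume K: "subgroup K G \<and> M \<subseteq> K"
    then have "K \<in> ?S" if "K \<noteq> carrier G" using M(1) that by auto
    then show "K = M \<or> K = carrier G" using bspec[OF M(2), of K] K by metis
  qed (use M(1) in auto)
  with M(1) that show ?thesis by blast
qed

section \<open>The subgroups D, G3 and PhiG3 when G3 has order 2\<close>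

locale G3_order_2 = group G for G (structure) +
  fixes N :: nat and y
  assumes order: "order G = 2 ^ N" and G3_eq: "G3 G = {\<one>, y}" and y1: "y \<noteq> \<one>"
begin

lemma finite_carrier: "finite (carrier G)"
  using order by (simp flip: order_gt_0_iff_finite)

lemma torsion: "x \<in> carrier G \<Longrightarrow> x [^] ((2::int) ^ N) = \<one>"
  using pow_order_eq_1[of x] int_pow_int[of G x "2 ^ N"] by (simp add: order)

lemma y_G3: "y \<in> G3 G" using G3_eq by simp

lemma y_D: "y \<in> D" using y_G3 G3_subset_D by blast

lemma y [simp]: "y \<in> carrier G" using y_D by (rule D_carrier)

lemma y_central: assumes g: "g \<in> carrier G" shows "y \<otimes> g = g \<otimes> y"
proof -
  have "g \<otimes> y \<otimes> inv g \<in> {\<one>, y}"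
    using normal.inv_op_closed2[OF G3_normal g y_G3] G3_eq by simp
  moreover have "g \<otimes> y \<otimes> inv g \<noteq> \<one>"
  proof
    assume "g \<otimes> y \<otimes> inv g = \<one>"
    then have "g \<otimes> y = g" using g inv_solve_right[of \<one> "g \<otimes> y" g] by simp
    then show False using y1 g by simp
  qed
  ultimately have "g \<otimes> y \<otimes> inv g = y" by blast
  then show ?thesis using g inv_solve_right[of y "g \<otimes> y" g] by simp
qed

lemma y_sq: "y \<otimes> y = \<one>"
proof -
  have "y \<otimes> y \<in> {\<one>, y}"
    using subgroup.m_closed[OF normal_imp_subgroup[OF G3_normal] y_G3 y_G3] G3_eq by simp
  then show ?thesis using y1 by auto
qed

lemma D_commutator:
  assumes "h \<in> D" "g \<in> carrier G"
  shows "h \<otimes> g = g \<otimes> h \<or> h \<otimes> g = g \<otimes> h \<otimes> y"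
proof -
  have h: "h \<in> carrier G" using assms by (simp add: D_carrier)
  have "commutator G h g = \<one> \<or> commutator G h g = y"
    using commutator_mem_G3[OF assms] G3_eq by blast
  then show ?thesis using commutator_swap[OF h assms(2)] h assms(2) by auto
qed

text \<open>Otherwise \<open>D\<close> would be \<open>{\<one>, y}\<close>, which is central, and
  \<open>G3 G\<close> would be trivial.\<close>

lemma D_ne_G3: "D \<noteq> G3 G"
proof
  assume eq: "D = G3 G"
  have "G3 G \<subseteq> {\<one>}"
    unfolding G3_def commutator_subgroup_def
  proof (rule generate_subgroup_incl[OF _ triv_subgroup], rule subsetI)
    fix t assume "t \<in> {commutator G h k |h k. h \<in> D \<and> k \<in> carrier G}"
    then obtain h k where hk: "t = commutator G h k" "h \<in> D" "k \<in> carrier G" by blast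
    then have "h = \<one> \<or> h = y" using eq G3_eq by simp
    then have "h \<otimes> k = k \<otimes> h \<otimes> \<one>" using y_central hk by auto
    then show "t \<in> {\<one>}"
      using commutator_eq_iff[of h k \<one>] hk D_carrier by simp
  qed
  then show False using G3_eq y1 by simp
qed

lemma group_D: "group (G\<lparr>carrier := D\<rparr>)"
  by (rule subgroup_imp_group[OF D_subgroup])

lemma maximal_D:
  assumes "maximal_subgroup M (G\<lparr>carrier := D\<rparr>)"
  shows "subgroup M G" "M \<subseteq> D" "M \<noteq> D"
proof -
  have M: "subgroup M (G\<lparr>carrier := D\<rparr>)" "M \<noteq> D"
    using assms by (simp_all add: maximal_subgroup_def)
  show "subgroup M G" using incl_subgroup[OF D_subgroup M(1)] .
  show "M \<subseteq> D" using subgroup.subset[OF M(1)] by simp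
  show "M \<noteq> D" by (rule M(2))
qed

lemma frattini_subgroup: "subgroup (frattini (G\<lparr>carrier := D\<rparr>)) G"
proof -
  have "frattini (G\<lparr>carrier := D\<rparr>) = \<Inter>(insert D {M. maximal_subgroup M (G\<lparr>carrier := D\<rparr>)})"
    by (simp add: frattini_def)
  moreover have "subgroup (\<Inter>(insert D {M. maximal_subgroup M (G\<lparr>carrier := D\<rparr>)})) G"
    by (rule subgroups_Inter) (use D_subgroup maximal_D in auto)
  ultimately show ?thesis by simp
qed

abbreviation "\<Phi> \<equiv> PhiG3 G"

lemma Phi_subgroup: "subgroup \<Phi> G"
  unfolding PhiG3_def commut_normal[OF frattini_subgroup G3_normal]
  by (rule mult_norm_subgroup[OF G3_normal frattini_subgroup])

lemma frattini_subset_Phi: "frattini (G\<lparr>carrier := D\<rparr>) \<subseteq> \<Phi>"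
proof
  fix x assume x: "x \<in> frattini (G\<lparr>carrier := D\<rparr>)"
  then have "x \<otimes> \<one> = x" using subgroup.mem_carrier[OF frattini_subgroup] by simp
  then show "x \<in> \<Phi>" unfolding PhiG3_def set_mult_def using x G3_eq by force
qed

lemma G3_subset_Phi: "G3 G \<subseteq> \<Phi>"
proof
  fix x assume x: "x \<in> G3 G"
  then have e: "\<one> \<otimes> x = x" using G3_subset_D D_carrier by auto
  have "\<one> \<otimes> x \<in> \<Phi>"
    unfolding PhiG3_def set_mult_def using x subgroup.one_closed[OF frattini_subgroup] by blast
  then show "x \<in> \<Phi>" unfolding e .
qed

lemma Phi_subset:
  assumes "subgroup K G" "frattini (G\<lparr>carrier := D\<rparr>) \<subseteq> K" "G3 G \<subseteq> K"
  shows "\<Phi> \<subseteq> K"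
  unfolding PhiG3_def set_mult_def using assms by (auto intro: subgroup.m_closed)

lemma frattini_subset_D: "frattini (G\<lparr>carrier := D\<rparr>) \<subseteq> D"
  by (simp add: frattini_def)

lemma Phi_subset_D: "\<Phi> \<subseteq> D"
  using Phi_subset[OF D_subgroup frattini_subset_D G3_subset_D] .

text \<open>\<open>G3 G\<close> is proper in \<open>D\<close>, so some maximal subgroup of
  \<open>D\<close> contains it; that subgroup contains the Frattini subgroup as well.\<close>

lemma Phi_ne_D: "\<Phi> \<noteq> D"
proof -
  have "subgroup (G3 G) (G\<lparr>carrier := D\<rparr>)"
    using subgroup_incl[OF normal_imp_subgroup[OF G3_normal] D_subgroup G3_subset_D] .
  moreover have "finite (carrier (G\<lparr>carrier := D\<rparr>))"
    using finite_subset[OF subgroup.subset[OF D_subgroup] finite_carrier] by simp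
  ultimately obtain M where M: "maximal_subgroup M (G\<lparr>carrier := D\<rparr>)" "G3 G \<subseteq> M"
    using exists_maximal_subgroup[OF group_D, of "G3 G"] D_ne_G3 by auto
  have "frattini (G\<lparr>carrier := D\<rparr>) \<subseteq> M" using M(1) by (auto simp: frattini_def)
  then have "\<Phi> \<subseteq> M" using Phi_subset maximal_D[OF M(1)] M(2) by blast
  then show ?thesis using maximal_D[OF M(1)] by blast
qed

lemma Phi_normal: "\<Phi> \<lhd> G"
  using normal_of_G3_subset[OF Phi_subgroup G3_subset_Phi Phi_subset_D] .

end

section \<open>Relations and normal form from characteristic generators\<close>

text \<open>The type of the centralizer quotient enters through its exponent, in
  \<open>centralizer_pow\<close>. The two premises there are established inside the locale before
  that assumption is applied.\<close>

locale char_setup = G3_order_2 +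
  fixes a b and n m :: nat
  assumes card_Phi: "card (PhiG3 G) = 4" and Phi_sq: "x \<in> PhiG3 G \<Longrightarrow> x \<otimes> x = \<one>"
    and a [simp]: "a \<in> carrier G" and b [simp]: "b \<in> carrier G"
    and gens: "generate (G Mod PhiG3 G) {PhiG3 G #> a, PhiG3 G #> b} = carrier (G Mod PhiG3 G)"
    and b_pow: "b [^] ((2::int) ^ m) \<in> PhiG3 G"
    and a_pow: "a [^] ((2::int) ^ (n - 1)) \<notin> PhiG3 G"
    and mn: "m < n"
    and centralizer_pow: "2 \<le> m \<Longrightarrow> PhiG3 G \<subseteq> centralizer G (derived_subgroup G) \<Longrightarrow>
      x \<in> centralizer G (derived_subgroup G) \<Longrightarrow> x [^] ((2::int) ^ (n - 1)) \<in> PhiG3 G"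
begin

definition c where "c = commutator G a b"

lemma c_D: "c \<in> D" unfolding c_def by (simp add: commutator_mem_D)

lemma c [simp]: "c \<in> carrier G" using c_D by (rule D_carrier)

lemma carrier_of_gens:
  assumes K: "subgroup K G" and "a \<in> K" "b \<in> K" "\<Phi> \<subseteq> K" and g: "g \<in> carrier G"
  shows "g \<in> K"
proof -
  interpret Phi: normal \<Phi> G by (rule Phi_normal)
  interpret h: group_hom G "G Mod \<Phi>" "\<lambda>x. \<Phi> #> x"
    by (intro group_hom.intro group_hom_axioms.intro group_axioms Phi.factorgroup_is_group Phi.r_coset_hom_Mod)
  have "\<Phi> #> g \<in> carrier (G Mod \<Phi>)" using g by (simp add: carrier_FactGroup)
  also have "\<dots> = (\<lambda>x. \<Phi> #> x) ` generate G {a, b}"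
    using h.generate_img[of "{a, b}"] gens by simp
  finally obtain h where h: "h \<in> generate G {a, b}" "\<Phi> #> g = \<Phi> #> h" by blast
  have hK: "h \<in> K" using generate_subgroup_incl[of "{a, b}" K] K assms h by blast
  have "g \<in> \<Phi> #> h" using rcos_self[OF g Phi_subgroup] h by simp
  then obtain p where "p \<in> \<Phi>" "g = p \<otimes> h" by (auto simp: r_coset_def)
  then show ?thesis using K hK assms(4) by (auto intro: subgroup.m_closed)
qed

definition K0 where "K0 = {c [^] (i::int) \<otimes> y [^] (j::int) |i j. True}"

lemma y_pow_comm: "x \<in> carrier G \<Longrightarrow> y [^] (j::int) \<otimes> x = x \<otimes> y [^] j"
  using commute_int_pow[of x y j 1] y_central by simp

lemma K0_subgroup: "subgroup K0 G"
proof (rule subgroupI)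
  show "K0 \<noteq> {}" by (auto simp: K0_def)
  show "inv x \<in> K0" if x: "x \<in> K0" for x
  proof -
    obtain i j where "x = c [^] (i::int) \<otimes> y [^] (j::int)" using x by (auto simp: K0_def)
    then have "inv x = c [^] (- i) \<otimes> y [^] (- j)"
      using y_pow_comm[of "c [^] (- i)" "- j"] by (simp add: inv_mult_group int_pow_neg)
    then show ?thesis unfolding K0_def by blast
  qed
  show "x \<otimes> x' \<in> K0" if x: "x \<in> K0" "x' \<in> K0" for x x'
  proof -
    obtain i j where e: "x = c [^] (i::int) \<otimes> y [^] (j::int)" using x by (auto simp: K0_def)
    obtain i' j' where e': "x' = c [^] (i'::int) \<otimes> y [^] (j'::int)" using x by (auto simp: K0_def)
    have "x \<otimes> x' = c [^] i \<otimes> (y [^] j \<otimes> c [^] i') \<otimes> y [^] j'"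
      unfolding e e' by (simp add: m_assoc)
    also have "\<dots> = c [^] (i + i') \<otimes> y [^] (j + j')"
      using y_pow_comm[of "c [^] i'" j] by (simp add: m_assoc int_pow_mult)
    finally show ?thesis unfolding K0_def by blast
  qed
qed (auto simp: K0_def)

lemma c_K0: "c \<in> K0"
proof -
  have "c = c [^] (1::int) \<otimes> y [^] (0::int)" by simp
  then show ?thesis unfolding K0_def by blast
qed

lemma y_K0: "y \<in> K0"
proof -
  have "y = c [^] (0::int) \<otimes> y [^] (1::int)" by simp
  then show ?thesis unfolding K0_def by blast
qed

lemma G3_subset_K0: "G3 G \<subseteq> K0"
  using y_K0 subgroup.one_closed[OF K0_subgroup] G3_eq by simp

lemma K0_subset_D: "K0 \<subseteq> D"
  unfolding K0_def using c_D y_D D_subgroup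
  by (auto intro!: subgroup.m_closed subgroup_int_pow_closed)

text \<open>\<open>K0\<close> contains \<open>G3 G\<close>, hence is normal and contains all
  commutators with elements of \<open>\<Phi>\<close>. Modulo \<open>K0\<close> the elements
  \<open>a\<close> and \<open>b\<close> therefore commute with a generating set of the group, so the
  quotient is abelian.\<close>

lemma K0_eq_D: "K0 = D"
proof
  have K0n: "K0 \<lhd> G"
    using normal_of_G3_subset[OF K0_subgroup G3_subset_K0 K0_subset_D] .
  have sym: "commutator G x z \<in> K0" if "commutator G z x \<in> K0" "x \<in> carrier G" "z \<in> carrier G" for x z
    using subgroup.m_inv_closed[OF K0_subgroup that(1)] commutator_inv[OF that(3,2)] by simp
  have Phi: "commutator G x p \<in> K0" if "x \<in> carrier G" "p \<in> \<Phi>" for x p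
  proof -
    have "p \<in> D" using that Phi_subset_D by blast
    then show ?thesis
      using sym[OF _ that(1) D_carrier] commutator_mem_G3[OF _ that(1)] G3_subset_K0 by blast
  qed
  have all: "commutator G x z \<in> K0"
    if x: "x \<in> carrier G" "commutator G x a \<in> K0" "commutator G x b \<in> K0" and z: "z \<in> carrier G" for x z
  proof -
    have "z \<in> {z \<in> carrier G. commutator G x z \<in> K0}"
      by (rule carrier_of_gens[OF subgroup_commutator_mem[OF K0n x(1)]])
        (use x z Phi subgroup.mem_carrier[OF Phi_subgroup] in auto)
    then show ?thesis by simp
  qed
  have self: "commutator G x x \<in> K0" if "x \<in> carrier G" for x
    using that subgroup.one_closed[OF K0_subgroup] by (simp add: commutator_def m_assoc inv_cancel)
  have ab: "commutator G a b \<in> K0" using c_K0 by (simp add: c_def)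
  have 1: "commutator G a z \<in> K0" "commutator G b z \<in> K0" if "z \<in> carrier G" for z
    using all[of a z] all[of b z] self ab sym[OF ab] that by simp_all
  have "commutator G x z \<in> K0" if "x \<in> carrier G" "z \<in> carrier G" for x z
    using all[OF that(1) _ _ that(2)] sym[OF 1(1)] sym[OF 1(2)] that by simp
  then show "D \<subseteq> K0" by (rule D_subset_of_commutators[OF K0_subgroup])
qed (rule K0_subset_D)

lemma D_cases:
  assumes "x \<in> D"
  obtains i j where "x = c [^] (i::int) \<otimes> y [^] (j::int)"
  using assms unfolding K0_eq_D[symmetric] K0_def by blast

text \<open>Suppose a maximal subgroup \<open>M\<close> of \<open>D\<close> misses the square of
  \<open>c\<close>. Since \<open>D\<close> is abelian, adjoining that square gives all of
  \<open>D\<close>, so \<open>c\<close> is an element of \<open>M\<close> times an even power of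
  \<open>c\<close>. Then an odd power of \<open>c\<close>, and with it \<open>c\<close>, lies in
  \<open>M\<close>.\<close>

lemma c_sq_Phi: "c [^] (2::int) \<in> \<Phi>"
proof -
  have "c [^] (2::int) \<in> M" if M: "maximal_subgroup M (G\<lparr>carrier := D\<rparr>)" for M
  proof (rule ccontr)
    assume n: "c [^] (2::int) \<notin> M"
    note MG = maximal_D[OF M]
    define K where "K = {\<mu> \<otimes> c [^] (2 * t) |\<mu> t::int. \<mu> \<in> M}"
    have comm: "c [^] t \<otimes> \<mu> = \<mu> \<otimes> c [^] t" if "\<mu> \<in> M" for \<mu> and t :: int
    proof -
      have "\<mu> \<in> D" using that MG by blast
      then obtain i j where "\<mu> = c [^] (i::int) \<otimes> y [^] (j::int)" by (rule D_cases)
      then show ?thesis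
        using y_pow_comm[of "c [^] t" j] by (simp add: m_assoc) (simp add: m_assoc[symmetric] int_pow_mult[symmetric] add.commute)
    qed
    have car: "\<mu> \<in> carrier G" if "\<mu> \<in> M" for \<mu>
      using subgroup.mem_carrier[OF MG(1) that] .
    have K: "subgroup K G"
    proof (rule subgroupI)
      show "K \<subseteq> carrier G" using car by (auto simp: K_def)
      show "K \<noteq> {}" using subgroup.one_closed[OF MG(1)] by (auto simp: K_def)
      show "inv x \<in> K" if x: "x \<in> K" for x
      proof -
        obtain \<mu> t where e: "\<mu> \<in> M" "x = \<mu> \<otimes> c [^] (2 * t::int)" using x by (auto simp: K_def)
        have i: "inv \<mu> \<in> M" using subgroup.m_inv_closed[OF MG(1) e(1)] .
        have "inv x = inv \<mu> \<otimes> c [^] (2 * (- t))"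
          using comm[OF i, of "2 * (- t)"] car[OF e(1)] by (simp add: e(2) inv_mult_group int_pow_neg)
        then show ?thesis unfolding K_def using i by blast
      qed
      show "x \<otimes> x' \<in> K" if x: "x \<in> K" "x' \<in> K" for x x'
      proof -
        obtain \<mu> t where e: "\<mu> \<in> M" "x = \<mu> \<otimes> c [^] (2 * t::int)" using x by (auto simp: K_def)
        obtain \<mu>' t' where e': "\<mu>' \<in> M" "x' = \<mu>' \<otimes> c [^] (2 * t'::int)" using x by (auto simp: K_def)
        have "x \<otimes> x' = \<mu> \<otimes> (c [^] (2 * t) \<otimes> \<mu>') \<otimes> c [^] (2 * t')"
          using car e e' by (simp add: m_assoc)
        also have "\<dots> = (\<mu> \<otimes> \<mu>') \<otimes> c [^] (2 * (t + t'))"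
          unfolding comm[OF e'(1)] using car e(1) e'(1) by (simp add: m_assoc int_pow_mult distrib_left)
        finally show ?thesis unfolding K_def using subgroup.m_closed[OF MG(1) e(1) e'(1)] by blast
      qed
    qed
    have MK: "M \<subseteq> K"
    proof
      fix \<mu> assume "\<mu> \<in> M"
      moreover have "\<mu> = \<mu> \<otimes> c [^] (2 * (0::int))" using car[OF \<open>\<mu> \<in> M\<close>] by simp
      ultimately show "\<mu> \<in> K" unfolding K_def by blast
    qed
    have KD: "K \<subseteq> D"
      unfolding K_def using MG(2) c_D D_subgroup
      by (auto intro!: subgroup.m_closed subgroup_int_pow_closed)
    have c2K: "c [^] (2::int) \<in> K"
    proof -
      have "c [^] (2::int) = \<one> \<otimes> c [^] (2 * (1::int))" by simp
      then show ?thesis unfolding K_def using subgroup.one_closed[OF MG(1)] by blast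
    qed
    have "subgroup K (G\<lparr>carrier := D\<rparr>)" by (rule subgroup_incl[OF K D_subgroup KD])
    then have "K = M \<or> K = D" using M MK by (simp add: maximal_subgroup_def)
    then have "c \<in> K" using c2K n c_D by auto
    then obtain \<mu> t where e: "\<mu> \<in> M" "c = \<mu> \<otimes> c [^] (2 * t::int)" by (auto simp: K_def)
    have "c [^] (1 - 2 * t) = c \<otimes> inv (c [^] (2 * t))" by (simp add: int_pow_diff)
    also have "\<dots> = \<mu>"
      using e(2) car[OF e(1)] inv_solve_right[of \<mu> c "c [^] (2 * t)"] by simp
    finally have "c [^] (1 - 2 * t) \<in> M" using e(1) by simp
    then have "c \<in> M"
      using odd_int_pow_mem[OF MG(1) c torsion[OF c], of "1 - 2 * t"] by simp
    then show False using n subgroup_int_pow_closed[OF MG(1), of c 2] by simp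
  qed
  moreover have "c [^] (2::int) \<in> D" using c_D by (rule subgroup_int_pow_closed[OF D_subgroup])
  ultimately have "c [^] (2::int) \<in> frattini (G\<lparr>carrier := D\<rparr>)" by (simp add: frattini_def)
  then show ?thesis using frattini_subset_Phi by blast
qed

lemma y_Phi: "y \<in> \<Phi>" using y_G3 G3_subset_Phi by blast

text \<open>An odd exponent of \<open>c\<close> would put \<open>c\<close> into
  \<open>\<Phi>\<close>, and then \<open>\<Phi>\<close> would be all of \<open>D\<close>.\<close>

lemma Phi_cases:
  assumes x: "x \<in> \<Phi>"
  obtains k l where "x = c [^] (2 * k::int) \<otimes> y [^] (l::int)"
proof -
  have "x \<in> D" using x Phi_subset_D by blast
  then obtain i j where e: "x = c [^] (i::int) \<otimes> y [^] (j::int)" by (rule D_cases)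
  have "even i"
  proof (rule ccontr)
    assume i: "odd i"
    have "c [^] i = x \<otimes> y [^] (- j)"
      by (simp add: e int_pow_neg m_assoc)
    then have "c [^] i \<in> \<Phi>"
      using x y_Phi Phi_subgroup by (simp add: subgroup.m_closed subgroup_int_pow_closed)
    then have "c \<in> \<Phi>" using odd_int_pow_mem[OF Phi_subgroup c torsion[OF c] i] by simp
    then have "K0 \<subseteq> \<Phi>"
      unfolding K0_def using y_Phi Phi_subgroup
      by (auto intro!: subgroup.m_closed subgroup_int_pow_closed)
    then show False using Phi_ne_D Phi_subset_D K0_eq_D by blast
  qed
  then show ?thesis using e that by (metis evenE)
qed

lemma c4: "c [^] (4::int) = \<one>"
  using Phi_sq[OF c_sq_Phi] int_pow_mult[of c 2 2] by simp

lemma y2: "y [^] (2::int) = \<one>"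
  using y_sq int_pow_mult[of y 1 1] by simp

text \<open>The square of \<open>c\<close> and \<open>y\<close> generate \<open>\<Phi>\<close>,
  which has four elements, while \<open>G3 G\<close> has two.\<close>

lemma c_sq_not_G3: "c [^] (2::int) \<notin> G3 G"
proof
  assume c2: "c [^] (2::int) \<in> G3 G"
  have G3: "subgroup (G3 G) G" using normal_imp_subgroup[OF G3_normal] .
  have "\<Phi> \<subseteq> G3 G"
  proof
    fix x assume "x \<in> \<Phi>"
    then obtain k l where "x = c [^] (2 * k::int) \<otimes> y [^] (l::int)" by (rule Phi_cases)
    then have "x = (c [^] (2::int)) [^] k \<otimes> y [^] l" by (simp add: int_pow_pow)
    then show "x \<in> G3 G"
      using c2 y_G3 G3 by (simp add: subgroup.m_closed subgroup_int_pow_closed)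
  qed
  then have "card \<Phi> \<le> card (G3 G)" by (rule card_mono[rotated]) (simp add: G3_eq)
  also have "\<dots> \<le> 2" by (simp add: G3_eq card_insert_if)
  finally show False using card_Phi by simp
qed

lemma c_swap:
  assumes g: "g \<in> carrier G"
  obtains e :: int where "c \<otimes> g = g \<otimes> (c \<otimes> y [^] e)" "e = 0 \<or> e = 1"
proof -
  consider "c \<otimes> g = g \<otimes> c" | "c \<otimes> g = g \<otimes> c \<otimes> y" using D_commutator[OF c_D g] by blast
  then show ?thesis
    using that[of 0] that[of 1] g by cases (simp_all add: m_assoc)
qed

lemma c2_central:
  assumes g: "g \<in> carrier G"
  shows "c [^] (2::int) \<otimes> g = g \<otimes> c [^] (2::int)"
proof -
  obtain e :: int where e: "c \<otimes> g = g \<otimes> (c \<otimes> y [^] e)" using c_swap[OF g] by blast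
  have "(c \<otimes> y [^] e) [^] (2::int) = c [^] (2::int) \<otimes> (y [^] e) [^] (2::int)"
    using y_pow_comm[of c e] by (intro int_pow_mult_distrib) simp_all
  also have "(y [^] e) [^] (2::int) = (y [^] (2::int)) [^] e"
    by (simp add: int_pow_pow mult.commute)
  finally show ?thesis
    using conj_int_pow[OF g c _ e, of 2] y2 by simp
qed

lemma Phi_central:
  assumes x: "x \<in> \<Phi>" and g: "g \<in> carrier G"
  shows "x \<otimes> g = g \<otimes> x"
proof -
  obtain k l where e: "x = c [^] (2 * k::int) \<otimes> y [^] (l::int)" using x by (rule Phi_cases)
  have "c [^] (2 * k::int) \<otimes> g = g \<otimes> c [^] (2 * k)"
    using commute_int_pow[of g "c [^] (2::int)" k 1] c2_central[OF g] g by (simp add: int_pow_pow)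
  then show ?thesis
    unfolding e using y_pow_comm[OF g, of l] g by (metis c y int_pow_closed m_assoc)
qed

lemma ab: "a \<otimes> b = b \<otimes> a \<otimes> c"
  unfolding c_def by (rule commutator_swap) simp_all

text \<open>The \<open>2 ^ m\<close>-th power of \<open>b\<close> lies in \<open>\<Phi>\<close> and
  so commutes with \<open>a\<close>. For \<open>m = 0\<close> this makes \<open>c\<close> trivial;
  for \<open>m = 1\<close> it puts the square of \<open>c\<close> into \<open>G3 G\<close>.\<close>

lemma m2: "2 \<le> m"
proof (rule ccontr)
  assume "\<not> 2 \<le> m"
  then consider "m = 0" | "m = 1" by linarith
  then show False
  proof cases
    case 1
    then have "a \<otimes> b = b \<otimes> a" using Phi_central[of b a] b_pow by simp
    then have "b \<otimes> a \<otimes> c = b \<otimes> a" using ab by simp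
    then have "c = \<one>" by simp
    then show False using c_sq_not_G3 G3_eq by simp
  next
    case 2
    obtain e :: int where e: "c \<otimes> b = b \<otimes> (c \<otimes> y [^] e)" "e = 0 \<or> e = 1" using c_swap[OF b] by blast
    have bb: "b \<otimes> b \<in> \<Phi>" using b_pow 2 int_pow_mult[of b 1 1] by simp
    have "a \<otimes> (b \<otimes> b) = b \<otimes> a \<otimes> (c \<otimes> b)" by (simp add: m_assoc[symmetric] ab)
    also have "\<dots> = b \<otimes> (a \<otimes> b) \<otimes> (c \<otimes> y [^] e)" unfolding e(1) by (simp add: m_assoc)
    also have "\<dots> = (b \<otimes> b) \<otimes> a \<otimes> (c \<otimes> (c \<otimes> y [^] e))" unfolding ab by (simp add: m_assoc)
    finally have "a \<otimes> (b \<otimes> b) = a \<otimes> (b \<otimes> b) \<otimes> (c \<otimes> (c \<otimes> y [^] e))"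
      using Phi_central[OF bb, of a] by simp
    then have "c \<otimes> (c \<otimes> y [^] e) = \<one>" by simp
    then have "c [^] (2::int) \<otimes> y [^] e = \<one>"
      using int_pow_mult[of c 1 1] by (simp add: m_assoc)
    then have "c [^] (2::int) = inv (y [^] e)" by (intro inv_equality[symmetric]) simp_all
    then have "c [^] (2::int) \<in> G3 G"
      using y_G3 normal_imp_subgroup[OF G3_normal]
      by (simp add: subgroup.m_inv_closed subgroup_int_pow_closed)
    then show False using c_sq_not_G3 by simp
  qed
qed

lemma centralizer_D_I:
  assumes g: "g \<in> carrier G" and "c \<otimes> g = g \<otimes> c"
  shows "g \<in> centralizer G D"
proof -
  have "g \<otimes> h = h \<otimes> g" if h: "h \<in> D" for h
  proof -
    obtain i j where e: "h = c [^] (i::int) \<otimes> y [^] (j::int)" using h by (rule D_cases)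
    have "c [^] i \<otimes> g = g \<otimes> c [^] i" using conj_int_pow[OF g c c assms(2)] .
    then show ?thesis
      unfolding e using y_pow_comm[OF g, of j] g by (metis c y int_pow_closed m_assoc)
  qed
  then show ?thesis using g by (simp add: centralizer_def)
qed

lemma expo:
  assumes "x \<in> centralizer G D"
  shows "x [^] ((2::int) ^ (n - 1)) \<in> \<Phi>"
proof (rule centralizer_pow[OF m2 _ assms])
  show "\<Phi> \<subseteq> centralizer G D"
    using Phi_central D_carrier subgroup.mem_carrier[OF Phi_subgroup] by (auto simp: centralizer_def)
qed

text \<open>If \<open>a\<close> centralized \<open>c\<close>, it would lie in the centralizer of
  \<open>D\<close>, whose exponent modulo \<open>\<Phi>\<close> divides \<open>2 ^ (n - 1)\<close>;
  the image of \<open>a\<close> does not satisfy this.\<close>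

lemma ca: "c \<otimes> a = a \<otimes> (c \<otimes> y)"
proof -
  obtain e :: int where e: "c \<otimes> a = a \<otimes> (c \<otimes> y [^] e)" "e = 0 \<or> e = 1" using c_swap[OF a] by blast
  have "e \<noteq> 0"
  proof
    assume "e = 0"
    then have "a \<in> centralizer G D" using e(1) by (intro centralizer_D_I) simp_all
    then show False using expo a_pow by blast
  qed
  then show ?thesis using e by simp
qed

text \<open>Modulo \<open>\<Phi>\<close> the commutator of \<open>a\<close> and \<open>b\<close> is
  central of exponent 2, so the \<open>2 ^ (n - 1)\<close>-th power of \<open>b \<otimes> a\<close>
  is the product of the powers. The power of \<open>b\<close> vanishes there because
  \<open>m < n\<close>, so the power of \<open>a\<close> would have to vanish too.\<close>

lemma ba_not_centralizer: "b \<otimes> a \<notin> centralizer G D"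
proof
  assume ba: "b \<otimes> a \<in> centralizer G D"
  interpret Phi: normal \<Phi> G by (rule Phi_normal)
  interpret Q: group "G Mod \<Phi>" by (rule Phi.factorgroup_is_group)
  let ?q = "\<lambda>x. \<Phi> #> x"
  interpret h: group_hom G "G Mod \<Phi>" ?q
    by (intro group_hom.intro group_hom_axioms.intro group_axioms Q.group_axioms Phi.r_coset_hom_Mod)
  have qmult: "?q x \<otimes>\<^bsub>G Mod \<Phi>\<^esub> ?q x' = ?q (x \<otimes> x')" if "x \<in> carrier G" "x' \<in> carrier G" for x x'
    using h.hom_mult[OF that] by simp
  have qone: "?q x = \<one>\<^bsub>G Mod \<Phi>\<^esub>" if "x \<in> \<Phi>" for x
    using coset_join2[OF _ Phi_subgroup that] subgroup.mem_carrier[OF Phi_subgroup that] by simp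
  have qc: "?q c \<otimes>\<^bsub>G Mod \<Phi>\<^esub> ?q g = ?q g \<otimes>\<^bsub>G Mod \<Phi>\<^esub> ?q c" if g: "g \<in> carrier G" for g
  proof -
    obtain e :: int where e: "c \<otimes> g = g \<otimes> (c \<otimes> y [^] e)" using c_swap[OF g] by blast
    have qy: "?q (y [^] e) = \<one>\<^bsub>G Mod \<Phi>\<^esub>"
      by (rule qone) (rule subgroup_int_pow_closed[OF Phi_subgroup y_Phi])
    have "?q (c \<otimes> y [^] e) = ?q c \<otimes>\<^bsub>G Mod \<Phi>\<^esub> ?q (y [^] e)"
      by (rule h.hom_mult) simp_all
    also have "\<dots> = ?q c" unfolding qy by (rule Q.r_one) (rule h.hom_closed[OF c])
    finally have "?q (g \<otimes> (c \<otimes> y [^] e)) = ?q g \<otimes>\<^bsub>G Mod \<Phi>\<^esub> ?q c"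
      using h.hom_mult[of g "c \<otimes> y [^] e"] g by simp
    then show ?thesis using qmult[OF c g] e by simp
  qed
  interpret F: heisenberg_gens "G Mod \<Phi>" "?q b" "?q a" "?q c"
  proof unfold_locales
    show "?q a \<otimes>\<^bsub>G Mod \<Phi>\<^esub> ?q b = ?q b \<otimes>\<^bsub>G Mod \<Phi>\<^esub> (?q a \<otimes>\<^bsub>G Mod \<Phi>\<^esub> ?q c)"
      using ab by (simp only: qmult a b c m_closed m_assoc)
    show "?q c [^]\<^bsub>G Mod \<Phi>\<^esub> (2::int) = \<one>\<^bsub>G Mod \<Phi>\<^esub>"
      using h.hom_int_pow[of c 2] qone[OF c_sq_Phi] by simp
    show "?q c \<otimes>\<^bsub>G Mod \<Phi>\<^esub> ?q b = ?q b \<otimes>\<^bsub>G Mod \<Phi>\<^esub> ?q c"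
      "?q c \<otimes>\<^bsub>G Mod \<Phi>\<^esub> ?q a = ?q a \<otimes>\<^bsub>G Mod \<Phi>\<^esub> ?q c"
      using qc by simp_all
  qed (use h.hom_closed in auto)
  let ?e = "(2::int) ^ (n - 1)"
  have n: "n - 1 = (n - 3) + 2" using m2 mn by simp
  have be: "b [^] ?e \<in> \<Phi>"
  proof -
    have "?e = 2 ^ m * 2 ^ (n - 1 - m)" using mn by (simp flip: power_add)
    then have "b [^] ?e = (b [^] ((2::int) ^ m)) [^] ((2::int) ^ (n - 1 - m))"
      by (simp add: int_pow_pow)
    then show ?thesis using subgroup_int_pow_closed[OF Phi_subgroup b_pow] by simp
  qed
  have "\<one>\<^bsub>G Mod \<Phi>\<^esub> = ?q ((b \<otimes> a) [^] ?e)"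
    by (rule qone[OF expo[OF ba], symmetric])
  also have "\<dots> = ?q (b \<otimes> a) [^]\<^bsub>G Mod \<Phi>\<^esub> ?e"
    by (rule h.hom_int_pow) simp
  also have "\<dots> = F.F 1 1 0 [^]\<^bsub>G Mod \<Phi>\<^esub> ?e"
    unfolding F.F_0(2) qmult[OF b a] ..
  also have "\<dots> = F.F ?e ?e 0"
    using F.F_1_1_pow[of 0 "n - 3"] unfolding n[symmetric] .
  also have "\<dots> = ?q (b [^] ?e) \<otimes>\<^bsub>G Mod \<Phi>\<^esub> ?q (a [^] ?e)"
    unfolding F.F_0(1) h.hom_int_pow[OF b] h.hom_int_pow[OF a] ..
  also have "\<dots> = ?q (a [^] ?e)"
    unfolding qone[OF be] by (rule Q.l_one) (rule h.hom_closed, simp)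
  finally have "?q (a [^] ?e) = \<Phi>" by simp
  then have "a [^] ?e \<in> \<Phi>"
    using rcos_self[OF _ Phi_subgroup, of "a [^] ?e"] by simp
  then show False using a_pow by simp
qed

text \<open>If \<open>b\<close> did not commute with \<open>c\<close>, moving \<open>c\<close> past
  \<open>b\<close> and past \<open>a\<close> would each produce \<open>y\<close>, and
  \<open>b \<otimes> a\<close> would centralize \<open>D\<close>.\<close>

lemma cb: "c \<otimes> b = b \<otimes> c"
proof -
  obtain e :: int where e: "c \<otimes> b = b \<otimes> (c \<otimes> y [^] e)" "e = 0 \<or> e = 1" using c_swap[OF b] by blast
  have "e \<noteq> 1"
  proof
    assume 1: "e = 1"
    have "c \<otimes> (b \<otimes> a) = b \<otimes> (c \<otimes> (y \<otimes> a))"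
      using e(1) 1 by (simp add: m_assoc[symmetric])
    also have "\<dots> = b \<otimes> ((c \<otimes> a) \<otimes> y)" using y_central[of a] by (simp add: m_assoc)
    also have "\<dots> = (b \<otimes> a) \<otimes> c" unfolding ca by (simp add: m_assoc y_sq)
    finally have "b \<otimes> a \<in> centralizer G D" by (intro centralizer_D_I) simp_all
    then show False using ba_not_centralizer by simp
  qed
  then show ?thesis using e by simp
qed

lemma ac: "a \<otimes> c = c \<otimes> a \<otimes> y"
  unfolding ca by (simp add: m_assoc y_sq)

lemma commutator_a_c: "commutator G a c = y"
  using commutator_eq_iff[of a c y] ac by simp

sublocale class3_gens G a b c y
  by unfold_locales (use ab ac cb y_central y2 c4 in simp_all)

lemma normal_form:
  assumes "x \<in> carrier G"
  shows "\<exists>i j k l. x = E i j k l"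
proof -
  let ?S = "{E i j k l |i j k l. True}"
  have S: "subgroup ?S G"
  proof (rule subgroupI)
    show "inv x \<in> ?S" if "x \<in> ?S" for x using that by (clarsimp simp: E_inv) blast
    show "x \<otimes> x' \<in> ?S" if "x \<in> ?S" "x' \<in> ?S" for x x'
      using that by (clarsimp simp: E_mult) blast
    show "?S \<noteq> {}" by blast
  qed auto
  have "a = E 1 0 0 0" "b = E 0 1 0 0" by (simp_all add: E_a E_b)
  then have "a \<in> ?S" "b \<in> ?S" by blast+
  moreover have "\<Phi> \<subseteq> ?S"
  proof
    fix x assume "x \<in> \<Phi>"
    then obtain k l where "x = c [^] (2 * k::int) \<otimes> y [^] (l::int)" by (rule Phi_cases)
    then have "x = E 0 0 (2 * k) l" by (simp add: E_cy)
    then show "x \<in> ?S" by blast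
  qed
  ultimately have "x \<in> ?S" using carrier_of_gens[OF S _ _ _ assms] by blast
  then show ?thesis by blast
qed

lemma nontrivial: "E 0 0 2 0 \<noteq> \<one>" "E 0 0 0 1 \<noteq> \<one>" "E 0 0 2 1 \<noteq> \<one>"
proof -
  show "E 0 0 2 0 \<noteq> \<one>" using c_sq_not_G3 G3_eq by (simp add: E_c)
  show "E 0 0 0 1 \<noteq> \<one>" using y1 by (simp add: E_y)
  show "E 0 0 2 1 \<noteq> \<one>"
  proof
    assume "E 0 0 2 1 = \<one>"
    then have "c [^] (2::int) \<otimes> y = \<one>" by (simp add: E_cy)
    then have "c [^] (2::int) = inv y" by (intro inv_equality[symmetric]) simp_all
    also have "inv y = y" using y_sq by (intro inv_equality) simp_all
    finally show False using c_sq_not_G3 G3_eq by simp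
  qed
qed

end

section \<open>Indices of the minimal non-abelian subgroups\<close>

lemma DirProd_nat_pow: "x [^]\<^bsub>G \<times>\<times> H\<^esub> (k::nat) = (fst x [^]\<^bsub>G\<^esub> k, snd x [^]\<^bsub>H\<^esub> k)"
  by (induction k) (simp_all add: mult_DirProd')

lemma The_pow_two: "(THE i. 2 ^ i = (2::nat) ^ k) = k"
  by (rule the_equality) simp_all

lemma square_eq_one_of_iso:
  assumes P: "group P" and iso: "P \<cong> integer_mod_group 2 \<times>\<times> integer_mod_group 2"
    and x: "x \<in> carrier P"
  shows "x \<otimes>\<^bsub>P\<^esub> x = \<one>\<^bsub>P\<^esub>"
proof -
  let ?Z = "integer_mod_group 2 \<times>\<times> integer_mod_group 2"
  interpret P: group P by (rule P)
  have Z: "group ?Z" by (simp add: DirProd_group)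
  obtain f where f: "f \<in> iso P ?Z" using iso by (auto simp: is_iso_def)
  then have hom: "f \<in> hom P ?Z" and inj: "inj_on f (carrier P)"
    by (simp_all add: iso_iff iso_imp_homomorphism)
  have "f (x \<otimes>\<^bsub>P\<^esub> x) = f x \<otimes>\<^bsub>?Z\<^esub> f x" using hom x by (simp add: hom_mult)
  also have "\<dots> = \<one>\<^bsub>?Z\<^esub>" by (cases "f x") simp
  also have "\<dots> = f \<one>\<^bsub>P\<^esub>" using hom_one[OF hom P Z] by simp
  finally show ?thesis using inj_onD[OF inj] x by blast
qed

lemma pow_eq_one_of_iso:
  assumes Q: "group Q" and mn: "m < n" "2 \<le> n"
    and iso: "Q \<cong> integer_mod_group (2 ^ (n - 1)) \<times>\<times> integer_mod_group (2 ^ m) \<times>\<times> integer_mod_group 2"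
    and x: "x \<in> carrier Q"
  shows "x [^]\<^bsub>Q\<^esub> ((2::nat) ^ (n - 1)) = \<one>\<^bsub>Q\<^esub>"
proof -
  let ?Z = "integer_mod_group (2 ^ (n - 1)) \<times>\<times> integer_mod_group (2 ^ m) \<times>\<times> integer_mod_group 2"
  interpret Q: group Q by (rule Q)
  have Z: "group ?Z" by (simp add: DirProd_group)
  obtain f where f: "f \<in> iso Q ?Z" using iso by (auto simp: is_iso_def)
  then have hom: "f \<in> hom Q ?Z" and inj: "inj_on f (carrier Q)"
    by (simp_all add: iso_iff iso_imp_homomorphism)
  have "(2::int) ^ m dvd 2 ^ (n - 1)" using mn by (intro le_imp_power_dvd) simp
  moreover have "(2::int) dvd 2 ^ (n - 1)" using mn by simp
  ultimately have "t [^]\<^bsub>?Z\<^esub> ((2::nat) ^ (n - 1)) = \<one>\<^bsub>?Z\<^esub>" for t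
    by (simp add: DirProd_nat_pow)
  then have "f (x [^]\<^bsub>Q\<^esub> ((2::nat) ^ (n - 1))) = f \<one>\<^bsub>Q\<^esub>"
    using hom_nat_pow[OF hom x Q Z] hom_one[OF hom Q Z] by simp
  then show ?thesis using inj_onD[OF inj] x by blast
qed

lemma (in G3_order_2) pow_mem_Phi_of_iso:
  assumes "m < n" "2 \<le> m" and x: "x \<in> centralizer G D"
    and central: "\<Phi> \<subseteq> centralizer G D"
    and iso: "G\<lparr>carrier := centralizer G D\<rparr> Mod \<Phi> \<cong>
      integer_mod_group (2 ^ (n - 1)) \<times>\<times> integer_mod_group (2 ^ m) \<times>\<times> integer_mod_group 2"
  shows "x [^] ((2::int) ^ (n - 1)) \<in> \<Phi>"
proof -
  let ?C = "G\<lparr>carrier := centralizer G D\<rparr>" and ?e = "(2::nat) ^ (n - 1)"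
  have sub: "subgroup (centralizer G D) G"
    by (rule subgroup_centralizer) (use D_carrier in blast)
  have xc: "x \<in> carrier G" using sub x by (rule subgroup.mem_carrier)
  interpret Phi: normal \<Phi> ?C
    by (rule normal_restrict_supergroup[OF sub Phi_normal central])
  have "\<Phi> #>\<^bsub>?C\<^esub> x \<in> carrier (?C Mod \<Phi>)"
    using x by (auto simp: carrier_FactGroup)
  then have "(\<Phi> #>\<^bsub>?C\<^esub> x) [^]\<^bsub>?C Mod \<Phi>\<^esub> ?e = \<one>\<^bsub>?C Mod \<Phi>\<^esub>"
    using assms by (intro pow_eq_one_of_iso[OF Phi.factorgroup_is_group _ _ iso]) simp_all
  then have "\<Phi> #> (x [^] ?e) = \<Phi>"
    using Phi.FactGroup_pow[of x ?e] x by (simp add: nat_pow_consistent[symmetric])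
  then have "x [^] ?e \<in> \<Phi>"
    using rcos_self[OF _ Phi_subgroup, of "x [^] ?e"] xc by simp
  then show ?thesis using int_pow_int[of G x ?e] by simp
qed


section \<open>The minimal and the maximal index\<close>

lemma (in tower_group) A1_indices_pow_two:
  assumes "i \<in> A1_indices G"
  shows "\<exists>k. i = 2 ^ k"
  using assms index_pow_two unfolding A1_indices_def by blast

lemma (in tower_group) finite_A1_indices: "finite (A1_indices G)"
proof -
  have "A1_indices G \<subseteq> {..order G}"
  proof
    fix i assume "i \<in> A1_indices G"
    then obtain H where H: "i = card (rcosets H)" "subgroup H G" unfolding A1_indices_def by blast
    have "i dvd order G" unfolding lagrange[OF H(2), symmetric] H(1) by simp
    then show "i \<in> {..order G}" using order by (simp add: dvd_imp_le)
  qed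
  then show ?thesis by (rule finite_subset) simp
qed

text \<open>The set of indices is finite, non-empty and consists of powers of 2, so the exponents
  described in \<open>I_min\<close> and \<open>I_max\<close> exist and are unique.\<close>

lemma (in tower_group) Min_Max_A1_indices:
  shows "2 ^ I_min G \<in> A1_indices G" "2 ^ I_max G \<in> A1_indices G"
    and "i \<in> A1_indices G \<Longrightarrow> i \<le> 2 ^ I_max G"
proof -
  have ne: "A1_indices G \<noteq> {}" using A1_large_index unfolding A1_indices_def by blast
  obtain k where k: "Min (A1_indices G) = 2 ^ k"
    using A1_indices_pow_two[OF Min_in[OF finite_A1_indices ne]] by blast
  obtain l where l: "Max (A1_indices G) = 2 ^ l"
    using A1_indices_pow_two[OF Max_in[OF finite_A1_indices ne]] by blast
  have kl: "I_min G = k" "I_max G = l"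
    unfolding I_min_def I_max_def k l by (rule The_pow_two)+
  show "2 ^ I_min G \<in> A1_indices G" "2 ^ I_max G \<in> A1_indices G"
    using Min_in[OF finite_A1_indices ne] Max_in[OF finite_A1_indices ne] unfolding kl k l by simp_all
  show "i \<le> 2 ^ I_max G" if "i \<in> A1_indices G"
    using Max_ge[OF finite_A1_indices that] unfolding kl l .
qed

lemma (in tower_group) I_min_I_max:
  "2 \<le> I_min G" "2 \<notin> A1_indices G" "m \<le> I_max G"
  "I_max G = 2 \<longleftrightarrow> m = 2 \<and> odd (w11 + w12) \<and> (odd w12 \<or> odd w22)"
proof -
  have gt: "2 < i" if "i \<in> A1_indices G" for i
    using that A1_index_gt_2 unfolding A1_indices_def by blast
  then show "2 \<notin> A1_indices G" by blast
  have "(2::nat) ^ 1 < 2 ^ I_min G" using gt[OF Min_Max_A1_indices(1)] by simp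
  then have "1 < I_min G" by (rule power_less_imp_less_exp[rotated]) simp
  then show "2 \<le> I_min G" by simp
  obtain H where "subgroup H G" "A1_group 2 (G\<lparr>carrier := H\<rparr>)" and H: "2 ^ m \<le> card (rcosets H)"
    using A1_large_index by blast
  then have "card (rcosets H) \<in> A1_indices G" unfolding A1_indices_def by blast
  then have "(2::nat) ^ m \<le> 2 ^ I_max G" using Min_Max_A1_indices(3) H le_trans by blast
  then show m: "m \<le> I_max G" by (rule power_le_imp_le_exp[rotated]) simp
  show "I_max G = 2 \<longleftrightarrow> m = 2 \<and> odd (w11 + w12) \<and> (odd w12 \<or> odd w22)"
  proof
    assume 2: "I_max G = 2"
    then have m': "m = 2" using m m2 by simp
    have "odd (w11 + w12) \<and> (odd w12 \<or> odd w22)"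
    proof (rule ccontr)
      assume "\<not> (odd (w11 + w12) \<and> (odd w12 \<or> odd w22))"
      from A1_index_ge_8_cases[OF m' this] obtain K
        where "subgroup K G" "A1_group 2 (G\<lparr>carrier := K\<rparr>)" and K: "8 \<le> card (rcosets K)" by blast
      then have "card (rcosets K) \<in> A1_indices G" unfolding A1_indices_def by blast
      then show False using Min_Max_A1_indices(3)[of "card (rcosets K)"] K 2 by simp
    qed
    with m' show "m = 2 \<and> odd (w11 + w12) \<and> (odd w12 \<or> odd w22)" by simp
  next
    assume c: "m = 2 \<and> odd (w11 + w12) \<and> (odd w12 \<or> odd w22)"
    obtain K where "subgroup K G" "A1_group 2 (G\<lparr>carrier := K\<rparr>)" "2 ^ I_max G = card (rcosets K)"
      using Min_Max_A1_indices(2) unfolding A1_indices_def by blast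
    then have "(2::nat) ^ I_max G \<le> 2 ^ 2" using A1_index_le_4[of K] c by simp
    then have "I_max G \<le> 2" by (rule power_le_imp_le_exp[rotated]) simp
    then show "I_max G = 2" using m c by simp
  qed
qed

lemma (in group) I_min_I_max_of_presentation:
  fixes n m :: nat and w :: "bit^2^2"
  assumes "p_group 2 G"
    and "G\<lparr>carrier := G3 G\<rparr> \<cong> integer_mod_group 2"
    and "G\<lparr>carrier := PhiG3 G\<rparr> \<cong> integer_mod_group 2 \<times>\<times> integer_mod_group 2"
    and "G Mod PhiG3 G \<cong> M2_group n m"
    and "G\<lparr>carrier := centralizer G (derived_subgroup G)\<rparr> Mod PhiG3 G \<cong>
           integer_mod_group (2 ^ (n - 1)) \<times>\<times> integer_mod_group (2 ^ m) \<times>\<times> integer_mod_group 2"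
    and "n > m"
    and "characteristic_matrix G n m w"
  shows "(I_min G \<ge> 2 \<and> 2 \<notin> A1_indices G) \<and>
         I_max G \<ge> m \<and>
         (I_max G = 2 \<longleftrightarrow>
           m = 2 \<and> (w $ 1 $ 1 = 0 \<and> w $ 1 $ 2 = 1 \<or>
                    w $ 1 $ 2 = 0 \<and> w $ 1 $ 1 = 1 \<and> w $ 2 $ 2 = 1))"
proof -
  obtain N where N: "order G = 2 ^ N" using assms(1) by (auto simp: p_group_def)
  have "card (G3 G) = card {0..<2::int}"
    using iso_same_card[OF assms(2)] by (simp add: carrier_integer_mod_group)
  then have "card (G3 G) = 2" by simp
  then obtain p q where pq: "G3 G = {p, q}" "p \<noteq> q" unfolding card_2_iff by blast
  have "\<one> \<in> G3 G" using subgroup.one_closed[OF normal_imp_subgroup[OF G3_normal]] .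
  then have "G3 G = {\<one>, p} \<and> p \<noteq> \<one> \<or> G3 G = {\<one>, q} \<and> q \<noteq> \<one>" using pq by auto
  then obtain y where y: "G3 G = {\<one>, y}" "y \<noteq> \<one>" by blast
  interpret G3_order_2 G N y by unfold_locales (use N y in auto)
  have "card (PhiG3 G) = card ({0..<2::int} \<times> {0..<2::int})"
    using iso_same_card[OF assms(3)] by (simp add: carrier_integer_mod_group)
  then have card_Phi: "card (PhiG3 G) = 4" by (simp add: card_cartesian_product)
  have Phi_sq: "x \<otimes> x = \<one>" if "x \<in> PhiG3 G" for x
    using square_eq_one_of_iso[OF subgroup_imp_group[OF Phi_subgroup] assms(3)] that by simp
  obtain a b where gens: "characteristic_generators G n m a b"
    and an: "a [^] ((2::nat) ^ n) = commutator G a b [^] (2 * of_bit (w $ 1 $ 1) :: nat) \<otimes>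
      commutator G a (commutator G a b) [^] (of_bit (w $ 1 $ 2) :: nat)"
    and bm: "b [^] ((2::nat) ^ m) = commutator G a b [^] (2 * of_bit (w $ 2 $ 1) :: nat) \<otimes>
      commutator G a (commutator G a b) [^] (of_bit (w $ 2 $ 2) :: nat)"
    using assms(7) unfolding characteristic_matrix_def Let_def by blast
  note g = gens[unfolded characteristic_generators_def Let_def]
  have a: "a \<in> carrier G" and b: "b \<in> carrier G" using g by blast+
  interpret Phi: normal \<Phi> G by (rule Phi_normal)
  interpret Q: group "G Mod \<Phi>" by (rule Phi.factorgroup_is_group)
  \<comment> \<open>Turns the order conditions on the images in the quotient into membership of
    powers in \<open>\<Phi>\<close>.\<close>
  have mem_Phi: "x [^] k \<in> \<Phi> \<longleftrightarrow> (\<Phi> #> x) [^]\<^bsub>G Mod \<Phi>\<^esub> k = \<one>\<^bsub>G Mod \<Phi>\<^esub>"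
    if "x \<in> carrier G" for x and k :: nat
    using that Phi.FactGroup_pow[OF that, of k] rcos_self[OF _ Phi_subgroup, of "x [^] k"]
      coset_join2[OF _ Phi_subgroup, of "x [^] k"] by auto
  have to_int: "x [^] ((2::int) ^ k) = x [^] ((2::nat) ^ k)" for x k
    using int_pow_int[of G x "2 ^ k"] by simp
  interpret char_setup G N y a b n m
  proof unfold_locales
    show "card \<Phi> = 4" by (rule card_Phi)
    show "x \<otimes> x = \<one>" if "x \<in> \<Phi>" for x using Phi_sq[OF that] .
    show "a \<in> carrier G" "b \<in> carrier G" by fact+
    show "generate (G Mod \<Phi>) {\<Phi> #> a, \<Phi> #> b} = carrier (G Mod \<Phi>)" using g by blast
    show "b [^] ((2::int) ^ m) \<in> \<Phi>" unfolding to_int mem_Phi[OF b] using g by blast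
    show "a [^] ((2::int) ^ (n - 1)) \<notin> \<Phi>"
    proof
      assume "a [^] ((2::int) ^ (n - 1)) \<in> \<Phi>"
      then have pow: "(\<Phi> #> a) [^]\<^bsub>G Mod \<Phi>\<^esub> ((2::nat) ^ (n - 1)) = \<one>\<^bsub>G Mod \<Phi>\<^esub>"
        unfolding to_int mem_Phi[OF a] .
      have car: "\<Phi> #> a \<in> carrier (G Mod \<Phi>)" using a by (simp add: carrier_FactGroup)
      have ord: "Q.ord (\<Phi> #> a) = 2 ^ n" using g by blast
      have "(2::nat) ^ n dvd 2 ^ (n - 1)"
        using iffD1[OF Q.pow_eq_id[OF car] pow] unfolding ord .
      then have "n \<le> n - 1" by (rule power_dvd_imp_le) simp
      then show False using assms(6) by simp
    qed
    show "m < n" by (rule assms(6))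
    show "x [^] ((2::int) ^ (n - 1)) \<in> \<Phi>"
      if "2 \<le> m" "\<Phi> \<subseteq> centralizer G D" "x \<in> centralizer G D" for x
      by (rule pow_mem_Phi_of_iso[OF assms(6) that(1,3,2) assms(5)])
  qed
  \<comment> \<open>The lower bound for the order of \<open>M2_group n m\<close> becomes one for the
    quotient, and the factor 4 from \<open>\<Phi>\<close> turns \<open>n + m + 1\<close> into
    \<open>n + m + 3\<close>.\<close>
  have "finite (carrier (G Mod \<Phi>))"
    using finite_carrier by (simp add: carrier_FactGroup)
  then have "2 ^ (n + m + 1) \<le> card (carrier (M2_group n m))"
    using iso_finite[OF assms(4)] m2 mn by (intro card_M2_group_ge) simp_all
  also have "\<dots> = card (rcosets \<Phi>)"
    using iso_same_card[OF assms(4)] by (simp add: FactGroup_def)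
  finally have "2 ^ (n + m + 1) * 4 \<le> card (rcosets \<Phi>) * card \<Phi>" by (simp add: card_Phi)
  then have order_ge: "2 ^ (n + m + 3) \<le> order G"
    unfolding lagrange[OF Phi_subgroup] by (simp add: power_add)
  let ?w = "\<lambda>i j. of_bit (w $ i $ j) :: int"
  have pow: "c [^] (2 * of_bit s :: nat) \<otimes> y [^] (of_bit t :: nat) = E 0 0 (2 * of_bit s) (of_bit t)"
    for s t :: bit
    using int_pow_int[of G c "2 * of_bit s"] int_pow_int[of G y "of_bit t"] by (simp add: E_cy)
  note an = an[folded c_def, unfolded commutator_a_c pow]
  note bm = bm[folded c_def, unfolded commutator_a_c pow]
  interpret tower_group G a b c y n m N "?w 1 1" "?w 1 2" "?w 2 1" "?w 2 2"
    by unfold_locales (use N order_ge normal_form nontrivial m2 mn an bm in \<open>simp_all add: to_int\<close>)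
  \<comment> \<open>An odd sum means that exactly one entry of the first row is 1; if that is not
    the second one, \<open>w $ 2 $ 2\<close> has to be 1.\<close>
  have "(odd (?w 1 1 + ?w 1 2) \<and> (odd (?w 1 2) \<or> odd (?w 2 2))) \<longleftrightarrow>
      (w $ 1 $ 1 = 0 \<and> w $ 1 $ 2 = 1 \<or> w $ 1 $ 2 = 0 \<and> w $ 1 $ 1 = 1 \<and> w $ 2 $ 2 = 1)"
    by (cases "w $ 1 $ 1"; cases "w $ 1 $ 2"; cases "w $ 2 $ 2") simp_all
  with I_min_I_max show ?thesis by simp
qed

theorem theorem5p6:
  fixes G :: "('a, 'b) monoid_scheme" and n m :: nat and w :: "bit^2^2"
  assumes "p_group 2 G"
    and "G\<lparr>carrier := G3 G\<rparr> \<cong> integer_mod_group 2"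
    and "G\<lparr>carrier := PhiG3 G\<rparr> \<cong> integer_mod_group 2 \<times>\<times> integer_mod_group 2"
    and "G Mod PhiG3 G \<cong> M2_group n m"
    and "G\<lparr>carrier := centralizer G (derived_subgroup G)\<rparr> Mod PhiG3 G \<cong>
           integer_mod_group (2 ^ (n - 1)) \<times>\<times> integer_mod_group (2 ^ m) \<times>\<times> integer_mod_group 2"
    and "n > m"
    and "characteristic_matrix G n m w"
  shows "(I_min G \<ge> 2 \<and> 2 \<notin> A1_indices G) \<and>
         I_max G \<ge> m \<and>
         (I_max G = 2 \<longleftrightarrow>
           m = 2 \<and> (w $ 1 $ 1 = 0 \<and> w $ 1 $ 2 = 1 \<or>
                    w $ 1 $ 2 = 0 \<and> w $ 1 $ 1 = 1 \<and> w $ 2 $ 2 = 1))"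
proof -
  interpret group G using assms(1) by (simp add: p_group_def)
  show ?thesis using assms by (rule I_min_I_max_of_presentation)
qed

end
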